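(* Let $\mathcal{P}$ be the set of all primes. Suppose that $\mathcal{P}\sim\mathcal{A}+\mathcal{B}$, where $\mathcal{A},\mathcal{B}$ are sets of positive integers containing at least two elements each. Then $$\frac{x^{1/2}}{\log x\,\log\log x}\ll\mathcal{A}(x)\ll x^{1/2}\log\log x,$$ and the same bounds hold for $\mathcal{B}(x)$.
   Context: For sets of positive integers, $\mathcal{A}+\mathcal{B}:=\{a+b: a\in\mathcal{A}, b\in\mathcal{B}\}$. We write $\mathcal{S}\sim\mathcal{A}+\mathcal{B}$ if there is some $x_0$ with $(\mathcal{A}+\mathcal{B})\cap[x_0,\infty)=\mathcal{S}\cap[x_0,\infty)$. The counting function is $\mathcal{A}(x):=\#\{n\le x: n\in\mathcal{A}\}$, and similarly $\mathcal{B}(x)$. The notation $F(x)\ll G(x)$ means that there is an absolute constant $C_0>0$ with $F(x)\le C_0G(x)$ for all sufficiently large $x$ (how large may depend on the sets involved). *)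

theory Defs
  imports
    Complex_Main
    "HOL-Library.Set_Algebras"
    "HOL-Computational_Algebra.Primes"
begin

text \<open>Sumsets \<open>A + B\<close> are the elementwise sums of \<^theory>\<open>HOL-Library.Set_Algebras\<close>.\<close>

definition ev_eq_set :: "nat set \<Rightarrow> nat set \<Rightarrow> bool"  (infix "\<sim>\<^sub>e" 50) where
  "S \<sim>\<^sub>e T \<longleftrightarrow> (\<exists>x0. T \<inter> {x0..} = S \<inter> {x0..})"

definition counting :: "nat set \<Rightarrow> real \<Rightarrow> real" where
  "counting A x = real (card {n \<in> A. real n \<le> x})"

text \<open>
  \<open>F \<lless>[C] G\<close> is the Vinogradov relation with its constant made explicit: absoluteness of the
  constant is expressed by binding \<open>C\<close> outside the sets that \<open>F\<close> and \<open>G\<close> depend on, whereas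
  the threshold hidden in \<open>eventually\<close> may depend on those sets.
\<close>

definition vinogradov :: "(real \<Rightarrow> real) \<Rightarrow> real \<Rightarrow> (real \<Rightarrow> real) \<Rightarrow> bool"
    ("(_ \<lless>[_] _)" [51, 0, 51] 50) where
  "F \<lless>[C] G \<longleftrightarrow> (\<forall>\<^sub>F x in at_top. F x \<le> C * G x)"

end

theory Submission
  imports
    Defs
    "HOL-Library.FuncSet"
    "HOL-Computational_Algebra.Squarefree"
    "HOL-Analysis.Convex"
    "HOL-Analysis.Summation_Tests"
    "HOL-Real_Asymp.Real_Asymp"
begin

text \<open>
  For a prime \<open>p\<close> no \<open>a + b\<close> with \<open>a, b\<close> large is divisible by \<open>p\<close>, so \<open>A\<close> avoids the negatives
  of the residue classes occupied by \<open>B\<close>. If \<open>B\<close> occupies many classes, the large sieve bounds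
  \<open>A(x)\<close> from above; as \<open>A(x) B(x) \<ge> \<pi>(x) - O(1)\<close>, this bounds \<open>B(x)\<close> from below; and by
  Gallagher's larger sieve a set with many elements occupies many classes. Going round this circle,
  finitely many elements of \<open>B\<close> give \<open>B(x) \<ge> c (log x)^4\<close>, then \<open>B(x) \<ge> x^(1/20)\<close>, then
  \<open>B(x) \<ge> x^(1/2) (log x)^(-C)\<close>. At that point both sets occupy about half of the classes modulo
  most primes, with an average error small enough that the sieve loses only a constant factor:
  \<open>A(x) \<le> K x^(1/2)\<close>. Here \<open>K\<close> depends on the sets, but the factor \<open>log log x\<close> absorbs it.
\<close>

section \<open>Chebyshev and Mertens bounds\<close>

text \<open>The product bound A(x) B(x) >> x / log x costs one logarithm whenever an upper bound is
  turned into a lower one, so each turn of the circle must save more than one logarithm; the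
  tightest instance is the very first, with two elements of \<open>B\<close>. The same sieve sum is
  bounded below in three ways: with one prime at most from each interval (w, w^2] while only
  boundedly many classes are known; with products of many primes of size up to (log x)^3 once B(x)
  exceeds that size; and with all squarefree moduli up to sqrt x at the end. In the last case a
  prime with \<nu> occupied classes has weight \<nu>/(p - \<nu>), which is 1 at half of the classes,
  and the sieve gives sqrt x times a constant times exp(4 H), where H sums the positive parts of
  ln((p - \<nu>)/\<nu>)/p. A larger sieve bound with an unspecified constant yields only H << log
  log x, that is, powers of log x. A bounded H requires the exact leading coefficient 2 in the
  larger sieve for both sets. Mertens' first theorem with bounded error is all that is used about
  the distribution of primes.\<close>

definition primes_in :: "real \<Rightarrow> real \<Rightarrow> nat set" where
  "primes_in y z = {p. prime p \<and> y < real p \<and> real p \<le> z}"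

lemma finite_primes_in [simp, intro]: "finite (primes_in y z)"
  by (rule finite_subset[of _ "{..nat \<lfloor>z\<rfloor>}"]) (auto simp: primes_in_def le_nat_floor)

lemma primes_in_1: "primes_in 1 (real n) = {p. prime p \<and> p \<le> n}"
  using prime_gt_1_nat by (auto simp: primes_in_def)

lemma primes_in_floor: "z \<ge> 0 \<Longrightarrow> primes_in y z = primes_in y (real (nat \<lfloor>z\<rfloor>))"
proof -
  assume "z \<ge> 0"
  hence "real p \<le> z \<longleftrightarrow> real p \<le> real (nat \<lfloor>z\<rfloor>)" for p
    using of_nat_floor[of z] le_nat_floor[of p z] of_nat_le_iff order_trans by metis
  thus ?thesis by (simp only: primes_in_def)
qed

lemma prod_primes_dvd:
  fixes n :: nat
  assumes "finite P" "\<And>p. p \<in> P \<Longrightarrow> prime p" "\<And>p. p \<in> P \<Longrightarrow> p dvd n"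
  shows "\<Prod>P dvd n"
  using assms
proof (induction P rule: finite_induct)
  case (insert p P)
  have "coprime p q" if "q \<in> P" for q
    using insert.hyps insert.prems(1) that by (intro primes_coprime) auto
  hence "coprime p (\<Prod>P)" by (intro prod_coprime_right)
  thus ?case using insert by (simp add: divides_mult)
qed simp

text \<open>Erdos's induction: for odd n = 2m + 1 the primes in (m + 1, n] all divide
  \<open>n choose m\<close>, which occurs twice in a row of sum 2^n and is therefore at most 4^m;
  the primes up to m + 1 are covered by the induction hypothesis. An even n > 2 is not prime and
  reduces to n - 1.\<close>

lemma prime_product_le: "(\<Prod>p | prime p \<and> p \<le> n. p) \<le> (4 :: nat) ^ n"
proof (induction n rule: less_induct)
  case (less n)
  have fin: "finite {p. prime p \<and> p \<le> k}" for k :: nat by (rule finite_subset[of _ "{..k}"]) auto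
  consider "n \<le> 1" | "n = 2" | "n > 2" "even n" | m where "n = 2 * m + 1" "m \<ge> 1"
  proof (cases "even n")
    case False
    then obtain m where "n = 2 * m + 1" by (elim oddE)
    thus ?thesis using that(1) that(4)[of m] by (cases "m = 0") simp_all
  next
    case True
    consider "n \<le> 1" | "n = 2" | "n > 2" by linarith
    thus ?thesis using that(1,2) that(3)[OF _ True] by cases blast+
  qed
  thus ?case
  proof cases
    case 1
    hence "{p. prime p \<and> p \<le> n} = {}" by (auto dest: prime_ge_2_nat)
    thus ?thesis by (simp only: prod.empty) simp
  next
    case 2
    have "p = 2" if "prime p" "p \<le> 2" for p :: nat using prime_ge_2_nat[OF that(1)] that(2) by linarith
    hence "{p. prime p \<and> p \<le> n} = {2 :: nat}" using 2 by auto
    thus ?thesis using 2 by simp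
  next
    case 3
    hence "\<not> prime n" using prime_odd_nat by auto
    hence "{p. prime p \<and> p \<le> n} = {p. prime p \<and> p \<le> n - 1}"
      using 3 by (auto simp: le_less)
    moreover have "(\<Prod>p | prime p \<and> p \<le> n - 1. p) \<le> (4 :: nat) ^ (n - 1)" using 3 by (intro less) auto
    moreover have "(4 :: nat) ^ (n - 1) \<le> 4 ^ n" by (intro power_increasing) auto
    ultimately show ?thesis by (metis order_trans)
  next
    case (4 m)
    define B where "B = {p. prime p \<and> m + 1 < p \<and> p \<le> n}"
    have finB: "finite B" by (rule finite_subset[of _ "{..n}"]) (auto simp: B_def)
    have eq: "{p. prime p \<and> p \<le> n} = {p. prime p \<and> p \<le> m + 1} \<union> B"
      using 4 by (auto simp: B_def)
    have dvd: "p dvd (n choose m)" if "p \<in> B" for p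
    proof -
      have p: "prime p" "m + 1 < p" "p \<le> n" using that by (auto simp: B_def)
      have "fact m * fact (n - m) * (n choose m) = (fact n :: nat)"
        using 4 by (intro binomial_fact_lemma) auto
      moreover have "p dvd fact n" using p by (simp add: prime_dvd_fact_iff)
      moreover have "\<not> p dvd fact m" "\<not> p dvd fact (n - m)"
        using p 4 prime_dvd_fact_iff[OF p(1), of m] prime_dvd_fact_iff[OF p(1), of "n - m"] by linarith+
      ultimately show ?thesis using p(1) by (metis prime_dvd_mult_iff)
    qed
    have "\<Prod>B dvd (n choose m)"
      using dvd finB by (intro prod_primes_dvd) (auto simp: B_def)
    moreover have "(n choose m) > 0" using 4 by simp
    ultimately have "\<Prod>B \<le> (n choose m)" by (intro dvd_imp_le)
    also have "(n choose m) \<le> 4 ^ m"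
    proof -
      have "(n choose m) = (n choose (m + 1))" using 4 binomial_symmetric[of m n] by simp
      moreover have "(n choose m) + (n choose (m + 1)) = (\<Sum>k\<in>{m, m + 1}. n choose k)" by simp
      moreover have "\<dots> \<le> (\<Sum>k\<le>n. n choose k)" using 4 by (intro sum_mono2) auto
      moreover have "\<dots> = 2 ^ n" by (rule choose_row_sum)
      moreover have "2 ^ n = 2 * (4 :: nat) ^ m" using 4 by (simp add: power_mult)
      ultimately show ?thesis by linarith
    qed
    finally have B: "\<Prod>B \<le> 4 ^ m" .
    have "(\<Prod>p | prime p \<and> p \<le> n. p) = (\<Prod>p | prime p \<and> p \<le> m + 1. p) * \<Prod>B"
      unfolding eq using finB by (intro prod.union_disjoint fin) (auto simp: B_def)
    also have "\<dots> \<le> 4 ^ (m + 1) * 4 ^ m"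
      using 4 by (intro mult_mono less B) auto
    also have "\<dots> = 4 ^ n" using 4 by (simp flip: power_add)
    finally show ?thesis .
  qed
qed

lemma theta_le:
  assumes "z \<ge> 0"
  shows "(\<Sum>p\<in>primes_in y z. ln (real p)) \<le> 2 * z"
proof -
  define n where "n = nat \<lfloor>z\<rfloor>"
  have "(\<Sum>p\<in>primes_in y z. ln (real p)) \<le> (\<Sum>p\<in>primes_in 1 (real n). ln (real p))"
    unfolding primes_in_floor[OF assms] n_def
    by (intro sum_mono2) (use prime_gt_1_nat in \<open>auto simp: primes_in_def intro!: ln_ge_zero dest: prime_ge_1_nat\<close>)
  also have "\<dots> = ln (real (\<Prod>p | prime p \<and> p \<le> n. p))"
    unfolding primes_in_1 of_nat_prod
    by (subst ln_prod) (auto intro: prime_gt_0_nat)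
  also have "\<dots> \<le> ln (4 ^ n)"
  proof (subst ln_le_cancel_iff)
    have "(\<Prod>p | prime p \<and> p \<le> n. p) > 0" by (intro prod_pos) (auto intro: prime_gt_0_nat)
    thus "real (\<Prod>p | prime p \<and> p \<le> n. p) > 0" by (simp only: of_nat_0_less_iff)
    have "real (\<Prod>p | prime p \<and> p \<le> n. p) \<le> real (4 ^ n)"
      using prime_product_le by (simp only: of_nat_le_iff)
    thus "real (\<Prod>p | prime p \<and> p \<le> n. p) \<le> 4 ^ n" by (simp only: of_nat_power of_nat_numeral)
  qed auto
  also have "\<dots> = real n * ln 4" by (simp add: ln_realpow)
  also have "ln (4 :: real) = 2 * ln 2" using ln_realpow[of 2 2] by simp
  also have "real n * (2 * ln 2) \<le> real n * 2"
    using ln_le_minus_one[of 2] by (intro mult_left_mono) auto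
  also have "\<dots> \<le> 2 * z" using assms by (simp add: n_def)
  finally show ?thesis .
qed

section \<open>Legendre's formula and Mertens' first theorem\<close>

lemma card_multiples:
  assumes "d > (0 :: nat)"
  shows "card {m\<in>{1..n}. d dvd m} = n div d"
proof -
  have "{m\<in>{1..n}. d dvd m} = (\<lambda>k. d * k) ` {1..n div d}"
  proof (intro set_eqI iffI)
    fix m assume "m \<in> {m\<in>{1..n}. d dvd m}"
    then obtain k where "m = d * k" "m \<ge> 1" "m \<le> n" by auto
    thus "m \<in> (\<lambda>k. d * k) ` {1..n div d}"
      using assms by (auto simp: less_eq_div_iff_mult_less_eq mult.commute intro!: imageI Suc_leI gr0I)
  next
    fix m assume "m \<in> (\<lambda>k. d * k) ` {1..n div d}"
    thus "m \<in> {m\<in>{1..n}. d dvd m}"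
      using assms by (auto simp: less_eq_div_iff_mult_less_eq mult.commute Suc_le_eq)
  qed
  moreover have "inj_on (\<lambda>k. d * k) {1..n div d}" using assms by (auto simp: inj_on_def)
  ultimately show ?thesis by (simp add: card_image)
qed

text \<open>Legendre's formula, by counting the pairs (m, i) with p^i dividing m in both orders.
  Stopping at i = n loses nothing, since p^i > n for every larger i.\<close>

lemma multiplicity_fact:
  fixes p n :: nat
  assumes "prime p"
  shows "multiplicity p (fact n :: nat) = (\<Sum>i=1..n. n div p ^ i)"
proof -
  have p: "p > 1" using assms prime_gt_1_nat by blast
  have one: "multiplicity p m = (\<Sum>i=1..n. if p ^ i dvd m then 1 else 0)" if "m \<in> {1..n}" for m
  proof -
    have "{i\<in>{1..n}. p ^ i dvd m} = {1..multiplicity p m}"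
    proof -
      have "multiplicity p m < p ^ multiplicity p m" using p by (intro power_gt_expt) auto
      also have "\<dots> \<le> m" using that by (intro dvd_imp_le multiplicity_dvd) auto
      finally have "multiplicity p m \<le> n" using that by auto
      hence le: "i \<le> n" if "i \<le> multiplicity p m" for i using that by simp
      have "p ^ i dvd m \<longleftrightarrow> i \<le> multiplicity p m" for i
        using that p by (intro power_dvd_iff_le_multiplicity) auto
      thus ?thesis using le by auto
    qed
    hence "multiplicity p m = card {i\<in>{1..n}. p ^ i dvd m}" by simp
    thus ?thesis unfolding card_eq_sum by (subst (asm) sum.inter_filter) simp_all
  qed
  have "multiplicity p (fact n :: nat) = (\<Sum>m=1..n. multiplicity p m)"
    unfolding fact_prod of_nat_id using assms by (subst prime_elem_multiplicity_prod_distrib) auto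
  also have "\<dots> = (\<Sum>m=1..n. \<Sum>i=1..n. if p ^ i dvd m then 1 else 0)" using one by (intro sum.cong) auto
  also have "\<dots> = (\<Sum>i=1..n. \<Sum>m=1..n. if p ^ i dvd m then 1 else 0)" by (rule sum.swap)
  also have "\<dots> = (\<Sum>i=1..n. n div p ^ i)"
  proof (intro sum.cong refl)
    fix i
    have "n div p ^ i = card {m\<in>{1..n}. p ^ i dvd m}" using p by (subst card_multiples) auto
    thus "(\<Sum>m=1..n. if p ^ i dvd m then 1 else 0) = n div p ^ i"
      unfolding card_eq_sum by (subst (asm) sum.inter_filter) simp_all
  qed
  finally show ?thesis .
qed

lemma ln_fact_eq: "ln (fact n) = (\<Sum>p\<in>primes_in 1 (real n). real (multiplicity p (fact n :: nat)) * ln (real p))"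
proof -
  have pf: "prime_factors (fact n :: nat) = {p. prime p \<and> p \<le> n}"
    by (auto simp: prime_factors_dvd prime_dvd_fact_iff)
  have "(fact n :: nat) = (\<Prod>p\<in>prime_factors (fact n). p ^ multiplicity p (fact n))"
    by (rule prime_factorization_nat) simp
  hence "real (fact n) = (\<Prod>p | prime p \<and> p \<le> n. real p ^ multiplicity p (fact n :: nat))"
    unfolding pf by (metis (no_types, lifting) of_nat_power of_nat_prod prod.cong)
  hence "ln (fact n) = ln (\<Prod>p | prime p \<and> p \<le> n. real p ^ multiplicity p (fact n :: nat))" by simp
  also have "\<dots> = (\<Sum>p | prime p \<and> p \<le> n. ln (real p ^ multiplicity p (fact n :: nat)))"
    by (rule ln_prod) (auto intro: prime_gt_0_nat)
  finally show ?thesis by (simp add: primes_in_1 ln_realpow prime_gt_0_nat)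
qed

lemma ln_fact_ge: "ln (fact n) \<ge> real n * ln (real n) - real n"
proof (induction n)
  case (Suc n)
  show ?case
  proof (cases "n = 0")
    case False
    have "ln (real (Suc n)) - ln (real n) = ln (1 + 1 / real n)"
      using False by (subst ln_divide_pos[symmetric]) (auto simp: field_simps)
    also have "\<dots> \<le> 1 / real n" by (intro ln_add_one_self_le_self) auto
    finally have "real n * (ln (real (Suc n)) - ln (real n)) \<le> 1" using False by (simp add: field_simps)
    moreover have "ln (fact (Suc n)) = ln (real (Suc n)) + ln (fact n)"
      by (simp add: ln_mult del: of_nat_Suc)
    ultimately show ?thesis using Suc by (simp add: algebra_simps)
  qed auto
qed auto

lemma ln_fact_le: "ln (fact n) \<le> real n * ln (real n)"
proof (cases "n = 0")
  case False
  have "ln (fact n :: real) \<le> ln (real n ^ n)"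
    using False fact_le_power[of n, where 'a = real] by (subst ln_le_cancel_iff) auto
  thus ?thesis using False by (simp add: ln_realpow)
qed auto

lemma sum_geometric_inverse_le:
  fixes r :: real
  assumes "r > 1"
  shows "(\<Sum>i=1..n. 1 / r ^ i) \<le> 1 / (r - 1)"
proof -
  have "(\<Sum>i=1..n. 1 / r ^ i) = (1 - 1 / r ^ n) / (r - 1)"
  proof (induction n)
    case (Suc n)
    have "(\<Sum>i=1..Suc n. 1 / r ^ i) = (1 - 1 / r ^ n) / (r - 1) + 1 / (r * r ^ n)"
      using Suc by simp
    also have "\<dots> = (1 - 1 / (r * r ^ n)) / (r - 1)"
      using assms by (simp add: divide_simps) (simp add: algebra_simps)
    finally show ?case by simp
  qed simp
  also have "\<dots> \<le> 1 / (r - 1)" using assms by (intro divide_right_mono) auto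
  finally show ?thesis .
qed

text \<open>Legendre's formula bounds ln n! from below through its first term, n div p > n/p - 1.
  The rounding errors add up to at most theta(n) \<le> 2n, which is the source of the 2.\<close>

lemma mertens_upper:
  assumes "z \<ge> 1"
  shows "(\<Sum>p\<in>primes_in 1 z. ln (real p) / real p) \<le> ln z + 2"
proof -
  define n where "n = nat \<lfloor>z\<rfloor>"
  have n: "n \<ge> 1" "real n \<le> z" using assms by (auto simp: n_def le_nat_floor)
  have P: "primes_in 1 z = primes_in 1 (real n)" using primes_in_floor[of z 1] assms by (simp add: n_def)
  have "real n * (\<Sum>p\<in>primes_in 1 (real n). ln (real p) / real p) - (\<Sum>p\<in>primes_in 1 (real n). ln (real p))
      = (\<Sum>p\<in>primes_in 1 (real n). (real n / real p - 1) * ln (real p))"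
    by (simp add: sum_distrib_left left_diff_distrib sum_subtractf)
  also have "\<dots> \<le> (\<Sum>p\<in>primes_in 1 (real n). real (multiplicity p (fact n :: nat)) * ln (real p))"
  proof (intro sum_mono mult_right_mono)
    fix p assume p: "p \<in> primes_in 1 (real n)"
    have "real n / real p - 1 \<le> real (n div p)"
    proof -
      have "n div p * p + n mod p = n" by simp
      moreover have p0: "p > 0" using p by (auto simp: primes_in_def)
      moreover have "n mod p < p" using p0 by simp
      ultimately have "n \<le> (n div p + 1) * p" by (simp only: add_mult_distrib mult_1)
      hence "real n \<le> real ((n div p + 1) * p)" by (simp only: of_nat_le_iff)
      thus ?thesis using p0 by (simp add: field_simps)
    qed
    also have "n div p \<le> (\<Sum>i=1..n. n div p ^ i)"
      using n member_le_sum[of 1 "{1..n}" "\<lambda>i. n div p ^ i"] by simp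
    finally show "real n / real p - 1 \<le> real (multiplicity p (fact n :: nat))"
      using p by (simp add: multiplicity_fact primes_in_def)
  qed (use prime_gt_1_nat in \<open>auto simp: primes_in_def\<close>)
  also have "\<dots> \<le> real n * ln (real n)" using ln_fact_le ln_fact_eq by metis
  finally have "real n * (\<Sum>p\<in>primes_in 1 (real n). ln (real p) / real p) \<le> real n * ln (real n) + 2 * real n"
    using theta_le[of "real n" 1] by linarith
  also have "\<dots> = real n * (ln (real n) + 2)" by (simp add: algebra_simps)
  finally have "(\<Sum>p\<in>primes_in 1 (real n). ln (real p) / real p) \<le> ln (real n) + 2"
    using n by simp
  also have "ln (real n) \<le> ln z" using n by simp
  finally show ?thesis by (simp add: P)
qed

text \<open>Bounding Legendre's sum by a geometric series replaces 1/p by 1/(p - 1); the excess ln p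
  / (p (p - 1)) is at most 4 p^(-3/2), whose sum \<open>s\<close> over all integers converges. The 2
  in \<open>s + 2\<close> comes half from the Stirling-type bound for ln n! and half from rounding z
  down.\<close>

lemma mertens_lower:
  obtains C where "C > 0" "\<And>z. z \<ge> 1 \<Longrightarrow> (\<Sum>p\<in>primes_in 1 z. ln (real p) / real p) \<ge> ln z - C"
proof
  define s where "s = (\<Sum>k. 4 * real k powr (- (3 / 2)))"
  have summ: "summable (\<lambda>k. 4 * real k powr (- (3 / 2)))"
    by (intro summable_mult) (simp add: summable_real_powr_iff)
  show "s + 2 > 0" unfolding s_def by (intro add_nonneg_pos suminf_nonneg summ) auto
  fix z :: real assume z: "z \<ge> 1"
  define n where "n = nat \<lfloor>z\<rfloor>"
  have n: "n \<ge> 1" "real n \<le> z" "z \<le> real n + 1" using z by (auto simp: n_def le_nat_floor)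
  have P: "primes_in 1 z = primes_in 1 (real n)" using primes_in_floor[of z 1] z by (simp add: n_def)
  have "real n * ln (real n) - real n \<le> ln (fact n)" by (rule ln_fact_ge)
  also have "\<dots> = (\<Sum>p\<in>primes_in 1 (real n). real (multiplicity p (fact n :: nat)) * ln (real p))"
    by (rule ln_fact_eq)
  also have "\<dots> \<le> (\<Sum>p\<in>primes_in 1 (real n). real n * (ln (real p) / real p + 4 * real p powr (- (3 / 2))))"
  proof (rule sum_mono)
    fix p assume p: "p \<in> primes_in 1 (real n)"
    hence p2: "p \<ge> 2" by (auto simp: primes_in_def prime_ge_2_nat)
    have "real (multiplicity p (fact n :: nat)) = (\<Sum>i=1..n. real (n div p ^ i))"
      using p by (simp add: multiplicity_fact primes_in_def)
    also have "\<dots> \<le> (\<Sum>i=1..n. real n * (1 / real p ^ i))"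
      by (intro sum_mono) (metis mult.right_neutral of_nat_power of_nat_div_le_of_nat times_divide_eq_right)
    also have "\<dots> \<le> real n * (1 / (real p - 1))"
      unfolding sum_distrib_left[symmetric] using p2 by (intro mult_left_mono sum_geometric_inverse_le) auto
    finally have "real (multiplicity p (fact n :: nat)) * ln (real p) \<le> real n * (1 / (real p - 1)) * ln (real p)"
      using p2 by (intro mult_right_mono) auto
    also have "\<dots> = real n * (ln (real p) / real p + ln (real p) / (real p * (real p - 1)))"
      using p2 by (simp add: field_simps)
    also have "ln (real p) / (real p * (real p - 1)) \<le> 2 * real p powr (1/2) / (real p * (real p / 2))"
    proof (intro frac_le mult_left_mono)
      have "ln (real p) = 2 * ln (real p powr (1/2))" using p2 by (simp add: ln_powr)
      also have "\<dots> \<le> 2 * real p powr (1/2)" using p2 ln_bound[of "real p powr (1/2)"] by simp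
      finally show "ln (real p) \<le> 2 * real p powr (1/2)" .
    qed (use p2 in auto)
    also have "\<dots> = 4 * (real p powr (1/2) / real p powr 2)"
      using p2 by (simp add: powr_numeral power2_eq_square field_simps)
    also have "real p powr (1/2) / real p powr 2 = real p powr (- (3/2))"
      by (simp only: powr_diff[symmetric]) simp
    finally show "real (multiplicity p (fact n :: nat)) * ln (real p)
        \<le> real n * (ln (real p) / real p + 4 * real p powr (- (3 / 2)))"
      by (simp add: mult_left_mono)
  qed
  also have "\<dots> = real n * ((\<Sum>p\<in>primes_in 1 (real n). ln (real p) / real p) + (\<Sum>p\<in>primes_in 1 (real n). 4 * real p powr (- (3 / 2))))"
    by (simp only: sum_distrib_left sum.distrib distrib_left)
  also have "(\<Sum>p\<in>primes_in 1 (real n). 4 * real p powr (- (3 / 2))) \<le> s"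
    unfolding s_def by (intro sum_le_suminf summ) auto
  finally have "real n * (ln (real n) - 1) \<le> real n * ((\<Sum>p\<in>primes_in 1 (real n). ln (real p) / real p) + s)"
    using n by (simp add: algebra_simps)
  hence "ln (real n) - 1 \<le> (\<Sum>p\<in>primes_in 1 z. ln (real p) / real p) + s" using n by (simp add: P)
  moreover have "ln z \<le> ln (real n) + 1"
  proof -
    have "ln z \<le> ln (2 * real n)" using n z by (subst ln_le_cancel_iff) auto
    also have "\<dots> = ln 2 + ln (real n)" using n by (simp add: ln_mult)
    finally show ?thesis using ln_le_minus_one[of 2] by simp
  qed
  ultimately show "(\<Sum>p\<in>primes_in 1 z. ln (real p) / real p) \<ge> ln z - (s + 2)" by linarith
qed

lemma mertens_first:
  obtains C where "C > 0"
    "\<And>y z. 1 \<le> y \<Longrightarrow> y \<le> z \<Longrightarrow> \<bar>(\<Sum>p\<in>primes_in y z. ln (real p) / real p) - (ln z - ln y)\<bar> \<le> C"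
proof -
  obtain C where C: "C > 0" "\<And>z. z \<ge> 1 \<Longrightarrow> (\<Sum>p\<in>primes_in 1 z. ln (real p) / real p) \<ge> ln z - C"
    using mertens_lower by blast
  have "\<bar>(\<Sum>p\<in>primes_in y z. ln (real p) / real p) - (ln z - ln y)\<bar> \<le> C + 2" if "1 \<le> y" "y \<le> z" for y z
  proof -
    have "primes_in 1 z = primes_in 1 y \<union> primes_in y z" using that by (auto simp: primes_in_def)
    moreover have "primes_in 1 y \<inter> primes_in y z = {}" by (auto simp: primes_in_def)
    ultimately have "(\<Sum>p\<in>primes_in 1 z. ln (real p) / real p)
        = (\<Sum>p\<in>primes_in 1 y. ln (real p) / real p) + (\<Sum>p\<in>primes_in y z. ln (real p) / real p)"
      by (simp add: sum.union_disjoint)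
    thus ?thesis using C(2)[of y] C(2)[of z] mertens_upper[of y] mertens_upper[of z] that
      unfolding abs_le_iff by linarith
  qed
  thus thesis using that[of "C + 2"] C(1) by simp
qed

text \<open>Mertens' theorem has an error of at most C, so an interval of logarithmic length C + 1,
  which is the choice of \<epsilon>, carries weight at least 1. There 1/p is at most 1/(\<epsilon>
  x), which turns the weight into the sum of ln p.\<close>

lemma theta_lower:
  obtains \<epsilon> where "0 < \<epsilon>" "\<epsilon> < 1" "\<And>x. \<epsilon> * x \<ge> 1 \<Longrightarrow> (\<Sum>p\<in>primes_in (\<epsilon> * x) x. ln (real p)) \<ge> \<epsilon> * x"
proof -
  obtain C where C: "C > 0"
    "\<And>y z. 1 \<le> y \<Longrightarrow> y \<le> z \<Longrightarrow> \<bar>(\<Sum>p\<in>primes_in y z. ln (real p) / real p) - (ln z - ln y)\<bar> \<le> C"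
    using mertens_first by blast
  define \<epsilon> where "\<epsilon> = exp (- (C + 1))"
  have \<epsilon>: "0 < \<epsilon>" "\<epsilon> < 1" using C(1) by (auto simp: \<epsilon>_def)
  have "(\<Sum>p\<in>primes_in (\<epsilon> * x) x. ln (real p)) \<ge> \<epsilon> * x" if x: "\<epsilon> * x \<ge> 1" for x
  proof -
    have x0: "x > 0" using x \<epsilon> by (smt (verit) mult_nonneg_nonpos)
    have "ln x - ln (\<epsilon> * x) = C + 1" using x0 \<epsilon> by (simp add: ln_mult \<epsilon>_def)
    moreover have "\<epsilon> * x \<le> x" using x0 \<epsilon> by simp
    ultimately have "1 \<le> (\<Sum>p\<in>primes_in (\<epsilon> * x) x. ln (real p) / real p)"
      using C(2)[of "\<epsilon> * x" x] x by linarith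
    also have "\<dots> \<le> (\<Sum>p\<in>primes_in (\<epsilon> * x) x. ln (real p) / (\<epsilon> * x))"
    proof (intro sum_mono divide_left_mono mult_pos_pos)
      fix p assume p: "p \<in> primes_in (\<epsilon> * x) x"
      thus "\<epsilon> * x \<le> real p" "real p > 0" "ln (real p) \<ge> 0"
        using x by (auto simp: primes_in_def dest: prime_ge_1_nat)
    qed (use x0 \<epsilon> in auto)
    finally show ?thesis using x by (simp flip: sum_divide_distrib add: le_divide_eq)
  qed
  thus thesis using that \<epsilon> by blast
qed

lemma prime_counting_lower:
  obtains c where "c > 0" "\<forall>\<^sub>F x in at_top. c * (x / ln x) \<le> real (card (primes_in 1 x))"
proof -
  obtain \<epsilon> where \<epsilon>: "0 < \<epsilon>" "\<epsilon> < 1" "\<And>x. \<epsilon> * x \<ge> 1 \<Longrightarrow> (\<Sum>p\<in>primes_in (\<epsilon> * x) x. ln (real p)) \<ge> \<epsilon> * x"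
    using theta_lower by blast
  have "\<forall>\<^sub>F x in at_top. \<epsilon> * x \<ge> 1 \<and> x > 1" using \<epsilon>(1)
    by (intro eventually_conj) real_asymp+
  hence "\<forall>\<^sub>F x in at_top. \<epsilon> * (x / ln x) \<le> real (card (primes_in 1 x))"
  proof eventually_elim
    case (elim x)
    have "\<epsilon> * x \<le> (\<Sum>p\<in>primes_in (\<epsilon> * x) x. ln (real p))" using \<epsilon>(3) elim by simp
    also have "\<dots> \<le> (\<Sum>p\<in>primes_in 1 x. ln x)"
    proof (intro order_trans[OF sum_mono sum_mono2])
      show "primes_in (\<epsilon> * x) x \<subseteq> primes_in 1 x" using elim by (auto simp: primes_in_def)
      show "finite (primes_in 1 x)" by (rule finite_primes_in)
    qed (use elim in \<open>auto simp: primes_in_def prime_gt_0_nat\<close>)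
    finally show ?case using elim by (simp add: field_simps)
  qed
  thus thesis using that \<epsilon>(1) by blast
qed

section \<open>The arithmetic large sieve\<close>

definition expi :: "real \<Rightarrow> complex" where
  "expi t = cis (2 * pi * t)"

lemma expi_add: "expi (s + t) = expi s * expi t"
  by (simp add: expi_def cis_mult algebra_simps)

lemma expi_0 [simp]: "expi 0 = 1"
  by (simp add: expi_def)

lemma norm_expi [simp]: "norm (expi t) = 1"
  by (simp add: expi_def)

lemma expi_minus: "expi (- t) = cnj (expi t)"
  by (simp add: expi_def cis_cnj)

lemma expi_power: "expi t ^ n = expi (real n * t)"
  unfolding expi_def by (simp add: DeMoivre algebra_simps)

lemma expi_of_int [simp]: "expi (of_int m) = 1"
  by (simp add: expi_def complex_eq_iff cos_int_2pin sin_int_2pin)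

lemma expi_sum: "finite A \<Longrightarrow> expi (\<Sum>i\<in>A. f i) = (\<Prod>i\<in>A. expi (f i))"
  by (induction A rule: finite_induct) (auto simp: expi_add)

lemma expi_eq_1_iff: "expi t = 1 \<longleftrightarrow> t \<in> \<int>"
proof
  assume "expi t = 1"
  hence "cos (2 * pi * t) = 1"
    by (simp add: expi_def complex_eq_iff)
  then obtain m :: int where "2 * pi * t = of_int m * 2 * pi"
    by (auto simp: cos_one_2pi_int)
  hence "t = of_int m" by simp
  thus "t \<in> \<int>" by simp
next
  assume "t \<in> \<int>"
  thus "expi t = 1" by (elim Ints_cases) simp
qed

lemma expi_character_sum:
  fixes k :: int
  assumes "p > 0"
  shows "(\<Sum>a<p. expi (of_int k * real a / real p)) = (if int p dvd k then of_nat p else 0)"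
proof (cases "int p dvd k")
  case True
  then obtain m where "k = int p * m" by blast
  hence "of_int k * real a / real p = of_int (m * int a)" for a
    using assms by simp
  hence "expi (of_int k * real a / real p) = 1" for a
    by (metis expi_of_int)
  thus ?thesis using True by simp
next
  case False
  define z where "z = expi (of_int k / real p)"
  have z: "expi (of_int k * real a / real p) = z ^ a" for a
    by (simp add: z_def expi_power mult.commute)
  have "z \<noteq> 1"
  proof
    assume "z = 1"
    then obtain m :: int where "of_int k / real p = of_int m"
      unfolding z_def expi_eq_1_iff by (elim Ints_cases)
    hence "of_int k = (of_int (int p * m) :: real)"
      using assms by (simp add: field_simps)
    hence "k = int p * m" by linarith
    with False show False by simp
  qed
  moreover have "z ^ p = 1"
    using assms by (simp add: z_def expi_power)
  ultimately show ?thesis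
    using False by (simp add: z geometric_sum)
qed

text \<open>Finite Fourier expansion and Parseval's identity modulo p. The zero mean removes the
  frequency 0, so only a in {1..<p} remain; multiplied over the primes of a squarefree modulus, such
  terms involve reduced fractions only, which keeps the fractions of different moduli
  distinct.\<close>

lemma fourier_expansion_mod:
  fixes \<psi> :: "nat \<Rightarrow> real"
  assumes p: "p > 0" and mean: "(\<Sum>m<p. \<psi> m) = 0"
  obtains c :: "nat \<Rightarrow> complex" where
    "\<And>n :: int. (\<Sum>a\<in>{1..<p}. c a * expi (of_int n * (real a / real p))) = of_real (\<psi> (nat (n mod int p)))"
    "(\<Sum>a\<in>{1..<p}. (norm (c a))\<^sup>2) = (\<Sum>m<p. (\<psi> m)\<^sup>2) / real p"
proof
  define c where "c a = (\<Sum>m<p. of_real (\<psi> m) * expi (- (real a * real m / real p))) / of_nat p" for a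
  have c0: "c 0 = 0"
    using mean by (simp add: c_def flip: of_real_sum)
  have split: "{..<p} = insert 0 {1..<p}" using p by auto
  have drop0: "(\<Sum>a\<in>{1..<p}. f a) = (\<Sum>a<p. f a)" if "f 0 = 0" for f :: "nat \<Rightarrow> 'b :: comm_monoid_add"
    unfolding split using that by simp
  show exp: "(\<Sum>a\<in>{1..<p}. c a * expi (of_int n * (real a / real p))) = of_real (\<psi> (nat (n mod int p)))" for n :: int
  proof -
    define r where "r = nat (n mod int p)"
    have r: "r < p" "int r = n mod int p"
      using p by (auto simp: r_def nat_less_iff)
    have dv: "int p dvd (n - int m) \<longleftrightarrow> m = r" if "m < p" for m
    proof -
      have "int p dvd (n - int m) \<longleftrightarrow> n mod int p = int m mod int p"
        by (simp add: mod_eq_dvd_iff)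
      thus ?thesis using r that by auto
    qed
    have "(\<Sum>a\<in>{1..<p}. c a * expi (of_int n * (real a / real p))) = (\<Sum>a<p. c a * expi (of_int n * (real a / real p)))"
      by (rule drop0) (simp add: c0)
    also have "\<dots> = (\<Sum>a<p. \<Sum>m<p. of_real (\<psi> m) / of_nat p * expi (of_int (n - int m) * real a / real p))"
      unfolding c_def sum_divide_distrib sum_distrib_right
      by (intro sum.cong refl) (simp add: expi_add [symmetric] field_simps)
    also have "\<dots> = (\<Sum>m<p. of_real (\<psi> m) / of_nat p * (\<Sum>a<p. expi (of_int (n - int m) * real a / real p)))"
      unfolding sum_distrib_left by (rule sum.swap)
    also have "\<dots> = (\<Sum>m<p. if m = r then of_real (\<psi> m) else 0)"
      using p dv by (intro sum.cong refl) (auto simp: expi_character_sum simp del: of_int_diff)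
    also have "\<dots> = of_real (\<psi> r)" using r by simp
    finally show ?thesis by (simp add: r_def)
  qed
  have "of_real (\<Sum>a\<in>{1..<p}. (norm (c a))\<^sup>2) = (\<Sum>a\<in>{1..<p}. c a * cnj (c a))"
    unfolding of_real_sum complex_norm_square ..
  also have "\<dots> = (\<Sum>a\<in>{1..<p}. c a * (\<Sum>m<p. of_real (\<psi> m) * expi (of_int (int m) * (real a / real p))) / of_nat p)"
    by (intro sum.cong refl) (simp add: c_def cnj_sum expi_minus field_simps)
  also have "\<dots> = (\<Sum>a\<in>{1..<p}. \<Sum>m<p. of_real (\<psi> m) / of_nat p * (c a * expi (of_int (int m) * (real a / real p))))"
    by (simp add: sum_divide_distrib sum_distrib_left mult_ac)
  also have "\<dots> = (\<Sum>m<p. of_real (\<psi> m) / of_nat p * (\<Sum>a\<in>{1..<p}. c a * expi (of_int (int m) * (real a / real p))))"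
    unfolding sum_distrib_left by (rule sum.swap)
  also have "\<dots> = (\<Sum>m<p. of_real (\<psi> m) / of_nat p * of_real (\<psi> m))"
    by (intro sum.cong refl, subst exp) (simp add: nat_mod_distrib)
  also have "\<dots> = of_real ((\<Sum>m<p. (\<psi> m)\<^sup>2) / real p)"
    by (simp add: power2_eq_square sum_divide_distrib)
  finally show "(\<Sum>a\<in>{1..<p}. (norm (c a))\<^sup>2) = (\<Sum>m<p. (\<psi> m)\<^sup>2) / real p"
    using of_real_eq_iff by blast
qed

text \<open>The expanded function is -1 on \<open>Om\<close> and g = w/(p - w) elsewhere. This g
  makes the mean vanish, and then the mean square is again g: the constant value off
  \<open>Om\<close> and the energy of the coefficients are the same number.\<close>

lemma sieve_weight_expansion:
  assumes p: "p > 0" and Om: "Om \<subseteq> {..<p}" "card Om < p"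
  obtains c :: "nat \<Rightarrow> complex" where
    "\<And>n. n mod p \<notin> Om \<Longrightarrow>
       (\<Sum>a\<in>{1..<p}. c a * expi (real n * (real a / real p))) = of_real (real (card Om) / (real p - real (card Om)))"
    "(\<Sum>a\<in>{1..<p}. (norm (c a))\<^sup>2) = real (card Om) / (real p - real (card Om))"
proof -
  define w where "w = real (card Om)"
  define g where "g = w / (real p - w)"
  define \<psi> where "\<psi> m = (if m \<in> Om then - 1 else g)" for m
  have wp: "w < real p" using Om by (simp add: w_def)
  have fin: "finite Om" using Om finite_subset by blast
  have cardc: "real (card ({..<p} - Om)) = real p - w"
    using Om fin by (simp add: card_Diff_subset w_def of_nat_diff)
  have split: "(\<Sum>m<p. h (m \<in> Om)) = w * h True + (real p - w) * h False" for h :: "bool \<Rightarrow> real"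
  proof -
    have "(\<Sum>m<p. h (m \<in> Om)) = (\<Sum>m\<in>Om. h (m \<in> Om)) + (\<Sum>m\<in>{..<p} - Om. h (m \<in> Om))"
      using Om by (metis add.commute finite_lessThan sum.subset_diff)
    also have "(\<Sum>m\<in>Om. h (m \<in> Om)) = w * h True"
      by (simp add: w_def)
    also have "(\<Sum>m\<in>{..<p} - Om. h (m \<in> Om)) = (real p - w) * h False"
      by (simp flip: cardc)
    finally show ?thesis .
  qed
  have "(\<Sum>m<p. \<psi> m) = 0"
    using split[of "\<lambda>b. if b then - 1 else g"] wp by (simp add: \<psi>_def g_def)
  then obtain c :: "nat \<Rightarrow> complex" where c:
    "\<And>n :: int. (\<Sum>a\<in>{1..<p}. c a * expi (of_int n * (real a / real p))) = of_real (\<psi> (nat (n mod int p)))"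
    "(\<Sum>a\<in>{1..<p}. (norm (c a))\<^sup>2) = (\<Sum>m<p. (\<psi> m)\<^sup>2) / real p"
    using fourier_expansion_mod[OF p] by blast
  have "(\<Sum>m<p. (\<psi> m)\<^sup>2) = w + (real p - w) * g\<^sup>2"
    using split[of "\<lambda>b. (if b then - 1 else g)\<^sup>2"] by (simp add: \<psi>_def)
  also have "\<dots> = g * real p"
  proof -
    have "(real p - w) * g = w" using wp by (simp add: g_def)
    hence "(real p - w) * g\<^sup>2 = w * g" by (simp add: power2_eq_square)
    moreover have "w + w * g = g * real p"
      using wp by (simp add: g_def field_simps)
    ultimately show ?thesis by linarith
  qed
  finally have "(\<Sum>a\<in>{1..<p}. (norm (c a))\<^sup>2) = g"
    using c(2) p by simp
  moreover have "(\<Sum>a\<in>{1..<p}. c a * expi (real n * (real a / real p))) = of_real g" if "n mod p \<notin> Om" for n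
    using c(1)[of "int n"] that by (simp add: \<psi>_def nat_mod_distrib)
  ultimately show ?thesis
    using that unfolding g_def w_def by blast
qed

section \<open>Exponential sums at well-spaced points\<close>

lemma sin_pi_times_ge:
  assumes "0 \<le> t" "t \<le> 1/2"
  shows "sin (pi * t) \<ge> t"
proof -
  define x where "x = pi * t"
  have x: "0 \<le> x" "x \<le> pi / 2" using assms by (auto simp: x_def)
  have "\<bar>sin x - (\<Sum>m<3. sin_coeff m * x ^ m)\<bar> \<le> inverse (fact 3) * \<bar>x\<bar> ^ 3"
    by (rule Maclaurin_sin_bound)
  \<comment> \<open>For x \<le> 2 this is at least x - 4x/6 = x/3, and x/3 \<ge> t because pi \<ge>
    3.\<close>
  hence "sin x \<ge> x - x ^ 3 / 6"
    using x by (simp add: numeral_3_eq_3 sin_coeff_def fact_numeral abs_if field_simps split: if_splits)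
  moreover have "x\<^sup>2 \<le> 4"
  proof -
    have "x \<le> 2" using x pi_less_4 by simp
    thus ?thesis using x power_mono[of x 2 2] by simp
  qed
  hence "x ^ 3 \<le> 4 * x" using x by (simp add: power3_eq_cube power2_eq_square mult_right_mono)
  moreover have "x \<ge> 3 * t"
  proof -
    have "pi \<ge> 3" using sin_x_le_x[of "pi / 6"] by (simp add: sin_30)
    thus ?thesis using assms by (auto simp: x_def intro: mult_right_mono)
  qed
  ultimately show ?thesis using assms unfolding x_def by linarith
qed

lemma norm_expi_minus_1: "norm (expi t - 1) = 2 * \<bar>sin (pi * t)\<bar>"
proof -
  have *: "2 * pi * t = 2 * (pi * t)" by simp
  have "(norm (expi t - 1))\<^sup>2 = (2 * \<bar>sin (pi * t)\<bar>)\<^sup>2"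
  proof -
    have "(norm (expi t - 1))\<^sup>2 = (cos (2 * (pi * t)) - 1)\<^sup>2 + (sin (2 * (pi * t)))\<^sup>2"
      unfolding expi_def * by (simp add: cmod_power2)
    also have "\<dots> = 2 - 2 * cos (2 * (pi * t))"
      using sin_cos_squared_add[of "2 * (pi * t)"] by (simp add: power2_eq_square algebra_simps)
    also have "\<dots> = 4 * (sin (pi * t))\<^sup>2"
      by (simp only: cos_double_sin) simp
    finally show ?thesis by (simp add: power_mult_distrib)
  qed
  thus ?thesis by (rule power2_eq_imp_eq) auto
qed

text \<open>A geometric sum is at most 2/|expi t - 1|, hence at most 1/min(u, 1 - u) for the
  fractional part u, uniformly in \<open>M\<close>. Replacing the minimum by a sum of two inverse
  squares lets each of them be summed separately over separated points.\<close>

lemma norm_expi_sum_le: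
  assumes "frac t > 0"
  shows "(norm (\<Sum>j<M. expi (real j * t)))\<^sup>2 \<le> 1 / (frac t)\<^sup>2 + 1 / (1 - frac t)\<^sup>2"
proof -
  define u where "u = frac t"
  have u: "0 < u" "u < 1" using assms frac_lt_1 by (auto simp: u_def)
  have tu: "expi (real j * t) = expi (real j * u)" for j
  proof -
    have "real j * t = of_int (int j * \<lfloor>t\<rfloor>) + real j * u"
      by (simp add: u_def frac_def algebra_simps)
    thus ?thesis by (metis expi_add expi_of_int mult_1)
  qed
  define m where "m = min u (1 - u)"
  have m: "m > 0" using u by (simp add: m_def)
  have "\<bar>sin (pi * u)\<bar> \<ge> m"
  proof (cases "u \<le> 1/2")
    case True
    thus ?thesis using sin_pi_times_ge[of u] u by (simp add: m_def)
  next
    case False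
    have "sin (pi * u) = sin (pi * (1 - u))"
      by (simp add: right_diff_distrib)
    thus ?thesis using sin_pi_times_ge[of "1 - u"] u False by (simp add: m_def)
  qed
  hence d: "norm (expi u - 1) \<ge> 2 * m" by (simp add: norm_expi_minus_1)
  hence "expi u \<noteq> 1" using m by auto
  hence "(\<Sum>j<M. expi (real j * t)) = (expi u ^ M - 1) / (expi u - 1)"
    unfolding tu by (simp flip: expi_power add: geometric_sum)
  moreover have "norm (expi u ^ M - 1) \<le> 2"
    using norm_triangle_ineq4[of "expi u ^ M" 1] by (simp add: norm_power)
  ultimately have "norm (\<Sum>j<M. expi (real j * t)) \<le> 2 / (2 * m)"
    unfolding norm_divide using d m by (simp only: norm_divide) (intro frac_le; simp)
  hence "(norm (\<Sum>j<M. expi (real j * t)))\<^sup>2 \<le> (1 / m)\<^sup>2"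
    by (intro power_mono) auto
  also have "\<dots> \<le> 1 / u\<^sup>2 + 1 / (1 - u)\<^sup>2"
    by (auto simp: m_def min_def power_divide)
  finally show ?thesis by (simp add: u_def)
qed

lemma sum_inverse_squares_le:
  fixes K :: "nat set"
  assumes "finite K" "0 \<notin> K"
  shows "(\<Sum>k\<in>K. 1 / (real k)\<^sup>2) \<le> 2"
proof -
  have *: "(\<Sum>k=1..n. 1 / (real k)\<^sup>2) \<le> 2 - 1 / real n" if "n \<ge> 1" for n
    using that
  proof (induction n rule: dec_induct)
    case (step n)
    have "1 / (real (Suc n))\<^sup>2 \<le> 1 / real n - 1 / real (Suc n)"
      using step by (simp add: divide_simps power2_eq_square)
    thus ?case using step by simp
  qed simp
  define n where "n = Max (insert 1 K)"
  have n: "n \<ge> 1" "K \<subseteq> {1..n}"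
    using assms by (auto simp: n_def Suc_le_eq Max_gr_iff intro: gr0I)
  have "(\<Sum>k\<in>K. 1 / (real k)\<^sup>2) \<le> (\<Sum>k=1..n. 1 / (real k)\<^sup>2)"
    using n by (intro sum_mono2) auto
  also have "\<dots> \<le> 2" using *[OF n(1)] by (smt (verit) divide_nonneg_nonneg of_nat_0_le_iff)
  finally show ?thesis .
qed

text \<open>Because of the spacing, rounding t i / \<delta> down is injective, so the sum is
  dominated by \<delta>^(-2) times a sum of 1/k^2 over distinct k \<ge> 1.\<close>

lemma sum_inverse_squares_separated:
  fixes t :: "'i \<Rightarrow> real"
  assumes J: "finite J" and d: "\<delta> > 0" and ge: "\<And>i. i \<in> J \<Longrightarrow> t i \<ge> \<delta>"
    and sep: "\<And>i j. i \<in> J \<Longrightarrow> j \<in> J \<Longrightarrow> i \<noteq> j \<Longrightarrow> \<bar>t i - t j\<bar> \<ge> \<delta>"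
  shows "(\<Sum>i\<in>J. 1 / (t i)\<^sup>2) \<le> 2 / \<delta>\<^sup>2"
proof -
  define k where "k i = nat \<lfloor>t i / \<delta>\<rfloor>" for i
  have k: "real (k i) \<le> t i / \<delta>" "t i / \<delta> < real (k i) + 1" "k i \<ge> 1" if "i \<in> J" for i
  proof -
    have "t i / \<delta> \<ge> 1" using ge[OF that] d by simp
    hence "\<lfloor>t i / \<delta>\<rfloor> \<ge> 1" by simp
    thus "real (k i) \<le> t i / \<delta>" "t i / \<delta> < real (k i) + 1" "k i \<ge> 1"
      unfolding k_def by linarith+
  qed
  have inj: "inj_on k J"
  proof (rule inj_onI, rule ccontr)
    fix i j assume ij: "i \<in> J" "j \<in> J" "k i = k j" "i \<noteq> j"
    have "\<bar>t i / \<delta> - t j / \<delta>\<bar> < 1"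
      using k[OF ij(1)] k[OF ij(2)] ij(3) by linarith
    hence "\<bar>t i - t j\<bar> < \<delta>"
      using d by (simp add: abs_less_iff field_simps)
    thus False using sep[OF ij(1,2,4)] by simp
  qed
  have "(\<Sum>i\<in>J. 1 / (t i)\<^sup>2) \<le> (\<Sum>i\<in>J. (1 / \<delta>\<^sup>2) * (1 / (real (k i))\<^sup>2))"
  proof (rule sum_mono)
    fix i assume i: "i \<in> J"
    have "0 < real (k i) * \<delta>" "real (k i) * \<delta> \<le> t i"
      using k(1)[OF i] k(3)[OF i] d by (simp_all add: pos_le_divide_eq)
    hence "(real (k i) * \<delta>)\<^sup>2 \<le> (t i)\<^sup>2" "0 < (real (k i) * \<delta>)\<^sup>2"
      by (intro power_mono zero_less_power; linarith)+
    hence "1 / (t i)\<^sup>2 \<le> 1 / (real (k i) * \<delta>)\<^sup>2"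
      by (intro divide_left_mono mult_pos_pos) linarith+
    thus "1 / (t i)\<^sup>2 \<le> (1 / \<delta>\<^sup>2) * (1 / (real (k i))\<^sup>2)"
      by (simp add: power_mult_distrib mult.commute)
  qed
  also have "\<dots> = (1 / \<delta>\<^sup>2) * (\<Sum>m\<in>k ` J. 1 / (real m)\<^sup>2)"
    by (simp add: sum_distrib_left sum.reindex[OF inj])
  also have "\<dots> \<le> (1 / \<delta>\<^sup>2) * 2"
  proof (intro mult_left_mono sum_inverse_squares_le)
    show "0 \<notin> k ` J" using k(3) by force
  qed (use J in auto)
  finally show ?thesis by simp
qed

lemma sum_swap3: "(\<Sum>i\<in>A. \<Sum>r\<in>B. \<Sum>s\<in>C. f i r s) = (\<Sum>r\<in>B. \<Sum>s\<in>C. \<Sum>i\<in>A. f i r s)"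
  by (subst sum.swap) (intro sum.cong refl sum.swap)

text \<open>Summing over pairs (i, j) weights the frequency n = i - j by M - |n|, and the kernel
  becomes the Fejer-type square |E(x r - x s)|^2. It is nonnegative and decays like the inverse
  square of the distance, so plain row sums converge and Schur's test applies: M^2 from the
  diagonal, 4/\<delta>^2 from the other points.\<close>

lemma dual_large_sieve:
  fixes x :: "'i \<Rightarrow> real" and c :: "'i \<Rightarrow> complex"
  assumes I: "finite I" and d: "\<delta> > 0"
    and sep: "\<And>r s m. r \<in> I \<Longrightarrow> s \<in> I \<Longrightarrow> r \<noteq> s \<Longrightarrow> \<bar>x r - x s - of_int m\<bar> \<ge> \<delta>"
  shows "(\<Sum>i<M. \<Sum>j<M. (norm (\<Sum>r\<in>I. c r * expi ((real i - real j) * x r)))\<^sup>2)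
           \<le> ((real M)\<^sup>2 + 4 / \<delta>\<^sup>2) * (\<Sum>r\<in>I. (norm (c r))\<^sup>2)"
proof -
  define E where "E t = (\<Sum>j<M. expi (real j * t))" for t
  define K where "K r s = (norm (E (x r - x s)))\<^sup>2" for r s
  have Ksym: "K r s = K s r" for r s
  proof -
    have "E (x s - x r) = cnj (E (x r - x s))"
      unfolding E_def cnj_sum
      by (intro sum.cong refl) (simp flip: expi_minus add: algebra_simps)
    thus ?thesis by (simp add: K_def)
  qed
  have row: "(\<Sum>s\<in>I. K r s) \<le> (real M)\<^sup>2 + 4 / \<delta>\<^sup>2" if r: "r \<in> I" for r
  proof -
    define t where "t s = frac (x r - x s)" for s
    have tsep: "t s \<ge> \<delta>" "1 - t s \<ge> \<delta>" if "s \<in> I - {r}" for s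
    proof -
      have "\<bar>x r - x s - of_int \<lfloor>x r - x s\<rfloor>\<bar> \<ge> \<delta>" "\<bar>x r - x s - of_int (\<lfloor>x r - x s\<rfloor> + 1)\<bar> \<ge> \<delta>"
        using sep[of r s] that r by blast+
      thus "t s \<ge> \<delta>" "1 - t s \<ge> \<delta>"
        using frac_ge_0[of "x r - x s"] frac_lt_1[of "x r - x s"]
        unfolding t_def frac_def by linarith+
    qed
    have tsep2: "\<bar>t s - t s'\<bar> \<ge> \<delta>" if "s \<in> I - {r}" "s' \<in> I - {r}" "s \<noteq> s'" for s s'
    proof -
      have "\<bar>x s' - x s - of_int (\<lfloor>x r - x s\<rfloor> - \<lfloor>x r - x s'\<rfloor>)\<bar> \<ge> \<delta>"
        using sep[of s' s] that by blast
      moreover have "x s' - x s - of_int (\<lfloor>x r - x s\<rfloor> - \<lfloor>x r - x s'\<rfloor>) = t s - t s'"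
        by (simp add: t_def frac_def)
      ultimately show ?thesis by simp
    qed
    have "(\<Sum>s\<in>I. K r s) = K r r + (\<Sum>s\<in>I - {r}. K r s)"
      using I r by (simp add: sum.remove)
    also have "K r r = (real M)\<^sup>2"
      by (simp add: K_def E_def)
    also have "(\<Sum>s\<in>I - {r}. K r s) \<le> (\<Sum>s\<in>I - {r}. 1 / (t s)\<^sup>2 + 1 / (1 - t s)\<^sup>2)"
    proof (rule sum_mono)
      fix s assume s: "s \<in> I - {r}"
      have "frac (x r - x s) > 0" using tsep(1)[OF s] d unfolding t_def by linarith
      thus "K r s \<le> 1 / (t s)\<^sup>2 + 1 / (1 - t s)\<^sup>2"
        unfolding K_def E_def t_def by (rule norm_expi_sum_le)
    qed
    also have "\<dots> = (\<Sum>s\<in>I - {r}. 1 / (t s)\<^sup>2) + (\<Sum>s\<in>I - {r}. 1 / (1 - t s)\<^sup>2)"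
      by (rule sum.distrib)
    also have "(\<Sum>s\<in>I - {r}. 1 / (t s)\<^sup>2) \<le> 2 / \<delta>\<^sup>2"
      using I d tsep tsep2 by (intro sum_inverse_squares_separated) auto
    also have "(\<Sum>s\<in>I - {r}. 1 / (1 - t s)\<^sup>2) \<le> 2 / \<delta>\<^sup>2"
    proof (intro sum_inverse_squares_separated)
      fix s s' assume "s \<in> I - {r}" "s' \<in> I - {r}" "s \<noteq> s'"
      from tsep2[OF this] show "\<delta> \<le> \<bar>1 - t s - (1 - t s')\<bar>" by auto
    qed (use I d tsep in auto)
    finally show ?thesis by simp
  qed
  have "complex_of_real (\<Sum>i<M. \<Sum>j<M. (norm (\<Sum>r\<in>I. c r * expi ((real i - real j) * x r)))\<^sup>2)
      = (\<Sum>i<M. \<Sum>j<M. \<Sum>r\<in>I. \<Sum>s\<in>I. c r * cnj (c s) * (expi (real i * (x r - x s)) * cnj (expi (real j * (x r - x s)))))"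
  proof -
    have "complex_of_real ((norm (\<Sum>r\<in>I. c r * expi ((real i - real j) * x r)))\<^sup>2)
        = (\<Sum>r\<in>I. \<Sum>s\<in>I. c r * cnj (c s) * (expi (real i * (x r - x s)) * cnj (expi (real j * (x r - x s)))))" for i j
    proof -
      have "complex_of_real ((norm (\<Sum>r\<in>I. c r * expi ((real i - real j) * x r)))\<^sup>2)
        = (\<Sum>r\<in>I. \<Sum>s\<in>I. (c r * expi ((real i - real j) * x r)) * cnj (c s * expi ((real i - real j) * x s)))"
        unfolding complex_norm_square cnj_sum sum_product ..
      also have "\<dots> = (\<Sum>r\<in>I. \<Sum>s\<in>I. c r * cnj (c s) * (expi (real i * (x r - x s)) * cnj (expi (real j * (x r - x s)))))"
        by (intro sum.cong refl) (simp add: mult_ac, simp flip: expi_minus expi_add add: algebra_simps)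
      finally show ?thesis .
    qed
    thus ?thesis by simp
  qed
  also have "\<dots> = (\<Sum>r\<in>I. \<Sum>s\<in>I. \<Sum>i<M. \<Sum>j<M. c r * cnj (c s) * (expi (real i * (x r - x s)) * cnj (expi (real j * (x r - x s)))))"
    by (rule trans[OF sum.cong[OF refl sum_swap3] sum_swap3])
  also have "\<dots> = (\<Sum>r\<in>I. \<Sum>s\<in>I. c r * cnj (c s) * of_real (K r s))"
    unfolding K_def complex_norm_square E_def cnj_sum sum_product
    by (simp only: sum_distrib_left)
  finally have "(\<Sum>i<M. \<Sum>j<M. (norm (\<Sum>r\<in>I. c r * expi ((real i - real j) * x r)))\<^sup>2)
      = norm (\<Sum>r\<in>I. \<Sum>s\<in>I. c r * cnj (c s) * of_real (K r s))"
    by (metis (no_types, lifting) abs_of_nonneg norm_of_real sum_nonneg zero_le_power2)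
  also have "\<dots> \<le> (\<Sum>r\<in>I. \<Sum>s\<in>I. norm (c r) * norm (c s) * K r s)"
    by (intro sum_norm_le) (auto simp: norm_mult norm_power K_def)
  also have "\<dots> \<le> (\<Sum>r\<in>I. \<Sum>s\<in>I. ((norm (c r))\<^sup>2 * K r s + (norm (c s))\<^sup>2 * K s r) / 2)"
  proof (intro sum_mono)
    fix r s
    have "norm (c r) * norm (c s) \<le> ((norm (c r))\<^sup>2 + (norm (c s))\<^sup>2) / 2"
      using sum_squares_bound[of "norm (c r)" "norm (c s)"] by simp
    moreover have "K r s \<ge> 0" by (simp add: K_def)
    ultimately have "norm (c r) * norm (c s) * K r s \<le> ((norm (c r))\<^sup>2 + (norm (c s))\<^sup>2) / 2 * K r s"
      by (rule mult_right_mono)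
    thus "norm (c r) * norm (c s) * K r s \<le> ((norm (c r))\<^sup>2 * K r s + (norm (c s))\<^sup>2 * K s r) / 2"
      by (simp add: Ksym[of s r] algebra_simps)
  qed
  also have "\<dots> = ((\<Sum>r\<in>I. \<Sum>s\<in>I. (norm (c r))\<^sup>2 * K r s) + (\<Sum>r\<in>I. \<Sum>s\<in>I. (norm (c s))\<^sup>2 * K s r)) / 2"
    by (simp add: sum.distrib flip: sum_divide_distrib)
  also have "(\<Sum>r\<in>I. \<Sum>s\<in>I. (norm (c s))\<^sup>2 * K s r) = (\<Sum>r\<in>I. \<Sum>s\<in>I. (norm (c r))\<^sup>2 * K r s)"
    by (rule sum.swap)
  also have "((\<Sum>r\<in>I. \<Sum>s\<in>I. (norm (c r))\<^sup>2 * K r s) + (\<Sum>r\<in>I. \<Sum>s\<in>I. (norm (c r))\<^sup>2 * K r s)) / 2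
      = (\<Sum>r\<in>I. (norm (c r))\<^sup>2 * (\<Sum>s\<in>I. K r s))"
    by (simp only: sum_distrib_left) simp
  also have "\<dots> \<le> (\<Sum>r\<in>I. (norm (c r))\<^sup>2 * ((real M)\<^sup>2 + 4 / \<delta>\<^sup>2))"
    using row by (intro sum_mono mult_left_mono) auto
  finally show ?thesis by (simp add: sum_distrib_right[symmetric] mult.commute)
qed


text \<open>Multiplied by the product over W = U \<union> V the difference becomes an integer
  \<open>T\<close>, and that product is at most Q^2, so it suffices that T is nonzero. Modulo a
  prime p of W only the term of p survives in \<open>T\<close>; hence T = 0 would make p divide
  \<open>d p\<close>, and |d p| < p would leave only d p = 0.\<close>

lemma fraction_sum_separated:
  fixes a b :: "nat \<Rightarrow> nat"
  assumes U: "finite U" "\<And>p. p \<in> U \<Longrightarrow> prime p" and V: "finite V" "\<And>p. p \<in> V \<Longrightarrow> prime p"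
    and Q: "\<Prod>U \<le> Q" "\<Prod>V \<le> Q"
    and a: "a \<in> Pi\<^sub>E U (\<lambda>p. {1..<p})" and b: "b \<in> Pi\<^sub>E V (\<lambda>p. {1..<p})"
    and ne: "(U, a) \<noteq> (V, b)"
  shows "\<bar>(\<Sum>p\<in>U. real (a p) / real p) - (\<Sum>p\<in>V. real (b p) / real p) - of_int m\<bar> \<ge> 1 / (real Q)\<^sup>2"
proof -
  define W where "W = U \<union> V"
  \<comment> \<open>The value 0 encodes that p lies outside X. Genuine numerators lie in {1..<p}, so
    the vanishing of all \<open>d p\<close> recovers U = V as well as a = b.\<close>
  define ext where "ext X f p = (if p \<in> X then int (f p) else 0)" for X and f :: "nat \<Rightarrow> nat" and p
  define d where "d p = ext U a p - ext V b p" for p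
  define T where "T = (\<Sum>p\<in>W. d p * int (\<Prod>(W - {p}))) - m * int (\<Prod>W)"
  have W: "finite W" "\<And>p. p \<in> W \<Longrightarrow> prime p" using U V by (auto simp: W_def)
  have rng: "a p \<in> {1..<p}" if "p \<in> U" for p using a that by auto
  have rng': "b p \<in> {1..<p}" if "p \<in> V" for p using b that by auto
  have dlt: "\<bar>d p\<bar> < int p" if "p \<in> W" for p
    using that rng[of p] rng'[of p] by (auto simp: d_def ext_def W_def)
  have W0: "\<Prod>W > 0" using W by (auto intro: prod_pos prime_gt_0_nat)
  have extsum: "(\<Sum>p\<in>X. real (f p) / real p) = (\<Sum>p\<in>W. of_int (ext X f p) / real p)"
    if "X \<subseteq> W" for X f
    using that W(1) by (intro sum.mono_neutral_cong_left) (auto simp: ext_def)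
  have "((\<Sum>p\<in>U. real (a p) / real p) - (\<Sum>p\<in>V. real (b p) / real p) - of_int m) * real (\<Prod>W)
      = (\<Sum>p\<in>W. of_int (d p) * (real (\<Prod>W) / real p)) - of_int m * real (\<Prod>W)"
    by (subst (1 2) extsum)
       (auto simp: W_def d_def sum_distrib_right diff_divide_distrib ring_distribs simp flip: sum_subtractf)
  also have "(\<Sum>p\<in>W. of_int (d p) * (real (\<Prod>W) / real p)) = (\<Sum>p\<in>W. of_int (d p) * real (\<Prod>(W - {p})))"
  proof (intro sum.cong refl)
    fix p assume p: "p \<in> W"
    have "\<Prod>W = p * \<Prod>(W - {p})" using prod.remove[OF W(1) p, of "\<lambda>x. x"] by simp
    moreover have "p > 0" using W(2)[OF p] by (rule prime_gt_0_nat)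
    ultimately show "of_int (d p) * (real (\<Prod>W) / real p) = of_int (d p) * real (\<Prod>(W - {p}))" by simp
  qed
  finally have T: "((\<Sum>p\<in>U. real (a p) / real p) - (\<Sum>p\<in>V. real (b p) / real p) - of_int m) * real (\<Prod>W) = of_int T"
    by (simp add: T_def)
  have "T \<noteq> 0"
  proof
    assume T0: "T = 0"
    have d0: "d p = 0" if p: "p \<in> W" for p
    proof -
      have "int p dvd d q * int (\<Prod>(W - {q}))" if "q \<in> W - {p}" for q
      proof -
        have "p dvd \<Prod>(W - {q})" using W(1) p that by (intro dvd_prodI) auto
        hence "int p dvd int (\<Prod>(W - {q}))" by (simp only: int_dvd_int_iff)
        thus ?thesis by (rule dvd_mult)
      qed
      hence "int p dvd (\<Sum>q\<in>W - {p}. d q * int (\<Prod>(W - {q})))" by (rule dvd_sum)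
      moreover have "int p dvd m * int (\<Prod>W)"
        using W(1) p by (intro dvd_mult) (metis dvd_prodI int_dvd_int_iff)
      moreover have "d p * int (\<Prod>(W - {p})) = m * int (\<Prod>W) - (\<Sum>q\<in>W - {p}. d q * int (\<Prod>(W - {q})))"
        using T0 sum.remove[OF W(1) p, of "\<lambda>q. d q * int (\<Prod>(W - {q}))"] by (simp add: T_def)
      ultimately have "int p dvd d p * int (\<Prod>(W - {p}))" by simp
      moreover have "\<not> p dvd \<Prod>(W - {p})"
      proof
        assume "p dvd \<Prod>(W - {p})"
        then obtain q where "q \<in> W - {p}" "p dvd q"
          using W(1) prime_dvd_prod_iff[of "W - {p}" p "\<lambda>x. x"] W(2)[OF p] by auto
        thus False using W(2)[of q] W(2)[OF p] primes_dvd_imp_eq[of p q] by auto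
      qed
      moreover have "prime (int p)" using W(2)[OF p] by simp
      ultimately have "int p dvd d p"
        using prime_dvd_mult_iff by (metis int_dvd_int_iff)
      thus "d p = 0" using dlt[OF p] dvd_imp_le_int[of "d p" "int p"] by linarith
    qed
    have "U = V"
    proof (intro set_eqI iffI)
      fix p assume p: "p \<in> U"
      thus "p \<in> V" using d0[of p] rng[OF p] by (auto simp: W_def d_def ext_def split: if_splits)
    next
      fix p assume p: "p \<in> V"
      thus "p \<in> U" using d0[of p] rng'[OF p] by (auto simp: W_def d_def ext_def split: if_splits)
    qed
    moreover have "a = b"
    proof (rule PiE_ext[OF a])
      show "b \<in> Pi\<^sub>E U (\<lambda>p. {1..<p})" using b \<open>U = V\<close> by simp
      fix p assume "p \<in> U"
      thus "a p = b p" using d0[of p] \<open>U = V\<close> by (auto simp: W_def d_def ext_def)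
    qed
    ultimately show False using ne by simp
  qed
  hence "1 \<le> \<bar>of_int T :: real\<bar>" by linarith
  also have "\<dots> = \<bar>(\<Sum>p\<in>U. real (a p) / real p) - (\<Sum>p\<in>V. real (b p) / real p) - of_int m\<bar> * real (\<Prod>W)"
    unfolding T[symmetric] abs_mult by (simp only: abs_of_nat)
  finally have ge: "\<bar>(\<Sum>p\<in>U. real (a p) / real p) - (\<Sum>p\<in>V. real (b p) / real p) - of_int m\<bar> \<ge> 1 / real (\<Prod>W)"
    using W0 by (subst pos_divide_le_eq) (simp_all del: of_nat_prod)
  have "\<Prod>W * 1 \<le> \<Prod>W * \<Prod>(U \<inter> V)"
    using U by (intro mult_left_mono prod_ge_1) (auto simp: Suc_le_eq intro: prime_gt_0_nat)
  also have "\<dots> = \<Prod>U * \<Prod>V"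
    unfolding W_def using U V by (intro prod.union_inter)
  also have "\<dots> \<le> Q * Q" using Q by (intro mult_mono) auto
  finally have "real (\<Prod>W) \<le> (real Q)\<^sup>2"
    by (simp add: power2_eq_square flip: of_nat_mult del: of_nat_prod)
  moreover have "0 < real (\<Prod>W)" using W0 by (simp only: of_nat_0_less_iff)
  ultimately have "1 / real (\<Prod>W) \<ge> 1 / (real Q)\<^sup>2"
    by (intro divide_left_mono mult_pos_pos) linarith+
  with ge show ?thesis by linarith
qed

text \<open>
  A squarefree modulus is represented by its set \<open>U\<close> of prime factors. The proof uses the dual form:
  with the mean-zero weights above, \<open>\<Sum>\<^sub>U \<Prod>\<^sub>p\<^sub>\<in>\<^sub>U \<psi>\<^sub>p\<close> takes the constant value \<open>L\<close> on \<open>S\<close>, while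
  the squares of its Fourier coefficients also add up to \<open>L\<close>.
\<close>

theorem large_sieve:
  fixes Om :: "nat \<Rightarrow> nat set" and Q N :: nat
  assumes QN: "Q\<^sup>2 \<le> N" "N > 0"
    and fin: "finite \<Q>" and \<Q>: "\<And>U. U \<in> \<Q> \<Longrightarrow> finite U" "\<And>U. U \<in> \<Q> \<Longrightarrow> \<Prod>U \<le> Q"
      "\<And>U p. U \<in> \<Q> \<Longrightarrow> p \<in> U \<Longrightarrow> prime p"
    and Om: "\<And>U p. U \<in> \<Q> \<Longrightarrow> p \<in> U \<Longrightarrow> Om p \<subseteq> {..<p} \<and> card (Om p) < p"
    and S: "S \<subseteq> {..N}" "\<And>U p n. U \<in> \<Q> \<Longrightarrow> p \<in> U \<Longrightarrow> n \<in> S \<Longrightarrow> n mod p \<notin> Om p"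
  shows "real (card S) * (\<Sum>U\<in>\<Q>. \<Prod>p\<in>U. real (card (Om p)) / (real p - real (card (Om p)))) \<le> 8 * real N"
proof -
  define g where "g p = real (card (Om p)) / (real p - real (card (Om p)))" for p
  define P where "P = \<Union>\<Q>"
  define L where "L = (\<Sum>U\<in>\<Q>. \<Prod>p\<in>U. g p)"
  have P: "prime p" "Om p \<subseteq> {..<p}" "card (Om p) < p" "\<And>n. n \<in> S \<Longrightarrow> n mod p \<notin> Om p" if "p \<in> P" for p
  proof -
    from that obtain U where U: "U \<in> \<Q>" "p \<in> U" by (auto simp: P_def)
    show "prime p" using U by (rule \<Q>(3))
    show "Om p \<subseteq> {..<p}" "card (Om p) < p" using Om[OF U] by simp_all
    show "n mod p \<notin> Om p" if "n \<in> S" for n using U that by (rule S(2))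
  qed
  have "\<forall>p\<in>P. \<exists>c. (\<forall>n. n mod p \<notin> Om p \<longrightarrow> (\<Sum>a\<in>{1..<p}. c a * expi (real n * (real a / real p))) = of_real (g p))
           \<and> (\<Sum>a\<in>{1..<p}. (norm (c a))\<^sup>2) = g p"
  proof
    fix p assume pP: "p \<in> P"
    obtain c where
      "\<And>n. n mod p \<notin> Om p \<Longrightarrow> (\<Sum>a\<in>{1..<p}. c a * expi (real n * (real a / real p))) = of_real (g p)"
      "(\<Sum>a\<in>{1..<p}. (norm (c a))\<^sup>2) = g p"
      using sieve_weight_expansion[OF prime_gt_0_nat[OF P(1)[OF pP]] P(2,3)[OF pP]]
      unfolding g_def by blast
    thus "\<exists>c. (\<forall>n. n mod p \<notin> Om p \<longrightarrow> (\<Sum>a\<in>{1..<p}. c a * expi (real n * (real a / real p))) = of_real (g p))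
           \<and> (\<Sum>a\<in>{1..<p}. (norm (c a))\<^sup>2) = g p"
      by blast
  qed
  from bchoice[OF this] obtain c where "\<forall>p\<in>P. (\<forall>n. n mod p \<notin> Om p \<longrightarrow> (\<Sum>a\<in>{1..<p}. c p a * expi (real n * (real a / real p))) = of_real (g p))
           \<and> (\<Sum>a\<in>{1..<p}. (norm (c p a))\<^sup>2) = g p" ..
  hence c:
    "\<And>p n. p \<in> P \<Longrightarrow> n mod p \<notin> Om p \<Longrightarrow> (\<Sum>a\<in>{1..<p}. c p a * expi (real n * (real a / real p))) = of_real (g p)"
    "\<And>p. p \<in> P \<Longrightarrow> (\<Sum>a\<in>{1..<p}. (norm (c p a))\<^sup>2) = g p"
    by simp_all
  \<comment> \<open>By the Chinese remainder theorem the pairs (U, a) represent the reduced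
    fractions modulo 1 with denominator \<open>\<Prod>U\<close>, in a form in which the coefficients
    \<open>cc\<close> factor over the primes of U.\<close>
  define I where "I = Sigma \<Q> (\<lambda>U. Pi\<^sub>E U (\<lambda>p. {1..<p}))"
  define x where "x = (\<lambda>(U, a). \<Sum>p\<in>U. real (a p) / real p)"
  define cc where "cc = (\<lambda>(U, a). \<Prod>p\<in>U. c p (a p))"
  have finI: "finite I" unfolding I_def using fin \<Q>(1) by (intro finite_SigmaI finite_PiE) auto
  have UP: "U \<in> \<Q> \<Longrightarrow> p \<in> U \<Longrightarrow> p \<in> P" for U p by (auto simp: P_def)
  have g0: "g p \<ge> 0" if "p \<in> P" for p using P[OF that] by (simp add: g_def)
  have L0: "L \<ge> 0" unfolding L_def using g0 UP by (intro sum_nonneg prod_nonneg) auto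
  have sumI: "(\<Sum>r\<in>I. F r) = (\<Sum>U\<in>\<Q>. \<Sum>a\<in>Pi\<^sub>E U (\<lambda>p. {1..<p}). F (U, a))" for F :: "_ \<Rightarrow> 'c :: comm_monoid_add"
    unfolding I_def using fin \<Q>(1) by (subst sum.Sigma) (auto intro!: finite_PiE)
  have normcc: "(\<Sum>r\<in>I. (norm (cc r))\<^sup>2) = L"
  proof -
    have "(\<Sum>r\<in>I. (norm (cc r))\<^sup>2) = (\<Sum>U\<in>\<Q>. \<Sum>a\<in>Pi\<^sub>E U (\<lambda>p. {1..<p}). \<Prod>p\<in>U. (norm (c p (a p)))\<^sup>2)"
      by (simp add: sumI cc_def prod_power_distrib flip: prod_norm)
    also have "\<dots> = (\<Sum>U\<in>\<Q>. \<Prod>p\<in>U. \<Sum>a\<in>{1..<p}. (norm (c p a))\<^sup>2)"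
      using \<Q>(1) by (intro sum.cong refl prod_sum_PiE [symmetric]) auto
    also have "\<dots> = L" unfolding L_def
      using UP c(2) by (intro sum.cong prod.cong refl) auto
    finally show ?thesis .
  qed
  have fS: "(\<Sum>r\<in>I. cc r * expi (real n * x r)) = of_real L" if n: "n \<in> S" for n
  proof -
    have "(\<Sum>r\<in>I. cc r * expi (real n * x r))
        = (\<Sum>U\<in>\<Q>. \<Sum>a\<in>Pi\<^sub>E U (\<lambda>p. {1..<p}). \<Prod>p\<in>U. c p (a p) * expi (real n * (real (a p) / real p)))"
      unfolding sumI cc_def x_def using \<Q>(1)
      by (intro sum.cong refl) (simp add: sum_distrib_left expi_sum prod.distrib)
    also have "\<dots> = (\<Sum>U\<in>\<Q>. \<Prod>p\<in>U. \<Sum>a\<in>{1..<p}. c p a * expi (real n * (real a / real p)))"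
      using \<Q>(1) by (intro sum.cong refl prod_sum_PiE [symmetric]) auto
    also have "\<dots> = (\<Sum>U\<in>\<Q>. \<Prod>p\<in>U. of_real (g p))"
      using UP c(1) P(4) n by (intro sum.cong prod.cong refl) auto
    finally show ?thesis by (simp add: L_def)
  qed
  show ?thesis
  proof (cases "Q = 0 \<or> L = 0")
    case True
    have "L = 0"
    proof (rule ccontr)
      assume "L \<noteq> 0"
      with True have "Q = 0" by simp
      have "\<Q> = {}"
      proof (rule ccontr)
        assume "\<Q> \<noteq> {}"
        then obtain U where U: "U \<in> \<Q>" by auto
        have "\<Prod>U \<noteq> 0" using \<Q>(1)[OF U] \<Q>(3)[OF U, of 0] by (auto simp: prod_zero_iff)
        thus False using \<Q>(2)[OF U] \<open>Q = 0\<close> by simp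
      qed
      with \<open>L \<noteq> 0\<close> show False by (simp add: L_def)
    qed
    thus ?thesis by (simp flip: g_def L_def)
  next
    case False
    hence Q: "Q > 0" and L: "L > 0" using L0 by auto
    \<comment> \<open>For n in S and j < N one has n + j < 2N, so every n in S is a difference i - j
      for N pairs below \<open>M\<close>. This puts N |S| L^2 on the left, against (4 N^2 + 4 Q^4) L
      on the right, and Q^2 \<le> N makes the latter at most 8 N^2 L.\<close>
    define M where "M = 2 * N"
    have finS: "finite S" using S(1) finite_subset by blast
    have inj: "inj_on (\<lambda>(n, j). (n + j, j)) (S \<times> {..<N})" by (auto simp: inj_on_def)
    have "real (card S) * real N * L\<^sup>2 = (\<Sum>(n, j)\<in>S \<times> {..<N}. (norm (\<Sum>r\<in>I. cc r * expi (real n * x r)))\<^sup>2)"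
    proof -
      have "(\<Sum>(n, j)\<in>S \<times> {..<N}. (norm (\<Sum>r\<in>I. cc r * expi (real n * x r)))\<^sup>2) = (\<Sum>(n, j)\<in>S \<times> {..<N}. L\<^sup>2)"
        by (intro sum.cong refl) (auto simp: fS)
      thus ?thesis by (simp add: card_cartesian_product)
    qed
    also have "\<dots> = (\<Sum>(i, j)\<in>(\<lambda>(n, j). (n + j, j)) ` (S \<times> {..<N}). (norm (\<Sum>r\<in>I. cc r * expi ((real i - real j) * x r)))\<^sup>2)"
      by (subst sum.reindex[OF inj]) (simp add: case_prod_unfold)
    also have "\<dots> \<le> (\<Sum>(i, j)\<in>{..<M} \<times> {..<M}. (norm (\<Sum>r\<in>I. cc r * expi ((real i - real j) * x r)))\<^sup>2)"
      using S(1) by (intro sum_mono2) (auto simp: M_def)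
    also have "\<dots> = (\<Sum>i<M. \<Sum>j<M. (norm (\<Sum>r\<in>I. cc r * expi ((real i - real j) * x r)))\<^sup>2)"
      by (simp add: sum.cartesian_product)
    also have "\<dots> \<le> ((real M)\<^sup>2 + 4 / (1 / (real Q)\<^sup>2)\<^sup>2) * (\<Sum>r\<in>I. (norm (cc r))\<^sup>2)"
    proof (intro dual_large_sieve finI)
      fix r s :: "nat set \<times> (nat \<Rightarrow> nat)" and m :: int
      assume "r \<in> I" "s \<in> I" "r \<noteq> s"
      thus "1 / (real Q)\<^sup>2 \<le> \<bar>x r - x s - of_int m\<bar>"
        unfolding x_def I_def using \<Q>
        by (auto simp: case_prod_unfold intro!: fraction_sum_separated)
    qed (use Q in auto)
    also have "\<dots> = ((real M)\<^sup>2 + 4 * (real Q ^ 2)\<^sup>2) * L"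
      by (simp add: normcc power_divide)
    also have "\<dots> \<le> ((real M)\<^sup>2 + 4 * (real N)\<^sup>2) * L"
    proof -
      have "real Q ^ 2 \<le> real N" using QN by (metis of_nat_le_iff of_nat_power)
      thus ?thesis using L by (intro mult_right_mono add_left_mono mult_left_mono power_mono) auto
    qed
    also have "\<dots> = (8 * real N) * (real N * L)" by (simp add: M_def power2_eq_square algebra_simps)
    finally have "(real (card S) * L) * (real N * L) \<le> (8 * real N) * (real N * L)"
      by (simp add: power2_eq_square mult_ac)
    hence "real (card S) * L \<le> 8 * real N"
      using L QN by (subst (asm) mult_le_cancel_right) auto
    thus ?thesis by (simp add: L_def g_def)
  qed
qed

section \<open>Gallagher's larger sieve and lower bounds for sieve sums\<close>

text \<open>Cauchy-Schwarz over the occupied classes: the double sum counts congruent pairs, which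
  is the sum of the squared class sizes.\<close>

lemma card_sq_le_card_residues:
  fixes S :: "nat set"
  assumes S: "finite S"
  shows "(real (card S))\<^sup>2 \<le> real (card ((\<lambda>n. n mod p) ` S)) * (\<Sum>m\<in>S. \<Sum>n\<in>S. if m mod p = n mod p then 1 else 0)"
proof -
  define R where "R = (\<lambda>n. n mod p) ` S"
  define c where "c r = real (card {n\<in>S. n mod p = r})" for r
  have finR: "finite R" using S by (simp add: R_def)
  have 1: "real (card S) = (\<Sum>r\<in>R. 1 * c r)"
    using sum.image_gen[OF S, of "\<lambda>_. 1 :: real" "\<lambda>n. n mod p"] by (simp add: R_def c_def)
  have "(\<Sum>m\<in>S. \<Sum>n\<in>S. if m mod p = n mod p then 1 else 0) = (\<Sum>m\<in>S. c (m mod p))"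
    unfolding c_def using S by (intro sum.cong refl) (simp add: sum.If_cases Int_def eq_commute)
  also have "\<dots> = (\<Sum>r\<in>R. \<Sum>m\<in>{n\<in>S. n mod p = r}. c (m mod p))"
    unfolding R_def by (rule sum.image_gen[OF S])
  also have "\<dots> = (\<Sum>r\<in>R. (c r)\<^sup>2)"
    by (intro sum.cong refl) (simp add: c_def power2_eq_square)
  finally have 2: "(\<Sum>m\<in>S. \<Sum>n\<in>S. if m mod p = n mod p then 1 else 0) = (\<Sum>r\<in>R. (c r)\<^sup>2)" .
  have "(\<Sum>r\<in>R. 1 * c r)\<^sup>2 \<le> (\<Sum>r\<in>R. 1\<^sup>2) * (\<Sum>r\<in>R. (c r)\<^sup>2)"
    by (rule Cauchy_Schwarz_ineq_sum)
  thus ?thesis unfolding 1 2 R_def[symmetric] by simp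
qed

lemma sum_ln_prime_divisors_le:
  assumes P: "finite P" "\<And>p. p \<in> P \<Longrightarrow> prime p" and d: "d > (0 :: nat)"
  shows "(\<Sum>p\<in>P. if p dvd d then ln (real p) else 0) \<le> ln (real d)"
proof -
  define P' where "P' = {p\<in>P. p dvd d}"
  have "\<Prod>P' dvd d"
    using P by (intro prod_primes_dvd) (auto simp: P'_def)
  hence le: "\<Prod>P' \<le> d" using d by (intro dvd_imp_le)
  have pos: "\<Prod>P' > 0" using P by (intro prod_pos) (auto simp: P'_def intro: prime_gt_0_nat)
  have "(\<Sum>p\<in>P. if p dvd d then ln (real p) else 0) = (\<Sum>p\<in>P'. ln (real p))"
    using P(1) by (simp add: P'_def sum.inter_filter)
  also have "\<dots> = ln (real (\<Prod>P'))"
    unfolding of_nat_prod using P by (intro ln_prod [symmetric]) (auto simp: P'_def intro: prime_gt_0_nat)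
  also have "\<dots> \<le> ln (real d)"
    using le pos by (subst ln_le_cancel_iff) (simp_all only: of_nat_0_less_iff of_nat_le_iff d)
  finally show ?thesis .
qed

text \<open>Gallagher's argument: weight congruent pairs by ln p and sum over P. A pair of distinct
  m, n receives weight only from the primes dividing m - n, in total at most ln N, while each
  diagonal pair receives the whole sum of ln p. Once |S| is at least of the order of that sum, the
  right-hand side is ln N + O(1), which limits how few classes S can occupy.\<close>

theorem larger_sieve:
  fixes S :: "nat set" and \<nu> :: "nat \<Rightarrow> real"
  assumes S: "S \<subseteq> {..N}" "S \<noteq> {}" and N: "N \<ge> 1"
    and P: "finite P" "\<And>p. p \<in> P \<Longrightarrow> prime p"
    and \<nu>: "\<And>p. p \<in> P \<Longrightarrow> real (card ((\<lambda>n. n mod p) ` S)) \<le> \<nu> p"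
  shows "(\<Sum>p\<in>P. ln (real p) / \<nu> p) \<le> (\<Sum>p\<in>P. ln (real p)) / real (card S) + ln (real N)"
proof -
  have finS: "finite S" using S(1) finite_subset by blast
  define s where "s = real (card S)"
  have s: "s > 0" using S finS by (simp add: s_def card_gt_0_iff)
  define e where "e m n p = (if m mod p = n mod p then 1 else 0 :: real)" for m n p :: nat
  have lnp: "ln (real p) \<ge> 0" if "p \<in> P" for p using prime_ge_1_nat[OF P(2)[OF that]] by simp
  have "s\<^sup>2 * (\<Sum>p\<in>P. ln (real p) / \<nu> p) = (\<Sum>p\<in>P. ln (real p) * (s\<^sup>2 / \<nu> p))"
    by (simp add: sum_distrib_left mult_ac)
  also have "\<dots> \<le> (\<Sum>p\<in>P. ln (real p) * (\<Sum>m\<in>S. \<Sum>n\<in>S. e m n p))"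
  proof (intro sum_mono mult_left_mono lnp)
    fix p assume p: "p \<in> P"
    have "card ((\<lambda>n. n mod p) ` S) > 0" using S finS by (simp add: card_gt_0_iff)
    hence \<nu>0: "\<nu> p > 0" using \<nu>[OF p] by linarith
    have "s\<^sup>2 \<le> real (card ((\<lambda>n. n mod p) ` S)) * (\<Sum>m\<in>S. \<Sum>n\<in>S. e m n p)"
      unfolding s_def e_def by (rule card_sq_le_card_residues[OF finS])
    also have "\<dots> \<le> \<nu> p * (\<Sum>m\<in>S. \<Sum>n\<in>S. e m n p)"
      using \<nu>[OF p] by (intro mult_right_mono sum_nonneg) (auto simp: e_def)
    finally show "s\<^sup>2 / \<nu> p \<le> (\<Sum>m\<in>S. \<Sum>n\<in>S. e m n p)" using \<nu>0 by (simp add: field_simps)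
  qed
  also have "\<dots> = (\<Sum>m\<in>S. \<Sum>n\<in>S. \<Sum>p\<in>P. ln (real p) * e m n p)"
  proof -
    have "(\<Sum>p\<in>P. ln (real p) * (\<Sum>m\<in>S. \<Sum>n\<in>S. e m n p)) = (\<Sum>p\<in>P. \<Sum>m\<in>S. \<Sum>n\<in>S. ln (real p) * e m n p)"
      by (simp add: sum_distrib_left)
    also have "\<dots> = (\<Sum>m\<in>S. \<Sum>p\<in>P. \<Sum>n\<in>S. ln (real p) * e m n p)" by (rule sum.swap)
    also have "\<dots> = (\<Sum>m\<in>S. \<Sum>n\<in>S. \<Sum>p\<in>P. ln (real p) * e m n p)" by (intro sum.cong refl sum.swap)
    finally show ?thesis .
  qed
  also have "\<dots> \<le> (\<Sum>m\<in>S. \<Sum>n\<in>S. (if m = n then (\<Sum>p\<in>P. ln (real p)) else 0) + ln (real N))"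
  proof (intro sum_mono)
    fix m n assume mn: "m \<in> S" "n \<in> S"
    show "(\<Sum>p\<in>P. ln (real p) * e m n p) \<le> (if m = n then (\<Sum>p\<in>P. ln (real p)) else 0) + ln (real N)"
    proof (cases "m = n")
      case True
      thus ?thesis using N by (simp add: e_def)
    next
      case False
      define d where "d = nat \<bar>int m - int n\<bar>"
      have "m \<le> N" "n \<le> N" using mn S(1) by auto
      hence d: "d > 0" "d \<le> N" using False by (auto simp: d_def)
      have dv: "m mod p = n mod p \<longleftrightarrow> p dvd d" for p
      proof -
        have "m mod p = n mod p \<longleftrightarrow> int m mod int p = int n mod int p"
          by (metis of_nat_eq_iff zmod_int)
        also have "\<dots> \<longleftrightarrow> int p dvd \<bar>int m - int n\<bar>"
          by (simp add: mod_eq_dvd_iff)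
        also have "\<bar>int m - int n\<bar> = int d" by (simp add: d_def)
        finally show ?thesis by (simp only: int_dvd_int_iff)
      qed
      have "(\<Sum>p\<in>P. ln (real p) * e m n p) = (\<Sum>p\<in>P. if p dvd d then ln (real p) else 0)"
        by (intro sum.cong refl) (simp add: e_def dv)
      also have "\<dots> \<le> ln (real d)" using P d by (intro sum_ln_prime_divisors_le)
      also have "\<dots> \<le> ln (real N)" using d by simp
      finally show ?thesis using False by simp
    qed
  qed
  also have "\<dots> = s * (\<Sum>p\<in>P. ln (real p)) + s\<^sup>2 * ln (real N)"
    using finS by (simp add: sum.distrib s_def power2_eq_square distrib_left)
  also have "\<dots> = s\<^sup>2 * ((\<Sum>p\<in>P. ln (real p)) / s + ln (real N))"
    using s by (simp add: field_simps power2_eq_square)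
  finally show ?thesis using s by (simp add: s_def)
qed

text \<open>A set U of at most K indices carries mass at most K, because h \<le> 1, so extending it
  by one index gains a factor of at least s - K; every (m + 1)-set arises from m + 1 such
  extensions. \<open>K\<close> is kept apart from \<open>m\<close> so that the subtracted constant
  stays the same throughout the induction.\<close>

lemma elementary_symmetric_lower:
  fixes h :: "'a \<Rightarrow> real"
  assumes P: "finite P" and h: "\<And>p. p \<in> P \<Longrightarrow> 0 \<le> h p" "\<And>p. p \<in> P \<Longrightarrow> h p \<le> 1"
    and K: "real K \<le> (\<Sum>p\<in>P. h p)" and m: "m \<le> K"
  shows "((\<Sum>p\<in>P. h p) - real K) ^ m \<le> fact m * (\<Sum>U | U \<subseteq> P \<and> card U = m. \<Prod>p\<in>U. h p)"
  using m
proof (induction m)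
  case 0
  have "{U. U \<subseteq> P \<and> card U = 0} = {{}}" using P by (auto dest: finite_subset)
  thus ?case by simp
next
  case (Suc m)
  define E where "E m = {U. U \<subseteq> P \<and> card U = m}" for m
  define s where "s = (\<Sum>p\<in>P. h p)"
  have finE: "finite (E m)" for m using P by (auto simp: E_def)
  have finU: "finite U" if "U \<in> E m" for U m using that P by (auto simp: E_def dest: finite_subset)
  have nn: "(\<Prod>p\<in>U. h p) \<ge> 0" if "U \<in> E m" for U m using that h by (auto simp: E_def intro!: prod_nonneg)
  have "(s - real K) ^ Suc m \<le> (s - real K) * (fact m * (\<Sum>U\<in>E m. \<Prod>p\<in>U. h p))"
    using Suc K unfolding s_def E_def power_Suc by (intro mult_left_mono) auto
  also have "\<dots> = fact m * (\<Sum>U\<in>E m. (\<Prod>p\<in>U. h p) * (s - real K))"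
    by (simp add: sum_distrib_left mult_ac)
  also have "\<dots> \<le> fact m * (\<Sum>U\<in>E m. (\<Prod>p\<in>U. h p) * (\<Sum>p\<in>P - U. h p))"
  proof (intro mult_left_mono sum_mono nn)
    fix U assume U: "U \<in> E m"
    have "(\<Sum>p\<in>U. h p) \<le> (\<Sum>p\<in>U. 1)" using U h by (intro sum_mono) (auto simp: E_def)
    also have "\<dots> \<le> real K" using U Suc.prems by (simp add: E_def)
    finally have "(\<Sum>p\<in>U. h p) \<le> real K" .
    moreover have "(\<Sum>p\<in>P - U. h p) = s - (\<Sum>p\<in>U. h p)"
      using U P unfolding s_def E_def by (intro sum_diff) auto
    ultimately show "s - real K \<le> (\<Sum>p\<in>P - U. h p)" by simp
  qed auto
  also have "(\<Sum>U\<in>E m. (\<Prod>p\<in>U. h p) * (\<Sum>p\<in>P - U. h p)) = (\<Sum>(U, p)\<in>Sigma (E m) (\<lambda>U. P - U). \<Prod>q\<in>insert p U. h q)"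
    unfolding sum_distrib_left using P finE finU
    by (subst sum.Sigma) (auto intro!: sum.cong simp: mult.commute)
  also have "\<dots> = (\<Sum>(V, p)\<in>Sigma (E (Suc m)) (\<lambda>V. V). \<Prod>q\<in>V. h q)"
  proof (rule sum.reindex_bij_witness[of _ "\<lambda>(V, p). (V - {p}, p)" "\<lambda>(U, p). (insert p U, p)"], goal_cases)
    case (2 a)
    obtain U p where a: "a = (U, p)" "U \<in> E m" "p \<in> P" "p \<notin> U" using 2 by auto
    have "card (insert p U) = Suc m" using a finU[OF a(2)] by (simp add: E_def)
    thus ?case using a by (simp add: E_def)
  next
    case (4 b)
    obtain V p where b: "b = (V, p)" "V \<in> E (Suc m)" "p \<in> V" using 4 by auto
    have "card (V - {p}) = m" using b finU[OF b(2)] by (simp add: E_def)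
    thus ?case using b by (auto simp: E_def)
  qed (auto simp: insert_absorb)
  also have "\<dots> = (\<Sum>V\<in>E (Suc m). \<Sum>p\<in>V. \<Prod>q\<in>V. h q)"
    using P finE finU by (subst sum.Sigma) auto
  also have "\<dots> = real (Suc m) * (\<Sum>V\<in>E (Suc m). \<Prod>q\<in>V. h q)"
    by (simp add: sum_distrib_left E_def)
  finally show ?case by (simp add: s_def E_def algebra_simps)
qed

text \<open>The moduli take at most one prime from each interval (w, w^2] with w = z^(2^j), j < J.
  Their size is at most z^(2 + 4 + ... + 2^J), and each interval multiplies the sum by at least 1 +
  s. Since J can be about log_2 (log Q / log z), this is a power of log Q with exponent log_2 (1 +
  s).\<close>

lemma sieve_family_scales:
  assumes z: "z \<ge> (1 :: real)" and s: "s \<ge> 0"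
    and scale: "\<And>w. w \<ge> z \<Longrightarrow> (\<Sum>p\<in>primes_in w (w\<^sup>2). h p) \<ge> s"
    and h: "\<And>p. h p \<ge> (0 :: real)"
  obtains \<Q> where "finite \<Q>" "\<And>U. U \<in> \<Q> \<Longrightarrow> U \<subseteq> primes_in z (z ^ (2 ^ J))"
    "\<And>U. U \<in> \<Q> \<Longrightarrow> real (\<Prod>U) \<le> z ^ (2 ^ (J + 1))"
    "(\<Sum>U\<in>\<Q>. \<Prod>p\<in>U. h p) \<ge> (1 + s) ^ J"
proof (induction J arbitrary: thesis)
  case 0
  show ?case by (rule 0[of "{{}}"]) (use z in auto)
next
  case (Suc J)
  obtain \<Q> where \<Q>: "finite \<Q>" "\<And>U. U \<in> \<Q> \<Longrightarrow> U \<subseteq> primes_in z (z ^ (2 ^ J))"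
    "\<And>U. U \<in> \<Q> \<Longrightarrow> real (\<Prod>U) \<le> z ^ (2 ^ (J + 1))"
    "(\<Sum>U\<in>\<Q>. \<Prod>p\<in>U. h p) \<ge> (1 + s) ^ J"
    using Suc.IH by blast
  define w where "w = z ^ (2 ^ J)"
  define P where "P = primes_in w (w\<^sup>2)"
  define ins where "ins = (\<lambda>(U, p :: nat). insert p U)"
  have w: "w \<ge> z" "w \<ge> 1" using z self_le_power[of z "2 ^ J"] by (auto simp: w_def one_le_power)
  have w2: "w\<^sup>2 = z ^ (2 ^ Suc J)" by (simp add: w_def power_mult [symmetric] mult.commute)
  have finU: "finite U" if "U \<in> \<Q>" for U using \<Q>(2)[OF that] finite_subset by blast
  have disj: "p \<notin> U" if "U \<in> \<Q>" "p \<in> P" for U p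
  proof
    assume "p \<in> U"
    hence "p \<in> primes_in z (z ^ (2 ^ J))" using \<Q>(2)[OF that(1)] by blast
    thus False using that(2) by (simp add: P_def primes_in_def w_def)
  qed
  have inj: "inj_on ins (\<Q> \<times> P)"
  proof (rule inj_onI, clarify)
    fix U p V q assume *: "U \<in> \<Q>" "p \<in> P" "V \<in> \<Q>" "q \<in> P" "ins (U, p) = ins (V, q)"
    hence "p = q" using disj[of U q] disj[of V p] by (auto simp: ins_def)
    thus "U = V \<and> p = q" using * disj[of U p] disj[of V p] by (auto simp: ins_def)
  qed
  define \<Q>' where "\<Q>' = \<Q> \<union> ins ` (\<Q> \<times> P)"
  have dis: "\<Q> \<inter> ins ` (\<Q> \<times> P) = {}" using disj by (auto simp: ins_def)
  have Psub: "P \<subseteq> primes_in z (z ^ (2 ^ Suc J))" using w by (auto simp: P_def primes_in_def w2)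
  have Qsub: "U \<subseteq> primes_in z (z ^ (2 ^ Suc J))" if "U \<in> \<Q>" for U
  proof -
    have "z ^ (2 ^ J) \<le> z ^ (2 ^ Suc J)" using z by (intro power_increasing) auto
    thus ?thesis using \<Q>(2)[OF that] by (force simp: primes_in_def)
  qed
  show ?case
  proof (rule Suc.prems[of \<Q>'])
    show "finite \<Q>'" using \<Q>(1) by (simp add: \<Q>'_def P_def)
    show "U \<subseteq> primes_in z (z ^ (2 ^ Suc J))" if "U \<in> \<Q>'" for U
      using that Qsub Psub by (auto simp: \<Q>'_def ins_def)
    show "real (\<Prod>U) \<le> z ^ (2 ^ (Suc J + 1))" if U: "U \<in> \<Q>'" for U
    proof -
      have mono: "z ^ (2 ^ (J + 1)) \<le> z ^ (2 ^ (Suc J + 1))"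
        using z by (intro power_increasing) auto
      consider "U \<in> \<Q>" | V p where "V \<in> \<Q>" "p \<in> P" "U = insert p V"
        using U by (auto simp: \<Q>'_def ins_def)
      thus ?thesis
      proof cases
        case 1
        thus ?thesis using \<Q>(3)[OF 1] mono by simp
      next
        case (2 V p)
        have "real (\<Prod>U) = real p * real (\<Prod>V)"
          using 2 finU[OF 2(1)] disj[OF 2(1,2)] by simp
        also have "\<dots> \<le> z ^ (2 ^ Suc J) * z ^ (2 ^ (J + 1))"
          using Psub 2(2) z by (intro mult_mono \<Q>(3) 2(1)) (auto simp: primes_in_def simp del: of_nat_prod)
        also have "\<dots> = z ^ (2 ^ (Suc J + 1))" by (simp flip: power_add)
        finally show ?thesis .
      qed
    qed
    have "(1 + s) ^ Suc J \<le> (\<Sum>U\<in>\<Q>. \<Prod>p\<in>U. h p) * (1 + s)"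
      using \<Q>(4) s by (simp add: mult.commute mult_right_mono)
    also have "\<dots> \<le> (\<Sum>U\<in>\<Q>. \<Prod>p\<in>U. h p) * (1 + (\<Sum>p\<in>P. h p))"
      using scale[OF w(1)] h by (intro mult_left_mono) (auto simp: P_def intro!: sum_nonneg prod_nonneg)
    also have "\<dots> = (\<Sum>U\<in>\<Q>. \<Prod>p\<in>U. h p) + (\<Sum>U\<in>\<Q>. \<Sum>p\<in>P. (\<Prod>p\<in>U. h p) * h p)"
      by (simp add: distrib_left sum_product)
    also have "(\<Sum>U\<in>\<Q>. \<Sum>p\<in>P. (\<Prod>p\<in>U. h p) * h p) = (\<Sum>U\<in>\<Q>. \<Sum>p\<in>P. \<Prod>q\<in>ins (U, p). h q)"
      using disj finU by (intro sum.cong refl) (simp add: ins_def mult.commute)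
    also have "\<dots> = (\<Sum>(U, p)\<in>\<Q> \<times> P. \<Prod>q\<in>ins (U, p). h q)"
      by (rule sum.cartesian_product)
    also have "(\<Sum>(U, p)\<in>\<Q> \<times> P. \<Prod>q\<in>ins (U, p). h q) = (\<Sum>U\<in>ins ` (\<Q> \<times> P). \<Prod>q\<in>U. h q)"
      by (subst sum.reindex[OF inj]) (simp add: case_prod_unfold)
    also have "(\<Sum>U\<in>\<Q>. \<Prod>p\<in>U. h p) + \<dots> = (\<Sum>U\<in>\<Q>'. \<Prod>p\<in>U. h p)"
      unfolding \<Q>'_def using \<Q>(1) dis by (subst sum.union_disjoint) (auto simp: P_def)
    finally show "(1 + s) ^ Suc J \<le> (\<Sum>U\<in>\<Q>'. \<Prod>p\<in>U. h p)" .
  qed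
qed

text \<open>Every q that is not squarefree is a multiple of some d^2 with d \<ge> 2, and the sum of
  1/d^2 over d \<ge> 2 is below 3/4.\<close>

lemma card_squarefree_ge:
  assumes "Q \<ge> 1"
  shows "real (card {q\<in>{1..Q}. squarefree q}) \<ge> real Q / 4"
proof -
  have "{1..Q} \<subseteq> {q\<in>{1..Q}. squarefree q} \<union> (\<Union>d\<in>{2..Q}. {q\<in>{1..Q}. d\<^sup>2 dvd q})"
  proof (intro subsetI UnCI)
    fix q assume q: "q \<in> {1..Q}" "q \<notin> (\<Union>d\<in>{2..Q}. {q\<in>{1..Q}. d\<^sup>2 dvd q})"
    have "squarefree q"
    proof (rule squarefreeI)
      fix d assume d: "d\<^sup>2 dvd q"
      have "d \<noteq> 0"
      proof
        assume "d = 0"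
        with d q show False by simp
      qed
      have "d \<le> d\<^sup>2" by (simp add: power2_eq_square)
      also have "\<dots> \<le> q" using d q by (intro dvd_imp_le) auto
      finally have "d \<le> Q" using q by auto
      hence "d < 2" using d q by force
      thus "is_unit d" using \<open>d \<noteq> 0\<close> by (cases d) auto
    qed
    thus "q \<in> {q\<in>{1..Q}. squarefree q}" using q by simp
  qed
  hence "card {1..Q} \<le> card ({q\<in>{1..Q}. squarefree q} \<union> (\<Union>d\<in>{2..Q}. {q\<in>{1..Q}. d\<^sup>2 dvd q}))"
    by (intro card_mono) auto
  also have "\<dots> \<le> card {q\<in>{1..Q}. squarefree q} + card (\<Union>d\<in>{2..Q}. {q\<in>{1..Q}. d\<^sup>2 dvd q})"
    by (rule card_Un_le)
  also have "card (\<Union>d\<in>{2..Q}. {q\<in>{1..Q}. d\<^sup>2 dvd q}) \<le> (\<Sum>d\<in>{2..Q}. card {q\<in>{1..Q}. d\<^sup>2 dvd q})"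
    by (rule card_UN_le) auto
  also have "(\<Sum>d\<in>{2..Q}. card {q\<in>{1..Q}. d\<^sup>2 dvd q}) = (\<Sum>d\<in>{2..Q}. Q div d\<^sup>2)"
    by (intro sum.cong refl card_multiples) auto
  finally have "real Q \<le> real (card {q\<in>{1..Q}. squarefree q}) + (\<Sum>d\<in>{2..Q}. real (Q div d\<^sup>2))"
    by (simp flip: of_nat_sum of_nat_add)
  also have "(\<Sum>d\<in>{2..Q}. real (Q div d\<^sup>2)) \<le> (\<Sum>d\<in>{2..Q}. real Q * (1 / (real d)\<^sup>2))"
    by (intro sum_mono) (metis mult.right_neutral of_nat_power of_nat_div_le_of_nat times_divide_eq_right)
  also have "\<dots> = real Q * (\<Sum>d\<in>{2..Q}. 1 / (real d)\<^sup>2)" by (simp add: sum_distrib_left)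
  also have "(\<Sum>d\<in>{2..Q}. 1 / (real d)\<^sup>2) \<le> 3 / 4"
  proof (cases "Q \<ge> 2")
    case True
    \<comment> \<open>Telescoping from d = 2 onwards would give only 1. The terms d = 2, 3, 4 are
      therefore evaluated, with sum 61/144 \<le> 1/2, and the telescoping begins after them.\<close>
    have "(\<Sum>d\<in>{2..Q}. 1 / (real d)\<^sup>2) \<le> 3 / 4 - 1 / real Q"  if "Q \<ge> 4" using that
    proof (induction Q rule: dec_induct)
      case base
      have "{2..4 :: nat} = {2, 3, 4}" by auto
      thus ?case by (simp add: power2_eq_square)
    next
      case (step n)
      have "1 / (real (Suc n))\<^sup>2 \<le> 1 / real n - 1 / real (Suc n)"
        using step by (simp add: divide_simps power2_eq_square)
      thus ?case using step by simp
    qed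
    moreover have "(\<Sum>d\<in>{2..Q}. 1 / (real d)\<^sup>2) \<le> 3 / 4" if "Q < 4"
    proof -
      have "Q = 2 \<or> Q = 3" using True that by auto
      moreover have "{2..2 :: nat} = {2}" "{2..3 :: nat} = {2, 3}" by auto
      ultimately show ?thesis by (auto simp: power2_eq_square)
    qed
    moreover have "1 / real Q \<ge> 0" by simp
    ultimately show ?thesis by linarith
  qed auto
  finally show ?thesis by (simp add: mult_left_mono)
qed

text \<open>An argument of Jensen type: the product of the g p is at least exp of minus the sum of
  the deficits f p, and exp t \<ge> 1 + t is applied around the centre 4 H. Over the squarefree q
  the mean of the deficit sums is at most 4 H, because their total is at most Q H, by counting the
  multiples of each p, and there are at least Q/4 such q. A surplus g p > 1 is discarded.\<close>

lemma squarefree_family_lower: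
  fixes g :: "nat \<Rightarrow> real"
  assumes Q: "Q \<ge> 1" and g: "\<And>p. prime p \<Longrightarrow> p \<le> Q \<Longrightarrow> g p > 0"
  defines "\<Q> \<equiv> prime_factors ` {q\<in>{1..Q}. squarefree q}"
  defines "H \<equiv> (\<Sum>p\<in>primes_in 1 (real Q). max 0 (- ln (g p)) / real p)"
  shows "(\<Sum>U\<in>\<Q>. \<Prod>p\<in>U. g p) \<ge> real Q / 4 * exp (- 4 * H)" "finite \<Q>"
    "\<And>U. U \<in> \<Q> \<Longrightarrow> finite U" "\<And>U. U \<in> \<Q> \<Longrightarrow> \<Prod>U \<le> Q" "\<And>U p. U \<in> \<Q> \<Longrightarrow> p \<in> U \<Longrightarrow> prime p"
proof -
  define Z where "Z = {q\<in>{1..Q}. squarefree q}"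
  define f where "f p = max 0 (- ln (g p))" for p
  have prodpf: "\<Prod>(prime_factors q) = q" if "q \<in> Z" for q
  proof -
    have "q = (\<Prod>p\<in>prime_factors q. p ^ multiplicity p q)" using that by (intro prime_factorization_nat) (auto simp: Z_def)
    also have "\<dots> = \<Prod>(prime_factors q)"
    proof (intro prod.cong refl)
      fix p assume p: "p \<in> prime_factors q"
      have "multiplicity p q = 1" using that p
        by (auto simp: Z_def squarefree_factorial_semiring' prime_factors_multiplicity)
      thus "p ^ multiplicity p q = p" by simp
    qed
    finally show ?thesis ..
  qed
  have finZ: "finite Z" by (simp add: Z_def)
  have inj: "inj_on prime_factors Z" by (rule inj_onI) (metis prodpf)
  show "finite \<Q>" "\<And>U. U \<in> \<Q> \<Longrightarrow> finite U" "\<And>U p. U \<in> \<Q> \<Longrightarrow> p \<in> U \<Longrightarrow> prime p"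
    by (auto simp: \<Q>_def)
  show "\<Prod>U \<le> Q" if "U \<in> \<Q>" for U
    using that prodpf by (auto simp: \<Q>_def Z_def)
  have H: "H \<ge> 0" unfolding H_def by (intro sum_nonneg) auto
  have sumf: "(\<Sum>q\<in>Z. \<Sum>p\<in>prime_factors q. f p) \<le> real Q * H"
  proof -
    have "(\<Sum>q\<in>Z. \<Sum>p\<in>prime_factors q. f p) \<le> (\<Sum>q\<in>{1..Q}. \<Sum>p\<in>prime_factors q. f p)"
      by (intro sum_mono2 sum_nonneg) (auto simp: Z_def f_def)
    also have "\<dots> = (\<Sum>q\<in>{1..Q}. \<Sum>p\<in>primes_in 1 (real Q). if p dvd q then f p else 0)"
    proof (rule sum.cong[OF refl])
      fix q assume q: "q \<in> {1..Q}"
      have "prime_factors q = {p\<in>primes_in 1 (real Q). p dvd q}"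
        using q by (auto simp: primes_in_1 prime_factors_dvd dest: dvd_imp_le)
      thus "(\<Sum>p\<in>prime_factors q. f p) = (\<Sum>p\<in>primes_in 1 (real Q). if p dvd q then f p else 0)"
        by (simp add: sum.inter_filter)
    qed
    also have "\<dots> = (\<Sum>p\<in>primes_in 1 (real Q). \<Sum>q\<in>{1..Q}. if p dvd q then f p else 0)" by (rule sum.swap)
    also have "\<dots> = (\<Sum>p\<in>primes_in 1 (real Q). real (Q div p) * f p)"
    proof (intro sum.cong refl)
      fix p assume "p \<in> primes_in 1 (real Q)"
      hence "p > 0" by (auto simp: primes_in_def)
      thus "(\<Sum>q\<in>{1..Q}. if p dvd q then f p else 0) = real (Q div p) * f p"
        by (subst card_multiples[symmetric]) (simp_all add: sum.If_cases Int_def)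
    qed
    also have "\<dots> \<le> (\<Sum>p\<in>primes_in 1 (real Q). (real Q / real p) * f p)"
      by (intro sum_mono mult_right_mono of_nat_div_le_of_nat) (auto simp: f_def)
    also have "\<dots> = real Q * H" by (simp add: H_def f_def sum_distrib_left)
    finally show ?thesis .
  qed
  have cardZ: "real (card Z) \<ge> real Q / 4" unfolding Z_def by (rule card_squarefree_ge[OF Q])
  have "real Q / 4 * exp (- 4 * H) \<le> real (card Z) * exp (- 4 * H)"
    using cardZ by (intro mult_right_mono) auto
  also have "\<dots> \<le> exp (- 4 * H) * (\<Sum>q\<in>Z. 1 + (4 * H - (\<Sum>p\<in>prime_factors q. f p)))"
  proof -
    have "(real Q / 4) * (4 * H) \<le> real (card Z) * (4 * H)" using cardZ H by (intro mult_right_mono) auto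
    hence "real (card Z) \<le> (\<Sum>q\<in>Z. 1 + (4 * H - (\<Sum>p\<in>prime_factors q. f p)))"
      using sumf by (simp add: sum.distrib sum_subtractf)
    thus ?thesis by (simp add: mult.commute)
  qed
  also have "\<dots> \<le> exp (- 4 * H) * (\<Sum>q\<in>Z. exp (4 * H - (\<Sum>p\<in>prime_factors q. f p)))"
    by (intro mult_left_mono sum_mono exp_ge_add_one_self) auto
  also have "\<dots> = (\<Sum>q\<in>Z. exp (- (\<Sum>p\<in>prime_factors q. f p)))"
    by (simp add: sum_distrib_left flip: exp_add)
  also have "\<dots> \<le> (\<Sum>q\<in>Z. \<Prod>p\<in>prime_factors q. g p)"
  proof (rule sum_mono)
    fix q assume q: "q \<in> Z"
    have "exp (- (\<Sum>p\<in>prime_factors q. f p)) = (\<Prod>p\<in>prime_factors q. exp (- f p))"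
      by (simp add: exp_sum flip: sum_negf)
    also have "\<dots> \<le> (\<Prod>p\<in>prime_factors q. g p)"
    proof (rule prod_mono)
      fix p assume p: "p \<in> prime_factors q"
      have "prime p" "p \<le> Q" using p q by (auto simp: Z_def prime_factors_dvd dest: dvd_imp_le)
      hence "g p > 0" by (rule g)
      moreover have "- f p \<le> ln (g p)" by (simp add: f_def)
      ultimately have "exp (- f p) \<le> g p" using ln_ge_iff by blast
      thus "0 \<le> exp (- f p) \<and> exp (- f p) \<le> g p" by simp
    qed
    finally show "exp (- (\<Sum>p\<in>prime_factors q. f p)) \<le> (\<Prod>p\<in>prime_factors q. g p)" .
  qed
  also have "\<dots> = (\<Sum>U\<in>\<Q>. \<Prod>p\<in>U. g p)"
    unfolding \<Q>_def Z_def[symmetric] by (simp add: sum.reindex[OF inj])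
  finally show "(\<Sum>U\<in>\<Q>. \<Prod>p\<in>U. g p) \<ge> real Q / 4 * exp (- 4 * H)" .
qed

section \<open>Sifting the summands\<close>

lemma sum_primes_in_split:
  fixes f :: "nat \<Rightarrow> 'a :: comm_monoid_add"
  assumes "y \<le> v" "v \<le> z"
  shows "(\<Sum>p\<in>primes_in y z. f p) = (\<Sum>p\<in>primes_in y v. f p) + (\<Sum>p\<in>primes_in v z. f p)"
proof -
  have "primes_in y z = primes_in y v \<union> primes_in v z" "primes_in y v \<inter> primes_in v z = {}"
    unfolding primes_in_def using assms by auto
  thus ?thesis by (simp add: sum.union_disjoint)
qed

text \<open>Any constant above \<open>1/2\<close> would do: it makes \<open>1 + 2 * (11/20) > 2\<close>, so that two elements of \<open>B\<close>
  already save more than one logarithm.\<close>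

lemma sum_inverse_primes_square_scale:
  obtains z0 where "z0 \<ge> 1" "\<And>w. w \<ge> z0 \<Longrightarrow> (\<Sum>p\<in>primes_in w (w\<^sup>2). 1 / real p) \<ge> 11 / 20"
proof -
  obtain C where C: "C > 0"
    "\<And>y z. 1 \<le> y \<Longrightarrow> y \<le> z \<Longrightarrow> \<bar>(\<Sum>p\<in>primes_in y z. ln (real p) / real p) - (ln z - ln y)\<bar> \<le> C"
    using mertens_first by blast
  have "(\<Sum>p\<in>primes_in w (w\<^sup>2). 1 / real p) \<ge> 11 / 20" if w: "w \<ge> exp (40 * C)" for w
  proof -
    define l where "l = ln w"
    have w1: "w > 1" using w C(1) by (smt (verit) one_less_exp_iff mult_pos_pos)
    have l: "l \<ge> 40 * C" "l > 0" using w w1 by (auto simp: l_def ln_ge_iff)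
    \<comment> \<open>On the undivided interval 1/p \<ge> ln p / (p ln (w^2)) yields only about 1/2.
      Divided at w^(3/2) it yields 1/3 + 1/4, and \<open>l \<ge> 40 * C\<close> limits the losses to
      1/60 and 1/80, which leaves 133/240 > 11/20.\<close>
    define v where "v = w powr (3/2)"
    have v: "w \<le> v" "v \<le> w\<^sup>2"
      using w1 powr_mono[of 1 "3/2" w] powr_mono[of "3/2" 2 w] by (simp_all add: v_def)
    have lnv: "ln v = 3/2 * l" "ln (w\<^sup>2) = 2 * l"
      using w1 by (simp_all add: v_def l_def ln_powr ln_realpow)
    have piece: "(\<Sum>p\<in>primes_in y z. 1 / real p) \<ge> (ln z - ln y - C) / ln z" if "1 < y" "y \<le> z" for y z
    proof -
      have "(ln z - ln y - C) / ln z \<le> (\<Sum>p\<in>primes_in y z. ln (real p) / real p) / ln z"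
        using C(2)[of y z] that by (intro divide_right_mono) auto
      also have "\<dots> = (\<Sum>p\<in>primes_in y z. (ln (real p) / ln z) / real p)"
        by (simp add: sum_divide_distrib mult.commute)
      also have "\<dots> \<le> (\<Sum>p\<in>primes_in y z. 1 / real p)"
        using that by (intro sum_mono divide_right_mono) (auto simp: primes_in_def)
      finally show ?thesis .
    qed
    have "(\<Sum>p\<in>primes_in w (w\<^sup>2). 1 / real p)
        = (\<Sum>p\<in>primes_in w v. 1 / real p) + (\<Sum>p\<in>primes_in v (w\<^sup>2). 1 / real p)"
      by (rule sum_primes_in_split[OF v])
    moreover have "(\<Sum>p\<in>primes_in w v. 1 / real p) \<ge> 19 / 60"
    proof (rule order_trans)
      show "19 / 60 \<le> (l / 2 - C) / (3/2 * l)" using l by (simp add: field_simps)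
      show "(l / 2 - C) / (3/2 * l) \<le> (\<Sum>p\<in>primes_in w v. 1 / real p)"
        using piece[of w v] w1 v lnv by (simp add: l_def)
    qed
    moreover have "(\<Sum>p\<in>primes_in v (w\<^sup>2). 1 / real p) \<ge> 19 / 80"
    proof (rule order_trans)
      show "19 / 80 \<le> (l / 2 - C) / (2 * l)" using l by (simp add: field_simps)
      show "(l / 2 - C) / (2 * l) \<le> (\<Sum>p\<in>primes_in v (w\<^sup>2). 1 / real p)"
        using piece[of v "w\<^sup>2"] w1 v lnv by simp
    qed
    ultimately show ?thesis by linarith
  qed
  moreover have "exp (40 * C) \<ge> 1" using C(1) by simp
  ultimately show thesis using that by blast
qed

section \<open>Occupied residue classes and the sieve for a pair of summands\<close>

definition neg_mod :: "nat \<Rightarrow> nat \<Rightarrow> nat" where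
  "neg_mod p r = (p - r mod p) mod p"

lemma neg_mod_less: "p > 0 \<Longrightarrow> neg_mod p r < p"
  by (simp add: neg_mod_def)

lemma inj_on_neg_mod: "inj_on (neg_mod p) {..<p}"
proof (rule inj_onI)
  fix r s assume "r \<in> {..<p}" "s \<in> {..<p}" "neg_mod p r = neg_mod p s"
  thus "r = s" by (cases "r = 0"; cases "s = 0") (auto simp: neg_mod_def)
qed

lemma neg_mod_dvd_add:
  assumes "p > 0" "n mod p = neg_mod p (b mod p)"
  shows "p dvd n + b"
proof -
  have "(n + b) mod p = ((p - b mod p) mod p + b mod p) mod p"
    using assms(2) by (simp add: neg_mod_def mod_add_eq flip: mod_add_eq[of n p b])
  also have "\<dots> = ((p - b mod p) + b mod p) mod p" by (simp add: mod_simps)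
  also have "(p - b mod p) + b mod p = p" using assms(1) by (simp add: less_imp_le)
  finally show ?thesis by (simp add: dvd_eq_mod_eq_0)
qed

text \<open>Only elements beyond both \<open>p\<close> and \<open>x0\<close> are counted: a sum
  containing one of them is prime and exceeds p, so it is never divisible by p. This makes the
  exclusion of classes hold at every prime, without exceptions.\<close>

definition residue_count :: "nat set \<Rightarrow> nat \<Rightarrow> nat \<Rightarrow> nat" where
  "residue_count A x0 p = card ((\<lambda>a. a mod p) ` {a\<in>A. p < a \<and> x0 < a})"

lemma residue_count_pos:
  assumes "infinite A" "p > 0"
  shows "residue_count A x0 p > 0"
proof -
  obtain a where "a \<in> A" "a > max p x0" using assms(1) infinite_nat_iff_unbounded by blast
  hence "(\<lambda>a. a mod p) ` {a\<in>A. p < a \<and> x0 < a} \<noteq> {}" by auto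
  moreover have "finite ((\<lambda>a. a mod p) ` {a\<in>A. p < a \<and> x0 < a})"
    by (rule finite_subset[of _ "{..<p}"]) (use assms(2) in auto)
  ultimately show ?thesis unfolding residue_count_def by (simp add: card_gt_0_iff)
qed

lemma finite_counting [simp]: "finite {n\<in>A. real n \<le> x}"
  by (rule finite_subset[of _ "{..nat \<lfloor>x\<rfloor>}"]) (auto simp: le_nat_floor)

lemma counting_nonneg: "counting A x \<ge> 0"
  by (simp add: counting_def)

text \<open>The quantity \<open>H\<close> of \<open>squarefree_family_lower\<close> for the weights
  \<nu>/(p - \<nu>). A prime contributes nothing once at least half of its classes are occupied; the
  sieve bound for the other summand carries the factor exp of four times this sum.\<close>

definition sieve_loss :: "nat set \<Rightarrow> nat \<Rightarrow> real \<Rightarrow> real" where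
  "sieve_loss A x0 z = (\<Sum>p\<in>primes_in 1 z.
     max 0 (- ln (real (residue_count A x0 p) / (real p - real (residue_count A x0 p)))) / real p)"

lemma sieve_loss_mono:
  assumes "y \<le> z"
  shows "sieve_loss A x0 y \<le> sieve_loss A x0 z"
  unfolding sieve_loss_def using assms
  by (intro sum_mono2[OF finite_primes_in]) (auto simp: primes_in_def)

text \<open>On a block from exp(4^j) to exp(4^(j + 1)) the logarithm of a prime varies by a factor
  of at most 4, so the weights ln p of the larger sieve can be removed block by block. About ln ln z
  blocks reach up to z.\<close>

lemma sum_primes_in_blocks:
  fixes f :: "nat \<Rightarrow> real"
  shows "(\<Sum>p\<in>primes_in 1 (exp (4 ^ J)). f p)
    = (\<Sum>p\<in>primes_in 1 (exp 1). f p) + (\<Sum>j<J. \<Sum>p\<in>primes_in (exp (4 ^ j)) (exp (4 ^ Suc j)). f p)"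
proof (induction J)
  case (Suc J)
  have "(4 :: real) ^ J \<ge> 0" "(4 :: real) ^ J \<le> 4 ^ Suc J" by simp_all
  hence "1 \<le> exp ((4 :: real) ^ J)" "exp ((4 :: real) ^ J) \<le> exp (4 ^ Suc J)" by (simp_all only: exp_le_cancel_iff one_le_exp_iff)
  hence "(\<Sum>p\<in>primes_in 1 (exp (4 ^ Suc J)). f p)
      = (\<Sum>p\<in>primes_in 1 (exp (4 ^ J)). f p) + (\<Sum>p\<in>primes_in (exp (4 ^ J)) (exp (4 ^ Suc J)). f p)"
    by (rule sum_primes_in_split)
  thus ?case using Suc by (simp del: power_Suc)
qed simp

text \<open>The two directions of the asymptotic equality play different roles:
  \<open>prime_sum\<close> feeds the sieve, and \<open>prime_decomp\<close> forces the product of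
  the counting functions to be large. The conditions are symmetric, so a bound for one summand
  passes to the other through \<open>swap\<close>.\<close>

locale prime_sumset =
  fixes A B :: "nat set" and x0 :: nat
  assumes prime_sum: "a \<in> A \<Longrightarrow> b \<in> B \<Longrightarrow> x0 \<le> a + b \<Longrightarrow> prime (a + b)"
    and prime_decomp: "prime p \<Longrightarrow> x0 \<le> p \<Longrightarrow> \<exists>a\<in>A. \<exists>b\<in>B. p = a + b"
begin

lemma swap: "prime_sumset B A x0"
proof
  fix a b assume "a \<in> B" "b \<in> A" "x0 \<le> a + b"
  thus "prime (a + b)" using prime_sum[of b a] by (simp add: add.commute)
next
  fix p assume "prime p" "x0 \<le> p"
  from prime_decomp[OF this] show "\<exists>a\<in>B. \<exists>b\<in>A. p = a + b" by (metis add.commute)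
qed

lemma card_primes_le: "real (card (primes_in 1 x)) \<le> counting A x * counting B x + real x0"
proof -
  define AB where "AB = {n\<in>A. real n \<le> x} \<times> {n\<in>B. real n \<le> x}"
  have "primes_in 1 x \<subseteq> {..<x0} \<union> (\<lambda>(a, b). a + b) ` AB"
  proof
    fix p assume p: "p \<in> primes_in 1 x"
    show "p \<in> {..<x0} \<union> (\<lambda>(a, b). a + b) ` AB"
    proof (cases "p < x0")
      case False
      then obtain a b where "a \<in> A" "b \<in> B" "p = a + b"
        using p prime_decomp[of p] by (auto simp: primes_in_def)
      hence "(a, b) \<in> AB" using p by (auto simp: AB_def primes_in_def)
      thus ?thesis using \<open>p = a + b\<close> by force
    qed auto
  qed
  hence "card (primes_in 1 x) \<le> card ({..<x0} \<union> (\<lambda>(a, b). a + b) ` AB)"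
    by (intro card_mono) (auto simp: AB_def)
  also have "\<dots> \<le> x0 + card ((\<lambda>(a, b). a + b) ` AB)"
    by (rule order_trans[OF card_Un_le]) simp
  also have "card ((\<lambda>(a, b). a + b) ` AB) \<le> card AB" by (rule card_image_le) (simp add: AB_def)
  finally have "card (primes_in 1 x) \<le> x0 + card AB" by simp
  hence "real (card (primes_in 1 x)) \<le> real (x0 + card AB)" by (simp only: of_nat_le_iff)
  thus ?thesis by (simp add: AB_def card_cartesian_product counting_def)
qed

lemma counting_product_lower:
  obtains c where "c > 0" "\<forall>\<^sub>F x in at_top. c * (x / ln x) \<le> counting A x * counting B x"
proof -
  obtain c where c: "c > 0" "\<forall>\<^sub>F x in at_top. c * (x / ln x) \<le> real (card (primes_in 1 x))"
    using prime_counting_lower by blast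
  have "\<forall>\<^sub>F x in at_top. real x0 \<le> c / 2 * (x / ln x)" using c(1) by real_asymp
  with c(2) have "\<forall>\<^sub>F x in at_top. c / 2 * (x / ln x) \<le> counting A x * counting B x"
  proof eventually_elim
    case (elim x)
    thus ?case using card_primes_le[of x] by (simp add: field_simps)
  qed
  thus thesis using that[of "c / 2"] c(1) by simp
qed

text \<open>If p divided the prime a + b, the two would be equal, against p < a. Only
  \<open>a\<close> has to be large, so any b in B excludes a class, in particular one taken from a
  fixed finite subset.\<close>

lemma no_prime_divisor:
  assumes "a \<in> A" "b \<in> B" "prime p" "p < a" "x0 < a"
  shows "a mod p \<noteq> neg_mod p (b mod p)"
proof
  assume "a mod p = neg_mod p (b mod p)"
  hence "p dvd a + b" using assms(3) by (intro neg_mod_dvd_add) (auto intro: prime_gt_0_nat)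
  moreover have "prime (a + b)" using assms by (intro prime_sum) auto
  ultimately have "p = a + b" using assms(3) primes_dvd_imp_eq by blast
  thus False using assms(4) by simp
qed

lemma residue_count_add_le:
  assumes p: "prime p"
  shows "residue_count A x0 p + residue_count B x0 p \<le> p"
proof -
  have p0: "p > 0" using p by (rule prime_gt_0_nat)
  define RA where "RA = (\<lambda>a. a mod p) ` {a\<in>A. p < a \<and> x0 < a}"
  define RB where "RB = (\<lambda>b. b mod p) ` {b\<in>B. p < b \<and> x0 < b}"
  have sub: "RA \<subseteq> {..<p}" "RB \<subseteq> {..<p}" using p0 by (auto simp: RA_def RB_def)
  have sub': "neg_mod p ` RB \<subseteq> {..<p}" using p0 by (auto simp: neg_mod_less)
  have "RA \<inter> neg_mod p ` RB = {}"
    using no_prime_divisor p by (auto simp: RA_def RB_def)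
  hence "card RA + card (neg_mod p ` RB) = card (RA \<union> neg_mod p ` RB)"
    using sub sub' by (intro card_Un_disjoint [symmetric]) (auto intro: finite_subset)
  also have "\<dots> \<le> card {..<p}" using sub sub' by (intro card_mono) auto
  finally have "card RA + card (neg_mod p ` RB) \<le> p" by simp
  moreover have "card (neg_mod p ` RB) = card RB"
    by (rule card_image[OF inj_on_subset[OF inj_on_neg_mod sub(2)]])
  ultimately show ?thesis by (simp add: residue_count_def RA_def RB_def)
qed

text \<open>\<open>D p\<close> selects the elements of B whose negative classes are removed modulo
  p. Elements of A up to Q or \<open>x0\<close> are counted trivially. If some element of A remains,
  its class modulo p is not removed, hence w p < p; if none remains, the bound is trivial. This is
  why the lower bound \<open>L\<close> may be established under the assumption w p < p.\<close>

lemma sieve_bound: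
  fixes D :: "nat \<Rightarrow> nat set" and Q :: nat
  defines "w \<equiv> (\<lambda>p. real (card ((\<lambda>b. b mod p) ` D p)))"
  assumes D: "\<And>p. D p \<subseteq> B" and x: "x \<ge> 1" and Q: "real Q \<le> sqrt x"
    and fin: "finite \<Q>" and \<Q>: "\<And>U. U \<in> \<Q> \<Longrightarrow> finite U" "\<And>U. U \<in> \<Q> \<Longrightarrow> \<Prod>U \<le> Q"
      "\<And>U p. U \<in> \<Q> \<Longrightarrow> p \<in> U \<Longrightarrow> prime p"
    and L: "L > 0" "(\<And>U p. U \<in> \<Q> \<Longrightarrow> p \<in> U \<Longrightarrow> w p < real p) \<Longrightarrow> L \<le> (\<Sum>U\<in>\<Q>. \<Prod>p\<in>U. w p / (real p - w p))"
  shows "counting A x \<le> sqrt x + real x0 + 1 + 8 * x / L"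
proof -
  define N where "N = nat \<lfloor>x\<rfloor>"
  define S where "S = {a\<in>A. Q < a \<and> x0 < a \<and> a \<le> N}"
  have N: "N \<ge> 1" "real N \<le> x" using x by (auto simp: N_def le_nat_floor)
  have finS: "finite S" by (rule finite_subset[of _ "{..N}"]) (auto simp: S_def)
  have QN: "Q\<^sup>2 \<le> N"
  proof -
    have "(real Q)\<^sup>2 \<le> x" using Q x by (metis of_nat_0_le_iff power_mono real_sqrt_pow2 order_trans zero_le_one)
    hence "real (Q\<^sup>2) \<le> x" by simp
    thus ?thesis unfolding N_def by (rule le_nat_floor)
  qed
  have "real (card S) * L \<le> 8 * real N"
  proof (cases "S = {}")
    case False
    then obtain a where a: "a \<in> S" by blast
    define Om where "Om p = neg_mod p ` ((\<lambda>b. b mod p) ` D p)" for p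
    have plt: "p \<le> Q" if "U \<in> \<Q>" "p \<in> U" for U p
    proof -
      have "\<Prod>U > 0" using \<Q>(3)[OF that(1)] by (intro prod_pos) (auto intro: prime_gt_0_nat)
      hence "p \<le> \<Prod>U" using \<Q>(1)[OF that(1)] that(2) by (intro dvd_imp_le dvd_prodI) auto
      thus ?thesis using \<Q>(2)[OF that(1)] by simp
    qed
    have notin: "n mod p \<notin> Om p" if "U \<in> \<Q>" "p \<in> U" "n \<in> S" for U p n
    proof
      assume "n mod p \<in> Om p"
      then obtain b where b: "b \<in> D p" "n mod p = neg_mod p (b mod p)" by (auto simp: Om_def)
      moreover have "p < n" using plt[OF that(1,2)] that(3) by (auto simp: S_def)
      ultimately show False using no_prime_divisor[of n b p] D[of p] \<Q>(3)[OF that(1,2)] that(3)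
        by (auto simp: S_def)
    qed
    have cardOm: "real (card (Om p)) = w p" "Om p \<subseteq> {..<p}" if "prime p" for p
    proof -
      have p0: "p > 0" using that by (rule prime_gt_0_nat)
      have "inj_on (neg_mod p) ((\<lambda>b. b mod p) ` D p)"
        by (rule inj_on_subset[OF inj_on_neg_mod]) (use p0 in auto)
      thus "real (card (Om p)) = w p" by (simp add: Om_def w_def card_image)
      show "Om p \<subseteq> {..<p}" using p0 by (auto simp: Om_def neg_mod_less)
    qed
    have Om: "Om p \<subseteq> {..<p} \<and> card (Om p) < p" if "U \<in> \<Q>" "p \<in> U" for U p
    proof -
      have p: "prime p" using \<Q>(3)[OF that] .
      have "a mod p \<in> {..<p}" using prime_gt_0_nat[OF p] by simp
      hence "Om p \<subset> {..<p}" using cardOm(2)[OF p] notin[OF that a] by blast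
      hence "card (Om p) < card {..<p}" by (intro psubset_card_mono) auto
      thus ?thesis using cardOm(2)[OF p] by simp
    qed
    have "L \<le> (\<Sum>U\<in>\<Q>. \<Prod>p\<in>U. w p / (real p - w p))"
    proof (rule L(2))
      fix U p assume "U \<in> \<Q>" "p \<in> U"
      thus "w p < real p" using Om[of U p] \<Q>(3)[of U p] cardOm(1)[of p] by (metis of_nat_less_iff)
    qed
    also have "\<dots> = (\<Sum>U\<in>\<Q>. \<Prod>p\<in>U. real (card (Om p)) / (real p - real (card (Om p))))"
      using \<Q>(3) cardOm(1) by (intro sum.cong prod.cong refl) auto
    finally have "real (card S) * L \<le> real (card S) * \<dots>" by (rule mult_left_mono) simp
    also have "\<dots> \<le> 8 * real N"
    proof (rule large_sieve[OF QN _ fin \<Q> Om _ notin])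
      show "S \<subseteq> {..N}" by (auto simp: S_def)
    qed (use N in auto)
    finally show ?thesis .
  qed simp
  hence "real (card S) \<le> 8 * real N / L" using L(1) by (simp add: field_simps)
  also have "\<dots> \<le> 8 * x / L" using N L(1) by (intro divide_right_mono) auto
  finally have cS: "real (card S) \<le> 8 * x / L" .
  have "{n\<in>A. real n \<le> x} \<subseteq> S \<union> {..Q + x0}"
    by (auto simp: S_def N_def le_nat_floor)
  hence "card {n\<in>A. real n \<le> x} \<le> card (S \<union> {..Q + x0})" using finS by (intro card_mono) auto
  also have "\<dots> \<le> card S + (Q + x0 + 1)" by (rule order_trans[OF card_Un_le]) simp
  finally have "counting A x \<le> real (card S + (Q + x0 + 1))" unfolding counting_def by (simp only: of_nat_le_iff)
  thus ?thesis using cS Q by simp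
qed

text \<open>All squarefree moduli up to sqrt x are used. The 64 is the large sieve constant 8, times
  4 for the proportion of squarefree numbers, times 2 for Q \<ge> sqrt x / 2. Since both sets are
  infinite, 0 < \<nu> p < p at every prime, and all weights are positive.\<close>

lemma sieve_bound_residue_count:
  assumes x: "x \<ge> 4" and inf: "infinite A" "infinite B"
  shows "counting A x \<le> sqrt x + real x0 + 1 + 64 * sqrt x * exp (4 * sieve_loss B x0 (sqrt x))"
proof -
  define Q where "Q = nat \<lfloor>sqrt x\<rfloor>"
  define \<nu> where "\<nu> p = real (residue_count B x0 p)" for p
  define g where "g p = \<nu> p / (real p - \<nu> p)" for p
  define H where "H = sieve_loss B x0 (sqrt x)"
  have sx: "sqrt x \<ge> 2" using x real_le_rsqrt[of 2 x] by simp
  have Q: "real Q \<le> sqrt x" "real Q \<ge> sqrt x / 2" "Q \<ge> 1"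
  proof -
    show "real Q \<le> sqrt x" using x unfolding Q_def by (intro of_nat_floor) auto
    have "real Q > sqrt x - 1" using sx unfolding Q_def by linarith
    thus "real Q \<ge> sqrt x / 2" using sx by linarith
    thus "Q \<ge> 1" using sx by linarith
  qed
  have \<nu>: "0 < \<nu> p" "\<nu> p < real p" if "prime p" for p
  proof -
    have "residue_count B x0 p > 0" "residue_count A x0 p > 0"
      using inf that by (auto intro: residue_count_pos prime_gt_0_nat)
    thus "0 < \<nu> p" "\<nu> p < real p" using residue_count_add_le[OF that] by (auto simp: \<nu>_def)
  qed
  have g: "g p > 0" if "prime p" "p \<le> Q" for p using \<nu>[OF that(1)] by (simp add: g_def)
  have H: "H = (\<Sum>p\<in>primes_in 1 (real Q). max 0 (- ln (g p)) / real p)"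
    unfolding H_def sieve_loss_def g_def \<nu>_def Q_def using sx x by (subst primes_in_floor) auto
  note fam = squarefree_family_lower[where g = g, OF Q(3) g, folded H]
  have "counting A x \<le> sqrt x + real x0 + 1 + 8 * x / (real Q / 4 * exp (- 4 * H))"
  proof (rule sieve_bound[where D = "\<lambda>p. {b\<in>B. p < b \<and> x0 < b}" and Q = Q
        and \<Q> = "prime_factors ` {q\<in>{1..Q}. squarefree q}"])
    show "real Q / 4 * exp (- 4 * H) \<le> (\<Sum>U\<in>prime_factors ` {q\<in>{1..Q}. squarefree q}.
        \<Prod>p\<in>U. real (card ((\<lambda>b. b mod p) ` {b\<in>B. p < b \<and> x0 < b})) /
          (real p - real (card ((\<lambda>b. b mod p) ` {b\<in>B. p < b \<and> x0 < b}))))"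
      by (rule fam(1)[unfolded g_def \<nu>_def residue_count_def])
    show "0 < real Q / 4 * exp (- 4 * H)" using Q(3) by simp
    show "real Q \<le> sqrt x" by (rule Q(1))
    show "1 \<le> x" using x by simp
    show "finite (prime_factors ` {q\<in>{1..Q}. squarefree q})" by (rule fam(2))
    fix U assume U: "U \<in> prime_factors ` {q\<in>{1..Q}. squarefree q}"
    show "finite U" by (rule fam(3)[OF _ _ U])
    show "\<Prod>U \<le> Q" by (rule fam(4)[OF _ _ U])
    show "prime p" if "p \<in> U" for p by (rule fam(5)[OF _ _ U that])
  qed simp
  also have "8 * x / (real Q / 4 * exp (- 4 * H)) = 32 * x * exp (4 * H) / real Q"
    by (simp add: exp_minus field_simps)
  also have "\<dots> \<le> 32 * x * exp (4 * H) / (sqrt x / 2)"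
    using Q x by (intro divide_left_mono) auto
  also have "\<dots> = 64 * sqrt x * exp (4 * H)"
    using x real_div_sqrt[of x] by (simp add: field_simps)
  finally show ?thesis by (simp add: H_def)
qed

text \<open>After removal of the elements up to y and \<open>x0\<close>, at least y elements of A up
  to x remain, so theta(y) \<le> 2y contributes at most 2 and the main term is ln x.\<close>

lemma larger_sieve_bound:
  assumes y: "y \<ge> 1" and x: "x \<ge> 1" and large: "counting A x \<ge> 2 * y + real x0 + 2" and P: "P \<subseteq> primes_in 1 y"
  shows "(\<Sum>p\<in>P. ln (real p) / real (residue_count A x0 p)) \<le> 2 + ln x"
proof -
  define N where "N = nat \<lfloor>x\<rfloor>"
  define Y where "Y = nat \<lfloor>y\<rfloor>"
  have N: "N \<ge> 1" "real N \<le> x" using x by (auto simp: N_def le_nat_floor)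
  have Y: "real Y \<le> y" using y by (simp add: Y_def)
  define S where "S = {a\<in>A. Y < a \<and> x0 < a \<and> a \<le> N}"
  have finS: "finite S" by (rule finite_subset[of _ "{..N}"]) (auto simp: S_def)
  have "{n\<in>A. real n \<le> x} \<subseteq> S \<union> {..Y + x0}"
    by (auto simp: S_def N_def le_nat_floor)
  hence "card {n\<in>A. real n \<le> x} \<le> card (S \<union> {..Y + x0})" using finS by (intro card_mono) auto
  also have "\<dots> \<le> card S + (Y + x0 + 1)" by (rule order_trans[OF card_Un_le]) simp
  finally have "counting A x \<le> real (card S + (Y + x0 + 1))" unfolding counting_def by (simp only: of_nat_le_iff)
  hence cS: "real (card S) \<ge> y" using large Y by simp
  have ne: "S \<noteq> {}" using cS y by auto
  have finP: "finite P" using P finite_subset by blast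
  have "(\<Sum>p\<in>P. ln (real p) / real (residue_count A x0 p)) \<le> (\<Sum>p\<in>P. ln (real p)) / real (card S) + ln (real N)"
  proof (rule larger_sieve)
    fix p assume p: "p \<in> P"
    hence "prime p" "real p \<le> y" using P by (auto simp: primes_in_def)
    hence pY: "p \<le> Y" "p > 0" unfolding Y_def by (auto intro: le_nat_floor prime_gt_0_nat)
    show "real (card ((\<lambda>n. n mod p) ` S)) \<le> real (residue_count A x0 p)"
      unfolding residue_count_def of_nat_le_iff
    proof (rule card_mono)
      show "finite ((\<lambda>a. a mod p) ` {a \<in> A. p < a \<and> x0 < a})"
        by (rule finite_subset[of _ "{..<p}"]) (use pY(2) in auto)
    qed (use pY in \<open>auto simp: S_def\<close>)
  qed (use P finP N ne in \<open>auto simp: S_def primes_in_def\<close>)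
  also have "(\<Sum>p\<in>P. ln (real p)) \<le> (\<Sum>p\<in>primes_in 1 y. ln (real p))"
    using P by (intro sum_mono2[OF finite_primes_in]) (auto simp: primes_in_def)
  also have "\<dots> \<le> 2 * y" using y by (intro theta_le) auto
  also have "2 * y / real (card S) \<le> 2" using cS y by (simp add: field_simps)
  also have "ln (real N) \<le> ln x" using N by simp
  finally show ?thesis by (simp add: divide_right_mono)
qed

end

section \<open>From logarithmic to power growth\<close>

lemma infinite_if_counting_ge_log_powr:
  assumes "c > 0" "e > 0" "\<forall>\<^sub>F x in at_top. c * ln x powr e \<le> counting B x"
  shows "infinite B"
proof
  assume fin: "finite B"
  have "\<forall>\<^sub>F x in at_top. c * ln x powr e > real (card B)" using assms(1,2) by real_asymp
  with assms(3) have "\<forall>\<^sub>F x in at_top. counting B x > real (card B)" by eventually_elim simp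
  then obtain x where "counting B x > real (card B)"
    using eventually_happens'[OF trivial_limit_at_top_linorder] by blast
  moreover have "counting B x \<le> real (card B)"
    unfolding counting_def of_nat_le_iff using fin by (intro card_mono) auto
  ultimately show False by simp
qed

context prime_sumset
begin

text \<open>Primes beyond max D see the k = |D| elements as k distinct classes, so their weight is
  at least k/p, and each interval (w, w^2] contributes at least 11 k / 20. With 2^J of order ln x,
  the sieve sum is at least (2^e)^J, of order (ln x)^e.\<close>

lemma counting_upper_finite_subset:
  assumes D: "finite D" "D \<subseteq> B" and e: "e > 0" "2 powr e \<le> 1 + 11 / 20 * real (card D)"
  obtains C where "C > 0" "\<forall>\<^sub>F x in at_top. counting A x \<le> C * (x / ln x powr e)"
proof -
  define k where "k = real (card D)"
  obtain z0 where z0: "z0 \<ge> 1" "\<And>w. w \<ge> z0 \<Longrightarrow> (\<Sum>p\<in>primes_in w (w\<^sup>2). 1 / real p) \<ge> 11 / 20"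
    using sum_inverse_primes_square_scale by blast
  define z where "z = Max ({z0, 2} \<union> real ` D)"
  have z: "z \<ge> z0" "z \<ge> 2" "\<And>d. d \<in> D \<Longrightarrow> real d \<le> z"
  proof -
    have "finite ({z0, 2} \<union> real ` D)" using D(1) by simp
    note ge = Max_ge[OF this, folded z_def]
    show "z \<ge> z0" "z \<ge> 2" "\<And>d. d \<in> D \<Longrightarrow> real d \<le> z" by (rule ge; simp)+
  qed
  define h where "h p = k / real p" for p
  have scale: "(\<Sum>p\<in>primes_in w (w\<^sup>2). h p) \<ge> 11 / 20 * k" if "w \<ge> z" for w
  proof -
    have "k * (11 / 20) \<le> k * (\<Sum>p\<in>primes_in w (w\<^sup>2). 1 / real p)"
      using z0(2)[of w] that z(1) by (intro mult_left_mono) (auto simp: k_def)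
    thus ?thesis by (simp add: h_def sum_distrib_left)
  qed
  \<comment> \<open>The 16 collects three losses: ln Q \<ge> ln x / 4, the division by 2 ln z in
    \<open>r\<close>, and 2^J > r / 2.\<close>
  define c where "c = (1 / (16 * ln z)) powr e"
  have c: "c > 0" using z by (simp add: c_def)
  have "\<forall>\<^sub>F x in at_top. counting A x \<le> sqrt x + real x0 + 1 + 8 * x / (c * ln x powr e)"
    using eventually_ge_at_top[of 16] eventually_ge_at_top[of "exp (16 * ln z)"]
  proof eventually_elim
    case (elim x)
    define Q where "Q = nat \<lfloor>sqrt x\<rfloor>"
    have x: "x \<ge> 16" "ln x \<ge> 16 * ln z" using elim by (auto simp: ln_ge_iff)
    have sx: "sqrt x \<ge> 4" using x real_le_rsqrt[of 4 x] by simp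
    have Q: "real Q \<le> sqrt x" unfolding Q_def using x by (intro of_nat_floor) auto
    have "real Q > sqrt x - 1" using sx unfolding Q_def by linarith
    moreover have "sqrt x - 1 \<ge> sqrt (sqrt x)"
    proof -
      define v where "v = sqrt (sqrt x)"
      have v: "v \<ge> 2" "v\<^sup>2 = sqrt x" using x sx real_le_rsqrt[of 2 "sqrt x"] by (auto simp: v_def)
      have "v * v \<ge> 2 * v" using v by (intro mult_right_mono) auto
      hence "v \<le> v\<^sup>2 - 1" using v(1) unfolding power2_eq_square by linarith
      thus ?thesis by (simp only: v(2) v_def[symmetric])
    qed
    ultimately have Qs: "real Q > sqrt (sqrt x)" "real Q > 1" using sx by linarith+
    have "sqrt (sqrt x) > 0" using x by simp
    hence "ln (sqrt (sqrt x)) \<le> ln (real Q)" using Qs by (intro ln_mono) linarith+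
    moreover have "ln (sqrt (sqrt x)) = ln x / 4" using x by (simp add: ln_sqrt)
    ultimately have lnQ: "ln (real Q) \<ge> ln x / 4" "real Q > 1" using Qs by linarith+
    \<comment> \<open>Chosen so that 2^J \<le> r is equivalent to z^(2^(J + 1)) \<le> Q, the size
      limit for the moduli.\<close>
    define r where "r = ln (real Q) / (2 * ln z)"
    have lnz: "ln z > 0" using z by simp
    have r: "r / 2 \<ge> ln x / (16 * ln z)"  using lnQ lnz by (simp add: r_def field_simps)
    moreover have "ln x / (16 * ln z) \<ge> 1" using x(2) lnz by (simp add: field_simps)
    ultimately have r1: "r \<ge> 1" by linarith
    define J where "J = nat \<lfloor>log 2 r\<rfloor>"
    have J: "2 ^ J \<le> r" "r < 2 ^ (J + 1)"
    proof -
      have l0: "log 2 r \<ge> 0" using r1 by simp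
      have "real J \<le> log 2 r" unfolding J_def using l0 by (intro of_nat_floor)
      hence "2 powr real J \<le> r" using r1 by (simp add: le_log_iff)
      thus "2 ^ J \<le> r" by (simp add: powr_realpow)
      have "log 2 r < real (J + 1)" unfolding J_def using l0 by linarith
      hence "r < 2 powr real (J + 1)" using r1 by (subst (asm) log_less_iff) auto
      thus "r < 2 ^ (J + 1)" by (subst (asm) powr_realpow) auto
    qed
    obtain \<Q> where \<Q>: "finite \<Q>" "\<And>U. U \<in> \<Q> \<Longrightarrow> U \<subseteq> primes_in z (z ^ (2 ^ J))"
      "\<And>U. U \<in> \<Q> \<Longrightarrow> real (\<Prod>U) \<le> z ^ (2 ^ (J + 1))"
      "(\<Sum>U\<in>\<Q>. \<Prod>p\<in>U. h p) \<ge> (1 + 11 / 20 * k) ^ J"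
      using sieve_family_scales[of z "11 / 20 * k" h J] scale z by (auto simp: h_def k_def)
    have zQ: "z ^ (2 ^ (J + 1)) \<le> real Q"
    proof -
      have "z ^ (2 ^ (J + 1)) = exp (ln z) ^ (2 ^ (J + 1))" using z by simp
      also have "\<dots> = exp (2 ^ J * (2 * ln z))" by (simp flip: exp_of_nat_mult)
      also have "\<dots> \<le> exp (r * (2 * ln z))" using J lnz by simp
      also have "\<dots> = real Q" using lnQ(2) lnz by (simp add: r_def)
      finally show ?thesis .
    qed
    have pz: "prime p" "real p > z" if "U \<in> \<Q>" "p \<in> U" for U p
      using \<Q>(2)[OF that(1)] that(2) by (auto simp: primes_in_def)
    have w: "real (card ((\<lambda>b. b mod p) ` D)) = k" if "U \<in> \<Q>" "p \<in> U" for U p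
    proof -
      have "b mod p = b" if "b \<in> D" for b
        using z(3)[OF that] pz[OF \<open>U \<in> \<Q>\<close> \<open>p \<in> U\<close>] by simp
      hence "(\<lambda>b. b mod p) ` D = D" by simp
      thus ?thesis by (simp add: k_def)
    qed
    have "c * ln x powr e = (ln x / (16 * ln z)) powr e"
      using x lnz by (simp add: c_def flip: powr_mult)
    also have "\<dots> \<le> (r / 2) powr e"
      using r x lnz e by (intro powr_mono2) auto
    also have "\<dots> \<le> (2 ^ J) powr e" using J r1 e by (intro powr_mono2) auto
    also have "\<dots> = (2 powr e) ^ J"
      by (simp add: powr_powr mult.commute flip: powr_realpow)
    also have "\<dots> \<le> (1 + 11 / 20 * k) ^ J" using e by (intro power_mono) (auto simp: k_def)
    also have "\<dots> \<le> (\<Sum>U\<in>\<Q>. \<Prod>p\<in>U. h p)" by (rule \<Q>(4))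
    finally have low: "c * ln x powr e \<le> (\<Sum>U\<in>\<Q>. \<Prod>p\<in>U. h p)" .
    have pos: "c * ln x powr e > 0" using c x by simp
    show ?case
    proof (rule sieve_bound[where D = "\<lambda>_. D" and Q = Q and \<Q> = \<Q>])
      show "x \<ge> 1" using x by simp
      show "finite \<Q>" by (rule \<Q>(1))
      show "real Q \<le> sqrt x" by (rule Q)
      show "c * ln x powr e > 0" by (rule pos)
      show "D \<subseteq> B" by (rule D(2))
      fix U assume U: "U \<in> \<Q>"
      show "finite U" by (rule finite_subset[OF \<Q>(2)[OF U] finite_primes_in])
      have "real (\<Prod>U) \<le> real Q" using \<Q>(3)[OF U] zQ by linarith
      thus "\<Prod>U \<le> Q" by (simp only: of_nat_le_iff)
      show "prime p" if "p \<in> U" for p using pz(1)[OF U that] .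
    next
      assume lt: "\<And>U p. U \<in> \<Q> \<Longrightarrow> p \<in> U \<Longrightarrow> real (card ((\<lambda>b. b mod p) ` D)) < real p"
      have "(\<Sum>U\<in>\<Q>. \<Prod>p\<in>U. h p) \<le> (\<Sum>U\<in>\<Q>. \<Prod>p\<in>U. k / (real p - k))"
      proof (intro sum_mono prod_mono conjI)
        fix U p assume Up: "U \<in> \<Q>" "p \<in> U"
        have "k < real p" using lt[OF Up] w[OF Up] by simp
        thus "0 \<le> h p" "h p \<le> k / (real p - k)"
          unfolding h_def by (auto simp: k_def intro!: divide_left_mono)
      qed
      also have "\<dots> = (\<Sum>U\<in>\<Q>. \<Prod>p\<in>U. real (card ((\<lambda>b. b mod p) ` D)) / (real p - real (card ((\<lambda>b. b mod p) ` D))))"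
        using w by (intro sum.cong prod.cong refl) auto
      finally show "c * ln x powr e \<le> (\<Sum>U\<in>\<Q>. \<Prod>p\<in>U. real (card ((\<lambda>b. b mod p) ` D)) / (real p - real (card ((\<lambda>b. b mod p) ` D))))"
        using low by linarith
    qed
  qed
  moreover have "\<forall>\<^sub>F x in at_top. sqrt x + real x0 + 1 \<le> x / ln x powr e"
    using e(1) by real_asymp
  ultimately have "\<forall>\<^sub>F x in at_top. counting A x \<le> (1 + 8 / c) * (x / ln x powr e)"
  proof eventually_elim
    case (elim x)
    have "(1 + 8 / c) * (x / ln x powr e) = x / ln x powr e + 8 * x / (c * ln x powr e)"
      unfolding distrib_right by simp
    thus ?case using elim by linarith
  qed
  thus thesis using that[of "1 + 8 / c"] c by (simp add: add_pos_pos)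
qed

text \<open>The prime count x / ln x is divided by the upper bound for A; its denominator costs one
  logarithm, so the conclusion expresses growth exactly when e > 1.\<close>

lemma counting_lower_finite_subset:
  assumes "finite D" "D \<subseteq> B" "e > 0" "2 powr e \<le> 1 + 11 / 20 * real (card D)"
  obtains c where "c > 0" "\<forall>\<^sub>F x in at_top. c * ln x powr (e - 1) \<le> counting B x"
proof -
  obtain C where C: "C > 0" "\<forall>\<^sub>F x in at_top. counting A x \<le> C * (x / ln x powr e)"
    using counting_upper_finite_subset[OF assms] by blast
  obtain c where c: "c > 0" "\<forall>\<^sub>F x in at_top. c * (x / ln x) \<le> counting A x * counting B x"
    using counting_product_lower by blast
  have "\<forall>\<^sub>F x in at_top. c / C * ln x powr (e - 1) \<le> counting B x"
    using C(2) c(2) eventually_gt_at_top[of 1]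
  proof eventually_elim
    case (elim x)
    have lx: "ln x > 0" using elim by simp
    have "c * (x / ln x) \<le> C * (x / ln x powr e) * counting B x"
      using elim counting_nonneg[of B x] by (meson mult_right_mono order_trans)
    hence "c * (x / ln x) * (ln x powr e / (C * x)) \<le> C * (x / ln x powr e) * counting B x * (ln x powr e / (C * x))"
      using elim C(1) by (intro mult_right_mono) auto
    also have "\<dots> = counting B x" using elim C(1) lx by simp
    also have "c * (x / ln x) * (ln x powr e / (C * x)) = c / C * (ln x powr e / ln x)"
      using elim by simp
    also have "ln x powr e / ln x = ln x powr (e - 1)" using lx by (simp add: powr_diff)
    finally show ?case .
  qed
  thus thesis using that[of "c / C"] C(1) c(1) by simp
qed

text \<open>Two elements give 1 + 2 * 11/20 = 21/10, and e = 21/20 is admissible because 2^21 \<le>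
  (21/10)^20. So B(x) is at least of order (ln x)^(1/20), which is impossible for a finite
  set.\<close>

lemma infinite_summand:
  assumes "\<exists>b\<in>B. \<exists>b'\<in>B. b \<noteq> b'"
  shows "infinite B"
proof -
  obtain b b' where b: "b \<in> B" "b' \<in> B" "b \<noteq> b'" using assms by blast
  have "(2 :: real) powr (21/20) \<le> 21 / 10"
  proof -
    have "((2 :: real) powr (21/20)) ^ 20 = 2 powr 21" by (simp add: powr_power)
    also have "\<dots> = 2 ^ 21" by (subst powr_realpow [symmetric]) auto
    also have "\<dots> \<le> (21 / 10) ^ 20" by (simp add: field_simps)
    finally show ?thesis by (rule power_le_imp_le_base[of _ 19, unfolded Suc_numeral, simplified]) simp
  qed
  then obtain c where c: "c > 0" "\<forall>\<^sub>F x in at_top. c * ln x powr (21/20 - 1) \<le> counting B x"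
    using counting_lower_finite_subset[of "{b, b'}" "21/20"] b by auto
  thus ?thesis by (intro infinite_if_counting_ge_log_powr[of c "21/20 - 1"]) auto
qed

lemma counting_ge_log_power:
  assumes "\<exists>b\<in>B. \<exists>b'\<in>B. b \<noteq> b'"
  obtains c where "c > 0" "\<forall>\<^sub>F x in at_top. c * ln x powr 4 \<le> counting B x"
proof -
  \<comment> \<open>The least size with 1 + 11/20 * 57 \<ge> 2^5; then e = 5 leaves the exponent
    4.\<close>
  obtain D where D: "D \<subseteq> B" "finite D" "card D = 57"
    using infinite_arbitrarily_large[OF infinite_summand[OF assms], of 57] by blast
  have "2 powr 5 \<le> (1 + 11 / 20 * real (card D) :: real)" by (simp add: D powr_numeral)
  from counting_lower_finite_subset[OF D(2,1) _ this] show thesis using that by auto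
qed

text \<open>With l = ln x, the larger sieve with primes up to y = l^3 and Cauchy-Schwarz give T
  \<ge> \<epsilon>^2 l^2 / (6 ln l) for the sum of \<nu> p / p. The moduli are products of m primes,
  with m about ln Q / ln y \<le> l / (6 ln l), and their sieve sum is at least (T - m)^m / m! \<ge>
  (T/m - 1)^m. Since T/m - 1 \<ge> sqrt l, this is a power of x.\<close>

lemma counting_power_saving:
  assumes cnt: "c > 0" "\<forall>\<^sub>F x in at_top. c * ln x powr 4 \<le> counting B x"
  shows "\<forall>\<^sub>F x in at_top. counting A x \<le> x powr (14/15)"
proof -
  obtain \<epsilon> where \<epsilon>: "0 < \<epsilon>" "\<epsilon> < 1" "\<And>x. \<epsilon> * x \<ge> 1 \<Longrightarrow> (\<Sum>p\<in>primes_in (\<epsilon> * x) x. ln (real p)) \<ge> \<epsilon> * x"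
    using theta_lower by blast
  have "\<forall>\<^sub>F x in at_top. c * ln x powr 4 \<ge> 2 * ln x ^ 3 + real x0 + 2" using cnt(1) by real_asymp
  moreover have "\<forall>\<^sub>F x in at_top. \<epsilon> * ln x ^ 3 \<ge> 1" using \<epsilon>(1) by real_asymp
  moreover have "\<forall>\<^sub>F x in at_top. ln (x :: real) \<ge> 8" by real_asymp
  moreover have "\<forall>\<^sub>F x in at_top. \<epsilon>\<^sup>2 * ln x - 1 \<ge> ln x powr (1/2)" using \<epsilon>(1) by real_asymp
  moreover have "\<forall>\<^sub>F x in at_top. (ln (x :: real) / 2 - 1) / (3 * ln (ln x)) - 1 \<ge> ln x / (7 * ln (ln x))" by real_asymp
  moreover have "\<forall>\<^sub>F x in at_top. sqrt x + real x0 + 1 + 8 * x / x powr (1/14) \<le> x powr (14/15)" by real_asymp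
  ultimately show ?thesis using cnt(2) eventually_gt_at_top[of 1]
  proof eventually_elim
    case (elim x)
    define l where "l = ln x"
    \<comment> \<open>The exponent 3 is below 4, so that B has enough elements up to x for the
      larger sieve at level y, and above 2, since the lower bound for T/m is of order y / l^2 and
      has to grow.\<close>
    define y where "y = l ^ 3"
    define Q where "Q = nat \<lfloor>sqrt x\<rfloor>"
    define P where "P = primes_in (\<epsilon> * y) y"
    define \<nu> where "\<nu> p = real (residue_count B x0 p)" for p
    define h where "h p = \<nu> p / real p" for p
    define T where "T = (\<Sum>p\<in>P. h p)"
    have l: "l \<ge> 8" using elim by (simp add: l_def)
    have x: "x > 1" using elim by simp
    have xe: "x = exp l" using x by (simp add: l_def)
    have lnl: "ln l > 0" using l by simp
    have y: "\<epsilon> * y \<ge> 1" using elim by (simp add: y_def l_def)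
    have y1: "y \<ge> 1" unfolding y_def using l by (simp add: one_le_power)
    have lny: "ln y = 3 * ln l" using l by (simp add: y_def ln_realpow)
    have Psub: "P \<subseteq> primes_in 1 y" using y by (auto simp: P_def primes_in_def)
    have finP: "finite P" by (simp add: P_def)
    have P: "prime p" "real p \<le> y" "real p > 0" if "p \<in> P" for p
      using that by (auto simp: P_def primes_in_def prime_gt_0_nat)
    have \<nu>: "0 \<le> h p" "h p \<le> 1" if "p \<in> P" for p
      using residue_count_add_le[OF P(1)[OF that]] P(3)[OF that] by (auto simp: h_def \<nu>_def)
    have th: "(\<Sum>p\<in>P. ln (real p)) \<ge> \<epsilon> * y" unfolding P_def by (rule \<epsilon>(3)[OF y])
    have gal: "(\<Sum>p\<in>P. ln (real p) / \<nu> p) \<le> 2 * l"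
    proof -
      have "(\<Sum>p\<in>P. ln (real p) / \<nu> p) \<le> 2 + ln x"
        unfolding \<nu>_def
      proof (rule prime_sumset.larger_sieve_bound[OF swap y1 _ _ Psub])
        show "2 * y + real x0 + 2 \<le> counting B x" using elim by (simp add: y_def l_def)
      qed (use x in simp)
      thus ?thesis using l by (simp add: l_def)
    qed
    have lnp: "ln (real p) \<ge> 0" "ln (real p) \<le> ln y" if "p \<in> P" for p
      using P[OF that] prime_ge_1_nat[OF P(1)[OF that]] by auto
    have Tge: "T \<ge> \<epsilon>\<^sup>2 * l\<^sup>2 / (6 * ln l)"
    proof (cases "\<forall>p\<in>P. \<nu> p > 0")
      case True
      \<comment> \<open>Factoring ln p as sqrt(\<nu> p ln p) * sqrt(ln p / \<nu> p) and applying
        Cauchy-Schwarz converts the upper bound for the sum of ln p / \<nu> p into a lower bound for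
        the sum of \<nu> p ln p.\<close>
      have "(\<epsilon> * y)\<^sup>2 \<le> (\<Sum>p\<in>P. ln (real p))\<^sup>2" using th y by (intro power_mono) auto
      also have "(\<Sum>p\<in>P. ln (real p)) = (\<Sum>p\<in>P. sqrt (\<nu> p * ln (real p)) * sqrt (ln (real p) / \<nu> p))"
      proof (intro sum.cong refl)
        fix p assume p: "p \<in> P"
        have "sqrt (\<nu> p * ln (real p)) * sqrt (ln (real p) / \<nu> p) = sqrt ((ln (real p))\<^sup>2)"
          unfolding real_sqrt_mult[symmetric] using True p by (auto simp: power2_eq_square)
        thus "ln (real p) = sqrt (\<nu> p * ln (real p)) * sqrt (ln (real p) / \<nu> p)" using lnp[OF p] by simp
      qed
      also have "(\<dots>)\<^sup>2 \<le> (\<Sum>p\<in>P. (sqrt (\<nu> p * ln (real p)))\<^sup>2) * (\<Sum>p\<in>P. (sqrt (ln (real p) / \<nu> p))\<^sup>2)"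
        by (rule Cauchy_Schwarz_ineq_sum)
      also have "\<dots> = (\<Sum>p\<in>P. \<nu> p * ln (real p)) * (\<Sum>p\<in>P. ln (real p) / \<nu> p)"
        using lnp by (intro arg_cong2[of _ _ _ _ "(*)"] sum.cong refl) (auto simp: \<nu>_def)
      also have "\<dots> \<le> (T * (y * ln y)) * (2 * l)"
      proof (intro mult_mono gal)
        have "(\<Sum>p\<in>P. \<nu> p * ln (real p)) \<le> (\<Sum>p\<in>P. h p * (y * ln y))"
        proof (rule sum_mono)
          fix p assume p: "p \<in> P"
          have "\<nu> p * ln (real p) = h p * (real p * ln (real p))" using P(3)[OF p] by (simp add: h_def)
          also have "\<dots> \<le> h p * (y * ln y)"
            using P[OF p] lnp[OF p] \<nu>[OF p] y1 by (intro mult_left_mono mult_mono) auto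
          finally show "\<nu> p * ln (real p) \<le> h p * (y * ln y)" .
        qed
        thus "(\<Sum>p\<in>P. \<nu> p * ln (real p)) \<le> T * (y * ln y)" by (simp add: T_def sum_distrib_right)
        show "0 \<le> T * (y * ln y)" using \<nu> y1 by (auto simp: T_def intro!: mult_nonneg_nonneg sum_nonneg)
        show "0 \<le> (\<Sum>p\<in>P. ln (real p) / \<nu> p)" using lnp by (auto intro!: sum_nonneg simp: \<nu>_def)
      qed
      finally have "y * (\<epsilon>\<^sup>2 * y) \<le> y * (T * (6 * ln l * l))"
        by (simp add: lny power2_eq_square mult_ac)
      hence "\<epsilon>\<^sup>2 * y \<le> T * (6 * ln l * l)" using y1 by simp
      hence "l * (\<epsilon>\<^sup>2 * l\<^sup>2) \<le> l * (T * (6 * ln l))"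
        by (simp add: y_def power2_eq_square power3_eq_cube mult_ac)
      hence "\<epsilon>\<^sup>2 * l\<^sup>2 \<le> T * (6 * ln l)" using l by simp
      thus ?thesis using lnl by (simp add: field_simps)
    next
      case False
      have "infinite B" using cnt by (intro infinite_if_counting_ge_log_powr[of c 4]) auto
      hence "\<nu> p > 0" if "p \<in> P" for p
        using residue_count_pos[of B p x0] P(3)[OF that] by (simp add: \<nu>_def)
      with False show ?thesis by blast
    qed
    define m where "m = nat \<lfloor>ln (real Q) / ln y\<rfloor>"
    have sx: "sqrt x \<ge> 2"
    proof -
      have "x \<ge> 4" using l exp_ge_add_one_self[of l] unfolding xe by linarith
      thus ?thesis using real_le_rsqrt[of 2 x] by simp
    qed
    have Q: "real Q \<le> sqrt x" "real Q \<ge> sqrt x / 2" "real Q \<ge> 1"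
    proof -
      show "real Q \<le> sqrt x" unfolding Q_def using x by (intro of_nat_floor) auto
      have "real Q > sqrt x - 1" using sx unfolding Q_def by linarith
      thus "real Q \<ge> sqrt x / 2" using sx by linarith
      thus "real Q \<ge> 1" using sx by linarith
    qed
    have lnQ: "ln (real Q) \<ge> l / 2 - 1" "ln (real Q) \<le> l / 2"
    proof -
      have "ln (sqrt x / 2) \<le> ln (real Q)" using Q(2) x Q(3) by (subst ln_le_cancel_iff) auto
      moreover have "ln (sqrt x / 2) = l / 2 - ln 2" using x by (simp add: ln_div ln_sqrt l_def)
      ultimately show "ln (real Q) \<ge> l / 2 - 1" using ln_le_minus_one[of 2] by simp
      have "ln (real Q) \<le> ln (sqrt x)" using Q x by (subst ln_le_cancel_iff) auto
      thus "ln (real Q) \<le> l / 2" using x by (simp add: ln_sqrt l_def)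
    qed
    have m: "real m \<le> ln (real Q) / ln y" "real m > ln (real Q) / ln y - 1"
    proof -
      have "ln (real Q) / ln y \<ge> 0" using Q y1 by simp
      thus "real m \<le> ln (real Q) / ln y" unfolding m_def by (rule of_nat_floor)
      show "real m > ln (real Q) / ln y - 1" unfolding m_def by linarith
    qed
    have mup: "real m \<le> l / (6 * ln l)"
    proof -
      have "ln (real Q) / ln y \<le> (l / 2) / ln y" using lnQ lny lnl by (intro divide_right_mono) auto
      thus ?thesis using m lny by simp
    qed
    have mlow: "real m \<ge> l / (7 * ln l)"
    proof -
      have "ln (real Q) / ln y \<ge> (l / 2 - 1) / (3 * ln l)" unfolding lny using lnQ lnl by (intro divide_right_mono) auto
      moreover have "(l / 2 - 1) / (3 * ln l) - 1 \<ge> l / (7 * ln l)" using elim by (simp add: l_def)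
      ultimately show ?thesis using m by linarith
    qed
    have m0: "real m > 0" using mlow l lnl by (smt (verit) divide_pos_pos)
    have u: "\<epsilon>\<^sup>2 * l - 1 \<ge> l powr (1/2)" using elim by (simp add: l_def)
    have lp: "l powr (1/2) > 0" using l by simp
    have Tm: "T - real m \<ge> real m * (\<epsilon>\<^sup>2 * l - 1)"
    proof -
      have "real m * (\<epsilon>\<^sup>2 * l) \<le> l / (6 * ln l) * (\<epsilon>\<^sup>2 * l)"
        using mup l by (intro mult_right_mono) auto
      also have "\<dots> = \<epsilon>\<^sup>2 * l\<^sup>2 / (6 * ln l)" by (simp add: power2_eq_square)
      finally show ?thesis using Tge by (simp add: algebra_simps)
    qed
    define E where "E = {U. U \<subseteq> P \<and> card U = m}"
    have sym: "(T - real m) ^ m \<le> fact m * (\<Sum>U\<in>E. \<Prod>p\<in>U. h p)"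
      unfolding T_def E_def
    proof (rule elementary_symmetric_lower[OF finP \<nu> _ order_refl])
      have "0 \<le> \<epsilon>\<^sup>2 * l - 1" using u lp by linarith
      hence "0 \<le> real m * (\<epsilon>\<^sup>2 * l - 1)" by simp
      thus "real m \<le> (\<Sum>p\<in>P. h p)" using Tm by (simp add: T_def)
    qed
    have "real m ^ m * (l powr (1/2)) ^ m = (real m * l powr (1/2)) ^ m" by (simp add: power_mult_distrib)
    also have "\<dots> \<le> (T - real m) ^ m"
    proof (rule power_mono)
      have "real m * l powr (1/2) \<le> real m * (\<epsilon>\<^sup>2 * l - 1)" using u by (intro mult_left_mono) auto
      thus "real m * l powr (1/2) \<le> T - real m" using Tm by linarith
    qed (use m0 lp in auto)
    also have "\<dots> \<le> fact m * (\<Sum>U\<in>E. \<Prod>p\<in>U. h p)" by (rule sym)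
    also have "\<dots> \<le> real m ^ m * (\<Sum>U\<in>E. \<Prod>p\<in>U. h p)"
      using fact_le_power[of m, where 'a = real] \<nu>
      by (intro mult_right_mono sum_nonneg prod_nonneg) (auto simp: E_def)
    finally have "real m ^ m * (l powr (1/2)) ^ m \<le> real m ^ m * (\<Sum>U\<in>E. \<Prod>p\<in>U. h p)" .
    hence low: "(l powr (1/2)) ^ m \<le> (\<Sum>U\<in>E. \<Prod>p\<in>U. h p)"
      using m0 by (subst (asm) mult_le_cancel_left_pos) auto
    \<comment> \<open>At least l / (7 ln l) factors, each equal to exp(ln l / 2), give exp(l /
      14).\<close>
    have low': "x powr (1/14) \<le> (\<Sum>U\<in>E. \<Prod>p\<in>U. h p)"
    proof -
      have "x powr (1/14) = exp (l / (7 * ln l) * (ln l / 2))"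
        using x lnl by (simp add: powr_def l_def)
      also have "\<dots> \<le> exp (real m * (ln l / 2))"
        unfolding exp_le_cancel_iff using mlow lnl by (intro mult_right_mono) auto
      also have "\<dots> = (l powr (1/2)) ^ m" using l by (simp add: powr_def exp_of_nat_mult [symmetric])
      finally show ?thesis using low by linarith
    qed
    have EU: "finite U" "\<Prod>U \<le> Q" if "U \<in> E" for U
    proof -
      show "finite U" using that finP by (auto simp: E_def dest: finite_subset)
      have "real (\<Prod>U) = (\<Prod>p\<in>U. real p)" by simp
      also have "\<dots> \<le> (\<Prod>p\<in>U. y)" using that P(2) by (intro prod_mono) (auto simp: E_def)
      also have "\<dots> = exp (ln y) ^ m" using that y1 by (simp add: E_def)
      also have "\<dots> = exp (real m * ln y)" by (simp add: exp_of_nat_mult)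
      also have "\<dots> \<le> exp (ln (real Q))" using m(1) lny lnl by (simp add: pos_le_divide_eq)
      also have "\<dots> = real Q" using Q by simp
      finally show "\<Prod>U \<le> Q" by (simp only: of_nat_le_iff)
    qed
    have "counting A x \<le> sqrt x + real x0 + 1 + 8 * x / x powr (1/14)"
    proof (rule sieve_bound[where D = "\<lambda>p. {b\<in>B. p < b \<and> x0 < b}" and Q = Q and \<Q> = E])
      show "x \<ge> 1" using x by simp
      show "real Q \<le> sqrt x" by (rule Q(1))
      show "finite E" using finP by (simp add: E_def)
      show "x powr (1/14) > 0" using x by simp
      fix U assume U: "U \<in> E"
      show "finite U" "\<Prod>U \<le> Q" using EU[OF U] by simp_all
      show "prime p" if "p \<in> U" for p using P(1) U that by (auto simp: E_def)
    next
      assume lt: "\<And>U p. U \<in> E \<Longrightarrow> p \<in> U \<Longrightarrow> real (card ((\<lambda>b. b mod p) ` {b\<in>B. p < b \<and> x0 < b})) < real p"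
      have "(\<Sum>U\<in>E. \<Prod>p\<in>U. h p) \<le> (\<Sum>U\<in>E. \<Prod>p\<in>U. \<nu> p / (real p - \<nu> p))"
      proof (intro sum_mono prod_mono conjI)
        fix U p assume Up: "U \<in> E" "p \<in> U"
        hence p: "p \<in> P" by (auto simp: E_def)
        have "\<nu> p < real p" using lt[OF Up] by (simp add: \<nu>_def residue_count_def)
        thus "h p \<le> \<nu> p / (real p - \<nu> p)" unfolding h_def by (intro divide_left_mono) (auto simp: \<nu>_def)
        show "0 \<le> h p" using \<nu>(1)[OF p] .
      qed
      thus "x powr (1/14) \<le> (\<Sum>U\<in>E. \<Prod>p\<in>U. real (card ((\<lambda>b. b mod p) ` {b\<in>B. p < b \<and> x0 < b})) /
          (real p - real (card ((\<lambda>b. b mod p) ` {b\<in>B. p < b \<and> x0 < b}))))"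
        using low' unfolding \<nu>_def residue_count_def by linarith
    qed auto
    thus ?case using elim by linarith
  qed
qed

end

section \<open>Growth up to powers of the logarithm\<close>

text \<open>The inequality ln u \<le> u - 1 makes the deficit linear in 1/\<nu>, which is what the
  larger sieve controls; p/\<nu> - 2 still vanishes at half of the classes.\<close>

lemma sieve_loss_term_le:
  fixes p :: nat and \<nu> :: real
  assumes "0 < \<nu>" "\<nu> < real p"
  shows "max 0 (- ln (\<nu> / (real p - \<nu>))) \<le> max 0 (real p / \<nu> - 2)"
proof -
  have "- ln (\<nu> / (real p - \<nu>)) = ln ((real p - \<nu>) / \<nu>)"
    using assms by (simp add: ln_div)
  also have "\<dots> \<le> (real p - \<nu>) / \<nu> - 1" using assms by (intro ln_le_minus_one) auto
  also have "\<dots> = real p / \<nu> - 2" using assms by (simp add: field_simps)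
  finally show ?thesis by (simp add: max.mono)
qed

lemma ln_ratio_block_sum:
  assumes f: "\<And>p. f p \<ge> (0 :: real)"
  shows "(\<Sum>p\<in>primes_in (exp (4 ^ j)) (exp (4 ^ Suc j)). f p)
           \<le> (\<Sum>p\<in>primes_in 1 (exp (4 ^ Suc j)). ln (real p) * f p) / 4 ^ j"
proof -
  have one: "(1 :: real) \<le> exp (4 ^ j)" by simp
  have "(\<Sum>p\<in>primes_in (exp (4 ^ j)) (exp (4 ^ Suc j)). f p) * 4 ^ j
      = (\<Sum>p\<in>primes_in (exp (4 ^ j)) (exp (4 ^ Suc j)). 4 ^ j * f p)"
    unfolding sum_distrib_right by (simp only: mult.commute)
  also have "\<dots> \<le> (\<Sum>p\<in>primes_in (exp (4 ^ j)) (exp (4 ^ Suc j)). ln (real p) * f p)"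
  proof (intro sum_mono mult_right_mono f)
    fix p assume "p \<in> primes_in (exp (4 ^ j)) (exp (4 ^ Suc j))"
    hence p: "exp (4 ^ j) < real p" by (simp add: primes_in_def)
    moreover have "real p > 0" using p by (rule less_trans[OF exp_gt_zero])
    ultimately show "4 ^ j \<le> ln (real p)" by (simp add: ln_ge_iff)
  qed
  also have "\<dots> \<le> (\<Sum>p\<in>primes_in 1 (exp (4 ^ Suc j)). ln (real p) * f p)"
  proof (rule sum_mono2[OF finite_primes_in])
    show "primes_in (exp (4 ^ j)) (exp (4 ^ Suc j)) \<subseteq> primes_in 1 (exp (4 ^ Suc j))"
    proof
      fix p assume p: "p \<in> primes_in (exp (4 ^ j)) (exp (4 ^ Suc j))"
      hence "exp (4 ^ j) < real p" by (simp add: primes_in_def)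
      hence "1 < real p" using one by linarith
      thus "p \<in> primes_in 1 (exp (4 ^ Suc j))" using p by (simp add: primes_in_def)
    qed
    fix p assume "p \<in> primes_in 1 (exp (4 ^ Suc j)) - primes_in (exp (4 ^ j)) (exp (4 ^ Suc j))"
    hence "real p > 1" by (simp add: primes_in_def)
    thus "0 \<le> ln (real p) * f p" using f by simp
  qed
  finally show ?thesis by (simp add: field_simps)
qed

context prime_sumset
begin

lemma residue_count_bounds:
  assumes "infinite A" "infinite B" "prime p"
  shows "0 < residue_count A x0 p" "residue_count A x0 p < p"
proof -
  have "residue_count A x0 p > 0" "residue_count B x0 p > 0"
    using assms by (auto intro: residue_count_pos prime_gt_0_nat)
  thus "0 < residue_count A x0 p" "residue_count A x0 p < p"
    using residue_count_add_le[OF assms(3)] by auto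
qed

text \<open>\<open>X y\<close> solves X^\<beta> = 4y, so A has at least 4y elements up to it, enough
  for the larger sieve at level y; the resulting bound ln X is a multiple of ln y.\<close>

lemma sum_residue_count_le:
  assumes \<beta>: "\<beta> > 0" and cnt: "\<forall>\<^sub>F x in at_top. counting A x \<ge> x powr \<beta>"
  obtains K where "K > 0" "\<forall>\<^sub>F y in at_top. (\<Sum>p\<in>primes_in 1 y. ln (real p) / real (residue_count A x0 p)) \<le> K * ln y"
proof -
  define X where "X y = (4 * y) powr (1 / \<beta>)" for y :: real
  have "filterlim X at_top at_top" unfolding X_def using \<beta> by real_asymp
  hence "\<forall>\<^sub>F y in at_top. counting A (X y) \<ge> X y powr \<beta>" "\<forall>\<^sub>F y in at_top. X y \<ge> 1"
    using cnt by (auto simp: filterlim_iff eventually_ge_at_top)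
  moreover have "\<forall>\<^sub>F y in at_top. 4 * y \<ge> 2 * y + real x0 + 2" by real_asymp
  moreover have "\<forall>\<^sub>F y in at_top. 2 + ln 4 / \<beta> \<le> ln y" by real_asymp
  ultimately have "\<forall>\<^sub>F y in at_top. (\<Sum>p\<in>primes_in 1 y. ln (real p) / real (residue_count A x0 p)) \<le> (1 / \<beta> + 1) * ln y"
    using eventually_ge_at_top[of 1]
  proof eventually_elim
    case (elim y)
    have "X y powr \<beta> = 4 * y" using elim \<beta> by (simp add: X_def powr_powr)
    hence "(\<Sum>p\<in>primes_in 1 y. ln (real p) / real (residue_count A x0 p)) \<le> 2 + ln (X y)"
      using elim by (intro larger_sieve_bound[of y "X y"]) auto
    also have "ln (X y) = ln 4 / \<beta> + ln y / \<beta>"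
      using elim by (simp add: X_def ln_powr ln_mult add_divide_distrib)
    also have "2 + (ln 4 / \<beta> + ln y / \<beta>) \<le> (1 / \<beta> + 1) * ln y"
      using elim by (simp add: distrib_right)
    finally show ?case .
  qed
  thus thesis using that[of "1 / \<beta> + 1"] \<beta> by (simp add: add_pos_pos)
qed

text \<open>Without its -2 the deficit per prime is at most 1/\<nu> p, so a block contributes at
  most K 4^(j + 1) / 4^j = 4K, and about ln ln z blocks lie below z. The finitely many blocks before
  the bound sets in go into \<open>c0\<close>.\<close>

lemma sieve_loss_log_log:
  assumes inf: "infinite A" "infinite B"
    and K: "K > 0" "\<forall>\<^sub>F y in at_top. (\<Sum>p\<in>primes_in 1 y. ln (real p) / real (residue_count A x0 p)) \<le> K * ln y"
  obtains c where "c > 0" "\<forall>\<^sub>F z in at_top. sieve_loss A x0 z \<le> c * ln (ln z)"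
proof -
  define \<nu> where "\<nu> p = real (residue_count A x0 p)" for p
  define f where "f p = max 0 (- ln (\<nu> p / (real p - \<nu> p))) / real p" for p
  define block where "block j = (\<Sum>p\<in>primes_in (exp (4 ^ j)) (exp (4 ^ Suc j)). f p)" for j
  have f0: "f p \<ge> 0" for p by (simp add: f_def)
  have fle: "f p \<le> 1 / \<nu> p" if "prime p" for p
  proof -
    have p: "0 < \<nu> p" "\<nu> p < real p" using residue_count_bounds[OF inf that] by (auto simp: \<nu>_def)
    have "f p \<le> max 0 (real p / \<nu> p - 2) / real p"
      unfolding f_def using sieve_loss_term_le[OF p] by (intro divide_right_mono) auto
    also have "\<dots> \<le> (real p / \<nu> p) / real p" using p by (intro divide_right_mono) auto
    finally show ?thesis using p by simp
  qed
  have lim: "filterlim (\<lambda>j. exp (4 ^ Suc j) :: real) at_top sequentially" by real_asymp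
  have "\<forall>\<^sub>F j in sequentially. block j \<le> 4 * K"
    using filterlim_iff[THEN iffD1, OF lim, rule_format, OF K(2)]
  proof eventually_elim
    case (elim j)
    have "block j \<le> (\<Sum>p\<in>primes_in 1 (exp (4 ^ Suc j)). ln (real p) * f p) / 4 ^ j"
      unfolding block_def using f0 by (rule ln_ratio_block_sum)
    also have "(\<Sum>p\<in>primes_in 1 (exp (4 ^ Suc j)). ln (real p) * f p) \<le> (\<Sum>p\<in>primes_in 1 (exp (4 ^ Suc j)). ln (real p) / \<nu> p)"
    proof (rule sum_mono)
      fix p assume "p \<in> primes_in 1 (exp (4 ^ Suc j))"
      hence "prime p" "real p > 1" by (auto simp: primes_in_def)
      hence "ln (real p) * f p \<le> ln (real p) * (1 / \<nu> p)" using fle by (intro mult_left_mono) auto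
      thus "ln (real p) * f p \<le> ln (real p) / \<nu> p" by simp
    qed
    also have "\<dots> \<le> K * 4 ^ Suc j" using elim by (simp add: \<nu>_def)
    finally show ?case by (simp add: divide_right_mono)
  qed
  then obtain j0 where j0: "\<And>j. j \<ge> j0 \<Longrightarrow> block j \<le> 4 * K" by (auto simp: eventually_sequentially)
  define c0 where "c0 = (\<Sum>p\<in>primes_in 1 (exp 1). f p) + (\<Sum>j<j0. block j)"
  have block0: "block j \<ge> 0" for j unfolding block_def using f0 by (intro sum_nonneg) auto
  have bd: "sieve_loss A x0 (exp (4 ^ J)) \<le> c0 + 4 * K * real J" for J
  proof -
    have "sieve_loss A x0 (exp (4 ^ J)) = (\<Sum>p\<in>primes_in 1 (exp 1). f p) + (\<Sum>j<J. block j)"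
      unfolding sieve_loss_def block_def f_def \<nu>_def by (rule sum_primes_in_blocks)
    also have "(\<Sum>j<J. block j) \<le> (\<Sum>j<J. (if j < j0 then block j else 0) + 4 * K)"
      using j0 K(1) by (intro sum_mono) (auto simp: not_less)
    also have "\<dots> = (\<Sum>j\<in>{..<J} \<inter> {..<j0}. block j) + 4 * K * real J"
      by (simp add: sum.distrib sum.If_cases Int_def lessThan_def)
    also have "(\<Sum>j\<in>{..<J} \<inter> {..<j0}. block j) \<le> (\<Sum>j<j0. block j)"
      using block0 by (intro sum_mono2) auto
    finally show ?thesis by (simp add: c0_def)
  qed
  have "\<forall>\<^sub>F z :: real in at_top. c0 + 4 * K * (ln (ln z) + 1) \<le> (8 * K) * ln (ln z)" using K(1) by real_asymp
  hence "\<forall>\<^sub>F z in at_top. sieve_loss A x0 z \<le> (8 * K) * ln (ln z)"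
    using eventually_ge_at_top[of "exp 1"]
  proof eventually_elim
    case (elim z)
    have "z > 0" using elim exp_gt_zero[of "1 :: real"] by linarith
    hence z: "z > 0" "ln z \<ge> 1" using elim by (simp_all add: ln_ge_iff)
    define J where "J = nat \<lceil>ln (ln z) / ln 4\<rceil>"
    have ln4: "ln (4 :: real) \<ge> 1" using exp_le by (simp add: ln_ge_iff)
    have J1: "ln (ln z) / ln 4 \<le> real J" unfolding J_def by linarith
    have l0: "ln (ln z) \<ge> 0" using z by simp
    have "real J < ln (ln z) / ln 4 + 1" unfolding J_def using l0 ln4 by simp linarith
    also have "ln (ln z) / ln 4 \<le> ln (ln z)" using l0 ln4 by (simp add: divide_le_eq mult_le_cancel_left1)
    finally have J2: "real J \<le> ln (ln z) + 1" by simp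
    have "ln (ln z) \<le> real J * ln 4" using J1 ln4 by (simp add: divide_le_eq)
    hence "exp (ln (ln z)) \<le> exp (real J * ln 4)" by simp
    moreover have "exp (ln (ln z)) = ln z" using z by (intro exp_ln) linarith
    ultimately have "ln z \<le> 4 ^ J" by (simp add: exp_of_nat_mult)
    hence "exp (ln z) \<le> exp (4 ^ J)" by (simp only: exp_le_cancel_iff)
    hence "z \<le> exp (4 ^ J)" using z by simp
    hence "sieve_loss A x0 z \<le> sieve_loss A x0 (exp (4 ^ J))" by (rule sieve_loss_mono)
    also have "\<dots> \<le> c0 + 4 * K * real J" by (rule bd)
    also have "\<dots> \<le> c0 + 4 * K * (ln (ln z) + 1)" using J2 K(1) by (intro add_left_mono mult_left_mono) auto
    finally show ?case using elim by linarith
  qed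
  thus thesis using that[of "8 * K"] K(1) by simp
qed

lemma counting_upper_log_power:
  assumes inf: "infinite A" "infinite B"
    and c: "c > 0" "\<forall>\<^sub>F z in at_top. sieve_loss B x0 z \<le> c * ln (ln z)"
  shows "\<forall>\<^sub>F x in at_top. counting A x \<le> sqrt x * ln x powr (4 * c + 1)"
proof -
  have lim: "filterlim (\<lambda>x :: real. sqrt x) at_top at_top" by real_asymp
  have "\<forall>\<^sub>F x in at_top. sqrt x + real x0 + 1 + 64 * sqrt x * ln x powr (4 * c) \<le> sqrt x * ln x powr (4 * c + 1)"
    using c(1) by real_asymp
  thus ?thesis
    using filterlim_iff[THEN iffD1, OF lim, rule_format, OF c(2)] eventually_ge_at_top[of 16]
      eventually_gt_at_top[of "exp 2"]
  proof eventually_elim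
    case (elim x)
    have lx: "ln x > 2" using elim by (smt (verit) exp_gt_zero ln_exp ln_less_cancel_iff)
    have "counting A x \<le> sqrt x + real x0 + 1 + 64 * sqrt x * exp (4 * sieve_loss B x0 (sqrt x))"
      using elim inf by (intro sieve_bound_residue_count) auto
    also have "exp (4 * sieve_loss B x0 (sqrt x)) \<le> exp (4 * (c * ln (ln x)))"
    proof -
      have "ln (ln (sqrt x)) \<le> ln (ln x)" using elim lx by (simp add: ln_sqrt)
      hence "c * ln (ln (sqrt x)) \<le> c * ln (ln x)" using c(1) by simp
      thus ?thesis using elim by simp
    qed
    also have "\<dots> = ln x powr (4 * c)" using lx by (simp add: powr_def mult_ac)
    finally show ?case using elim by (simp add: mult_left_mono)
  qed
qed

lemma counting_lower_from_upper:
  assumes "\<forall>\<^sub>F x in at_top. counting A x \<le> F x" "\<forall>\<^sub>F x in at_top. F x > 0"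
  obtains c where "c > 0" "\<forall>\<^sub>F x in at_top. counting B x \<ge> c * (x / ln x) / F x"
proof -
  obtain c where c: "c > 0" "\<forall>\<^sub>F x in at_top. c * (x / ln x) \<le> counting A x * counting B x"
    using counting_product_lower by blast
  have "\<forall>\<^sub>F x in at_top. counting B x \<ge> c * (x / ln x) / F x"
    using assms c(2)
  proof eventually_elim
    case (elim x)
    have "c * (x / ln x) \<le> F x * counting B x"
      using elim counting_nonneg[of B x] by (meson mult_right_mono order_trans)
    hence "c * (x / ln x) \<le> counting B x * F x" by (simp only: mult.commute)
    thus ?case using elim by (subst pos_divide_le_eq)
  qed
  thus thesis using that c(1) by blast
qed

text \<open>The point is the leading coefficient 2, the value that \<nu> p = p/2 at every prime
  would produce. It comes from X of order y^2 up to logarithms: the exponent 2C + 2 gives sqrt X /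
  (ln X)^C \<ge> y l^(C + 1) / (3 l)^C with l = ln y, which exceeds 4y thanks to one spare
  logarithm, and costs only a multiple of ln ln y in ln X.\<close>

lemma sum_residue_count_sharp:
  assumes C: "C \<ge> 0" and cnt: "\<forall>\<^sub>F x in at_top. counting A x \<ge> sqrt x / ln x powr C"
  shows "\<forall>\<^sub>F y in at_top. (\<Sum>p\<in>primes_in 1 y. ln (real p) / real (residue_count A x0 p))
           \<le> 2 + 2 * ln y + (2 * C + 2) * ln (ln y)"
proof -
  define X where "X y = y\<^sup>2 * ln y powr (2 * C + 2)" for y :: real
  have "filterlim X at_top at_top" unfolding X_def using C by real_asymp
  hence "\<forall>\<^sub>F y in at_top. counting A (X y) \<ge> sqrt (X y) / ln (X y) powr C" "\<forall>\<^sub>F y in at_top. X y \<ge> 1"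
    using cnt by (auto simp: filterlim_iff eventually_ge_at_top)
  moreover have "\<forall>\<^sub>F y in at_top. 4 * y \<ge> 2 * y + real x0 + 2" by real_asymp
  moreover have "\<forall>\<^sub>F y in at_top. (2 * C + 2) * ln (ln y) \<le> ln y" using C by real_asymp
  moreover have "\<forall>\<^sub>F y in at_top. ln y \<ge> 4 * 3 powr C" by real_asymp
  moreover have "\<forall>\<^sub>F y :: real in at_top. ln y > 1" by real_asymp
  ultimately show ?thesis using eventually_gt_at_top[of 1]
  proof eventually_elim
    case (elim y)
    define l where "l = ln y"
    have l: "l > 1" using elim by (simp add: l_def)
    have lnX: "ln (X y) = 2 * l + (2 * C + 2) * ln l"
      using elim by (simp add: X_def l_def ln_mult ln_realpow ln_powr)
    have X3: "ln (X y) \<le> 3 * l" "ln (X y) > 0"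
      using elim l C by (auto simp: lnX l_def intro!: add_pos_nonneg)
    have "sqrt (X y) = y * l powr (C + 1)"
    proof -
      have "X y = (y * l powr (C + 1))\<^sup>2"
      proof -
        have "(l powr (C + 1))\<^sup>2 = l powr (2 * C + 2)"
          by (simp add: power2_eq_square flip: powr_add)
        thus ?thesis by (simp add: X_def l_def power_mult_distrib)
      qed
      thus ?thesis using elim by simp
    qed
    have "4 * y * (3 * l) powr C \<le> y * l powr (C + 1)"
    proof -
      have "4 * y * (3 * l) powr C = y * l powr C * (4 * 3 powr C)" using l by (simp add: powr_mult)
      also have "\<dots> \<le> y * l powr C * l" using elim by (intro mult_left_mono) (auto simp: l_def)
      also have "\<dots> = y * l powr (C + 1)" using l by (simp add: powr_add)
      finally show ?thesis .
    qed
    hence "4 * y \<le> y * l powr (C + 1) / (3 * l) powr C" using l by (simp add: pos_le_divide_eq)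
    also have "\<dots> \<le> sqrt (X y) / ln (X y) powr C"
      unfolding \<open>sqrt (X y) = y * l powr (C + 1)\<close> using X3 l C elim
      by (intro divide_left_mono powr_mono2 mult_pos_pos mult_nonneg_nonneg) auto
    finally have "2 * y + real x0 + 2 \<le> counting A (X y)" using elim by linarith
    hence "(\<Sum>p\<in>primes_in 1 y. ln (real p) / real (residue_count A x0 p)) \<le> 2 + ln (X y)"
      using elim by (intro larger_sieve_bound[of y "X y"]) auto
    thus ?case by (simp add: lnX l_def)
  qed
qed

end

section \<open>Removing the powers of the logarithm\<close>

text \<open>
  The two larger sieve bounds leave almost no slack in \<open>1/\<alpha> + 1/\<beta> \<ge> 4\<close> for the densities
  \<open>\<alpha> + \<beta> \<le> 1\<close> of occupied residue classes, which forces both to be near \<open>1/2\<close> on average.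
\<close>

lemma harmonic_deficit:
  fixes a b P \<delta> :: real
  assumes ab: "a > 0" "b > 0" "a + b \<le> P" and \<delta>: "0 < \<delta>" "\<delta> \<le> 1"
  shows "P / a + P / b - 4 \<ge> 0" "max 0 (P / a - 2) \<le> \<delta> + 2 / \<delta> * (P / a + P / b - 4)"
proof -
  define t where "t = P / a - 2"
  define D where "D = P / a + P / b - 4"
  have P: "P > a" using ab by simp
  have t1: "1 + t > 0" using P ab by (simp add: t_def)
  \<comment> \<open>Replacing b by its largest value P - a turns the lower bound for
    \<open>D\<close> into t^2/(1 + t), a function of t alone that is quadratic at 0. A small
    \<open>D\<close> therefore forces t to be small; the free parameter \<delta> converts this into
    a bound linear in \<open>D\<close>.\<close>
  have "P / b \<ge> P / (P - a)" using ab P by (intro divide_left_mono) auto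
  also have "P / (P - a) = (t + 2) / (1 + t)"
    using ab P t1 by (simp add: t_def field_simps)
  finally have "D \<ge> t + 2 + (t + 2) / (1 + t) - 4" by (simp add: D_def t_def)
  also have "t + 2 + (t + 2) / (1 + t) - 4 = t\<^sup>2 / (1 + t)"
    using t1 by (simp add: field_simps power2_eq_square)
  finally have D: "D \<ge> t\<^sup>2 / (1 + t)" .
  moreover have "t\<^sup>2 / (1 + t) \<ge> 0" using t1 by simp
  ultimately have D0: "D \<ge> 0" by linarith
  thus "P / a + P / b - 4 \<ge> 0" by (simp add: D_def)
  have "max 0 t \<le> \<delta> + 2 / \<delta> * D"
  proof (cases "t \<le> \<delta>")
    case True
    have "2 / \<delta> * D \<ge> 0" using \<delta> D0 by simp
    thus ?thesis using True \<delta> by linarith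
  next
    case False
    hence t: "t > \<delta>" by simp
    have "\<delta> * t \<le> 1 * t" using t \<delta> by (intro mult_right_mono) auto
    hence "\<delta> * (1 + t) \<le> 2 * t" using t by (simp add: algebra_simps)
    hence "t * (\<delta> * (1 + t)) \<le> t * (2 * t)" using t \<delta> by (intro mult_left_mono) auto
    hence "t \<le> t * (2 * t) / (\<delta> * (1 + t))" using \<delta> t1 by (subst pos_le_divide_eq) auto
    also have "\<dots> = 2 / \<delta> * (t\<^sup>2 / (1 + t))" by (simp add: power2_eq_square)
    also have "\<dots> \<le> 2 / \<delta> * D" using D \<delta> by (intro mult_left_mono) auto
    finally show ?thesis using t \<delta> by simp
  qed
  thus "max 0 (P / a - 2) \<le> \<delta> + 2 / \<delta> * (P / a + P / b - 4)" by (simp add: t_def D_def)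
qed

context prime_sumset
begin

text \<open>Adding the two sharp larger sieve bounds and subtracting four times Mertens' lower bound
  cancels the leading terms, 2 + 2 - 4 = 0, so the sum of ln p D p / p up to y is O(ln ln y). With a
  value of \<delta> adapted to each block, the deficit inequality then makes the block sums
  summable, and their total bounds the loss for all z at once.\<close>

lemma sieve_loss_bounded:
  assumes inf: "infinite A" "infinite B" and C: "C \<ge> 0"
    and cntA: "\<forall>\<^sub>F x in at_top. counting A x \<ge> sqrt x / ln x powr C"
    and cntB: "\<forall>\<^sub>F x in at_top. counting B x \<ge> sqrt x / ln x powr C"
  obtains M where "\<And>z. sieve_loss A x0 z \<le> M"
proof -
  define \<nu> where "\<nu> p = real (residue_count A x0 p)" for p
  define \<mu> where "\<mu> p = real (residue_count B x0 p)" for p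
  \<comment> \<open>At primes the maximum is inactive; it makes \<open>D\<close> nonnegative at
    every argument, as the block estimate asks.\<close>
  define D where "D p = max 0 (real p / \<nu> p + real p / \<mu> p - 4)" for p
  define f where "f p = max 0 (- ln (\<nu> p / (real p - \<nu> p))) / real p" for p
  define block where "block j = (\<Sum>p\<in>primes_in (exp (4 ^ j)) (exp (4 ^ Suc j)). f p)" for j
  obtain CM where CM: "CM > 0" "\<And>z. z \<ge> 1 \<Longrightarrow> (\<Sum>p\<in>primes_in 1 z. ln (real p) / real p) \<ge> ln z - CM"
    using mertens_lower by blast
  define a where "a = 4 + 4 * CM"
  define b where "b = 4 * C + 4"
  have ab: "a > 0" "b > 0" using CM(1) C by (auto simp: a_def b_def)
  have \<nu>: "0 < \<nu> p" "\<nu> p < real p" "0 < \<mu> p" "\<nu> p + \<mu> p \<le> real p" if "prime p" for p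
    using residue_count_bounds[OF inf that] prime_sumset.residue_count_bounds[OF swap inf(2,1) that]
      residue_count_add_le[OF that] by (auto simp: \<nu>_def \<mu>_def)
  have f0: "f p \<ge> 0" for p by (simp add: f_def)
  have Deq: "D p = real p / \<nu> p + real p / \<mu> p - 4" if "prime p" for p
    using harmonic_deficit(1)[OF \<nu>(1,3,4)[OF that], of 1] by (simp add: D_def)
  have fle: "f p \<le> (1 / real p) * (\<delta> + 2 / \<delta> * D p)" if "prime p" "0 < \<delta>" "\<delta> \<le> 1" for p \<delta>
  proof -
    have "f p \<le> max 0 (real p / \<nu> p - 2) / real p"
      unfolding f_def using sieve_loss_term_le[OF \<nu>(1,2)[OF that(1)]] by (intro divide_right_mono) auto
    also have "\<dots> \<le> (\<delta> + 2 / \<delta> * D p) / real p"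
      using harmonic_deficit(2)[OF \<nu>(1,3,4)[OF that(1)] that(2,3)] Deq[OF that(1)]
      by (intro divide_right_mono) auto
    finally show ?thesis by simp
  qed
  have "\<forall>\<^sub>F y in at_top. (\<Sum>p\<in>primes_in 1 y. ln (real p) * (D p / real p)) \<le> a + b * ln (ln y)"
    using sum_residue_count_sharp[OF C cntA] prime_sumset.sum_residue_count_sharp[OF swap C cntB]
      eventually_ge_at_top[of 1]
  proof eventually_elim
    case (elim y)
    have "(\<Sum>p\<in>primes_in 1 y. ln (real p) * (D p / real p))
        = (\<Sum>p\<in>primes_in 1 y. ln (real p) / \<nu> p + ln (real p) / \<mu> p - 4 * (ln (real p) / real p))"
    proof (rule sum.cong[OF refl])
      fix p assume "p \<in> primes_in 1 y"
      hence p: "prime p" "real p > 0" by (auto simp: primes_in_def)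
      show "ln (real p) * (D p / real p) = ln (real p) / \<nu> p + ln (real p) / \<mu> p - 4 * (ln (real p) / real p)"
        using p(2) \<nu>[OF p(1)] by (simp add: Deq[OF p(1)] field_simps)
    qed
    also have "\<dots> = (\<Sum>p\<in>primes_in 1 y. ln (real p) / \<nu> p) + (\<Sum>p\<in>primes_in 1 y. ln (real p) / \<mu> p)
        - 4 * (\<Sum>p\<in>primes_in 1 y. ln (real p) / real p)"
      by (simp add: sum.distrib sum_subtractf sum_distrib_left)
    finally show ?case
      using elim CM(2)[of y] unfolding \<nu>_def[symmetric] \<mu>_def[symmetric] a_def b_def
      by (simp add: algebra_simps)
  qed
  moreover have "filterlim (\<lambda>j. exp (4 ^ Suc j) :: real) at_top sequentially" by real_asymp
  ultimately have "\<forall>\<^sub>F j in sequentially. (\<Sum>p\<in>primes_in 1 (exp (4 ^ Suc j)). ln (real p) * (D p / real p))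
      \<le> a + b * ln (ln (exp (4 ^ Suc j)))"
    by (rule eventually_compose_filterlim)
  hence "\<forall>\<^sub>F j in sequentially. block j \<le> (1 / 2) ^ j * (6 + 2 * a + 4 * b * (real j + 1))"
  proof eventually_elim
    case (elim j)
    \<comment> \<open>Block j receives O(\<delta>) from Mertens' theorem and O((j + 1) / (\<delta>
      4^j)) from \<open>D\<close>. Taking \<delta> = 2^(-j) makes both O((j + 1) 2^(-j)), eventually
      below (3/4)^j.\<close>
    define \<delta> where "\<delta> = (1 / 2 :: real) ^ j"
    have \<delta>: "0 < \<delta>" "\<delta> \<le> 1" by (auto simp: \<delta>_def power_le_one)
    have "block j \<le> (\<Sum>p\<in>primes_in (exp (4 ^ j)) (exp (4 ^ Suc j)). (1 / real p) * (\<delta> + 2 / \<delta> * D p))"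
      unfolding block_def using fle \<delta> by (intro sum_mono) (auto simp: primes_in_def)
    also have "\<dots> \<le> (\<Sum>p\<in>primes_in 1 (exp (4 ^ Suc j)). ln (real p) * ((1 / real p) * (\<delta> + 2 / \<delta> * D p))) / 4 ^ j"
      using \<delta> by (intro ln_ratio_block_sum) (auto simp: D_def intro!: mult_nonneg_nonneg divide_nonneg_nonneg)
    also have "(\<Sum>p\<in>primes_in 1 (exp (4 ^ Suc j)). ln (real p) * ((1 / real p) * (\<delta> + 2 / \<delta> * D p)))
        = \<delta> * (\<Sum>p\<in>primes_in 1 (exp (4 ^ Suc j)). ln (real p) / real p)
          + 2 / \<delta> * (\<Sum>p\<in>primes_in 1 (exp (4 ^ Suc j)). ln (real p) * (D p / real p))"
      unfolding sum_distrib_left sum.distrib[symmetric]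
      by (intro sum.cong refl) (simp add: distrib_left add_divide_distrib mult_ac)
    also have "(\<Sum>p\<in>primes_in 1 (exp (4 ^ Suc j)). ln (real p) / real p) \<le> 4 * 4 ^ j + 2"
      using mertens_upper[of "exp (4 ^ Suc j)"] by simp
    also have "(\<Sum>p\<in>primes_in 1 (exp (4 ^ Suc j)). ln (real p) * (D p / real p)) \<le> a + 2 * b * (real j + 1)"
    proof -
      have "ln (ln (exp ((4 :: real) ^ Suc j))) = ln (4 ^ Suc j)" by (simp only: ln_exp)
      also have "\<dots> = real (Suc j) * ln 4" by (rule ln_realpow)
      also have "\<dots> \<le> real (Suc j) * 2"
        using ln_realpow[of 2 2] ln_le_minus_one[of 2] by (intro mult_left_mono) auto
      finally have "b * ln (ln (exp ((4 :: real) ^ Suc j))) \<le> b * (real (Suc j) * 2)"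
        using ab by (intro mult_left_mono) auto
      thus ?thesis using elim by (simp add: algebra_simps)
    qed
    finally have "block j \<le> (\<delta> * (4 * 4 ^ j + 2) + 2 / \<delta> * (a + 2 * b * (real j + 1))) / 4 ^ j"
      using \<delta> by (simp add: mult_left_mono divide_right_mono)
    also have "\<dots> = \<delta> * (4 + 2 / 4 ^ j) + \<delta> * (2 * (a + 2 * b * (real j + 1)))"
    proof -
      have "\<delta> * \<delta> * 4 ^ j = 1" unfolding \<delta>_def by (simp flip: power_mult_distrib)
      hence "1 / \<delta> / 4 ^ j = \<delta>" using \<delta> by (simp add: field_simps)
      hence "2 / \<delta> * (a + 2 * b * (real j + 1)) / 4 ^ j = \<delta> * (2 * (a + 2 * b * (real j + 1)))"
        by (simp add: divide_inverse mult_ac)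
      thus ?thesis by (simp add: add_divide_distrib distrib_left)
    qed
    also have "\<dots> \<le> \<delta> * 6 + \<delta> * (2 * (a + 2 * b * (real j + 1)))"
    proof -
      have "2 / (4 :: real) ^ j \<le> 2" by (simp add: divide_le_eq)
      thus ?thesis using \<delta> by (intro add_right_mono mult_left_mono) auto
    qed
    also have "\<dots> = \<delta> * (6 + 2 * a + 4 * b * (real j + 1))" by (simp add: algebra_simps)
    finally show ?case by (simp add: \<delta>_def)
  qed
  moreover have "\<forall>\<^sub>F j in sequentially. (1 / 2) ^ j * (6 + 2 * a + 4 * b * (real j + 1)) \<le> (3 / 4) ^ j"
    using ab by real_asymp
  ultimately have "\<forall>\<^sub>F j in sequentially. norm (block j) \<le> (3 / 4) ^ j"
  proof eventually_elim
    case (elim j)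
    have "block j \<ge> 0" unfolding block_def using f0 by (intro sum_nonneg) auto
    thus ?case using elim by simp
  qed
  hence summ: "summable block" by (rule summable_comparison_test_ev) (simp add: summable_geometric_iff)
  have "sieve_loss A x0 z \<le> (\<Sum>p\<in>primes_in 1 (exp 1). f p) + (\<Sum>j. block j)" for z
  proof -
    have "filterlim (\<lambda>J. exp (4 ^ J) :: real) at_top sequentially" by real_asymp
    hence "\<forall>\<^sub>F J in sequentially. z \<le> exp (4 ^ J)" by (simp add: filterlim_at_top)
    then obtain J where "z \<le> exp (4 ^ J)" by (auto simp: eventually_sequentially)
    hence "sieve_loss A x0 z \<le> sieve_loss A x0 (exp (4 ^ J))" by (rule sieve_loss_mono)
    also have "\<dots> = (\<Sum>p\<in>primes_in 1 (exp 1). f p) + (\<Sum>j<J. block j)"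
      unfolding sieve_loss_def block_def f_def \<nu>_def by (rule sum_primes_in_blocks)
    also have "(\<Sum>j<J. block j) \<le> (\<Sum>j. block j)"
      using f0 by (intro sum_le_suminf summ) (auto simp: block_def intro!: sum_nonneg)
    finally show ?thesis by simp
  qed
  thus thesis using that by blast
qed

section \<open>Growth rates of the two counting functions\<close>

lemma counting_upper_sqrt:
  assumes inf: "infinite A" "infinite B" and M: "\<And>z. sieve_loss B x0 z \<le> M"
  obtains K where "K > 0" "\<forall>\<^sub>F x in at_top. counting A x \<le> K * sqrt x"
proof -
  have "\<forall>\<^sub>F x in at_top. sqrt x + real x0 + 1 \<le> 2 * sqrt x" by real_asymp
  hence "\<forall>\<^sub>F x in at_top. counting A x \<le> (2 + 64 * exp (4 * M)) * sqrt x"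
    using eventually_ge_at_top[of 4]
  proof eventually_elim
    case (elim x)
    have "counting A x \<le> sqrt x + real x0 + 1 + 64 * sqrt x * exp (4 * sieve_loss B x0 (sqrt x))"
      using elim inf by (intro sieve_bound_residue_count) auto
    also have "64 * sqrt x * exp (4 * sieve_loss B x0 (sqrt x)) \<le> 64 * sqrt x * exp (4 * M)"
      using M elim by (intro mult_left_mono) auto
    finally show ?case using elim by (simp add: algebra_simps)
  qed
  thus thesis using that[of "2 + 64 * exp (4 * M)"] by (simp add: add_pos_pos)
qed

text \<open>Dividing x / ln x by x^(14/15) leaves x^(1/15) / ln x; the smaller exponent 1/20 absorbs
  the logarithm and the constant.\<close>

lemma counting_ge_small_power:
  assumes "\<exists>b\<in>B. \<exists>b'\<in>B. b \<noteq> b'"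
  shows "\<forall>\<^sub>F x in at_top. counting B x \<ge> x powr (1/20)"
proof -
  obtain c where c: "c > 0" "\<forall>\<^sub>F x in at_top. c * ln x powr 4 \<le> counting B x"
    using counting_ge_log_power[OF assms] by blast
  have pos: "\<forall>\<^sub>F x :: real in at_top. x powr (14/15) > 0" by real_asymp
  obtain d where d: "d > 0" "\<forall>\<^sub>F x in at_top. counting B x \<ge> d * (x / ln x) / x powr (14/15)"
    using counting_lower_from_upper[OF counting_power_saving[OF c] pos] by blast
  have "\<forall>\<^sub>F x in at_top. d * (x / ln x) / x powr (14/15) \<ge> x powr (1/20)" using d(1) by real_asymp
  with d(2) show ?thesis by eventually_elim linarith
qed

text \<open>The growth of B is amplified through A: it bounds the sieve loss of B, hence A(x) by
  sqrt x (ln x)^(4c + 1), and the product bound returns to B. Of the two further logarithms in 4c +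
  3, one comes from the prime count and one absorbs the constant \<open>d\<close>.\<close>

lemma counting_ge_sqrt_div_log_power:
  assumes inf: "infinite A" "infinite B" and cnt: "\<forall>\<^sub>F x in at_top. counting B x \<ge> x powr (1/20)"
  obtains C where "C \<ge> 0" "\<forall>\<^sub>F x in at_top. counting B x \<ge> sqrt x / ln x powr C"
proof -
  obtain K where K: "K > 0" "\<forall>\<^sub>F y in at_top. (\<Sum>p\<in>primes_in 1 y. ln (real p) / real (residue_count B x0 p)) \<le> K * ln y"
    using prime_sumset.sum_residue_count_le[OF swap _ cnt] by auto
  obtain c where c: "c > 0" "\<forall>\<^sub>F z in at_top. sieve_loss B x0 z \<le> c * ln (ln z)"
    using prime_sumset.sieve_loss_log_log[OF swap inf(2,1) K] by blast
  have pos: "\<forall>\<^sub>F x in at_top. sqrt x * ln x powr (4 * c + 1) > 0" by real_asymp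
  obtain d where d: "d > 0" "\<forall>\<^sub>F x in at_top. counting B x \<ge> d * (x / ln x) / (sqrt x * ln x powr (4 * c + 1))"
    using counting_lower_from_upper[OF counting_upper_log_power[OF inf c] pos] by blast
  have "\<forall>\<^sub>F x in at_top. d * (x / ln x) / (sqrt x * ln x powr (4 * c + 1)) \<ge> sqrt x / ln x powr (4 * c + 3)"
    using d(1) c(1) by real_asymp
  with d(2) have "\<forall>\<^sub>F x in at_top. counting B x \<ge> sqrt x / ln x powr (4 * c + 3)"
    by eventually_elim linarith
  thus thesis using that[of "4 * c + 3"] c(1) by simp
qed

lemma counting_upper:
  assumes two: "\<exists>a\<in>A. \<exists>a'\<in>A. a \<noteq> a'" "\<exists>b\<in>B. \<exists>b'\<in>B. b \<noteq> b'"
  obtains K where "K > 0" "\<forall>\<^sub>F x in at_top. counting A x \<le> K * sqrt x"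
proof -
  have inf: "infinite A" "infinite B"
    using infinite_summand[OF two(2)] prime_sumset.infinite_summand[OF swap two(1)] by auto
  obtain CB where CB: "CB \<ge> 0" "\<forall>\<^sub>F x in at_top. counting B x \<ge> sqrt x / ln x powr CB"
    using counting_ge_sqrt_div_log_power[OF inf counting_ge_small_power[OF two(2)]] by blast
  obtain CA where CA: "CA \<ge> 0" "\<forall>\<^sub>F x in at_top. counting A x \<ge> sqrt x / ln x powr CA"
    using prime_sumset.counting_ge_sqrt_div_log_power[OF swap inf(2,1)
        prime_sumset.counting_ge_small_power[OF swap two(1)]] by blast
  \<comment> \<open>\<open>sieve_loss_bounded\<close> takes one exponent for both sets; the larger
    exponent gives the weaker bound as soon as ln x \<ge> 1.\<close>
  define C where "C = max CA CB"
  have weaken: "\<forall>\<^sub>F x in at_top. counting S x \<ge> sqrt x / ln x powr C"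
    if "C' \<le> C" "\<forall>\<^sub>F x in at_top. counting S x \<ge> sqrt x / ln x powr C'" for S C'
    using that(2) eventually_ge_at_top[of "exp 1"]
  proof eventually_elim
    case (elim x)
    have x0: "x > 0" using elim exp_gt_zero[of "1 :: real"] by linarith
    have lx: "ln x \<ge> 1" using elim x0 by (simp add: ln_ge_iff)
    have "sqrt x / ln x powr C \<le> sqrt x / ln x powr C'"
      using lx x0 that(1) by (intro divide_left_mono powr_mono mult_pos_pos) auto
    thus ?case using elim by linarith
  qed
  have C: "C \<ge> 0" "CB \<le> C" "CA \<le> C" using CA(1) by (auto simp: C_def)
  obtain M where "\<And>z. sieve_loss B x0 z \<le> M"
    using prime_sumset.sieve_loss_bounded[OF swap inf(2,1) C(1) weaken[OF C(2) CB(2)] weaken[OF C(3) CA(2)]]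
    by blast
  thus thesis using counting_upper_sqrt[OF inf] that by blast
qed

text \<open>Eventually ln ln x exceeds both K and K/d, so the constant is 1 whatever the sets are.
  The lower bound for B is the upper bound for A passed through the product bound; exchanging the
  sets supplies the other two estimates.\<close>

lemma vinogradov_bounds:
  assumes two: "\<exists>a\<in>A. \<exists>a'\<in>A. a \<noteq> a'" "\<exists>b\<in>B. \<exists>b'\<in>B. b \<noteq> b'"
  shows "(\<lambda>x. x powr (1/2) / (ln x * ln (ln x))) \<lless>[1] counting B"
    "counting A \<lless>[1] (\<lambda>x. x powr (1/2) * ln (ln x))"
proof -
  obtain K where K: "K > 0" "\<forall>\<^sub>F x in at_top. counting A x \<le> K * sqrt x"
    using counting_upper[OF two] by blast
  have "\<forall>\<^sub>F x in at_top. K * sqrt x \<le> x powr (1/2) * ln (ln x)" by real_asymp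
  with K(2) show "counting A \<lless>[1] (\<lambda>x. x powr (1/2) * ln (ln x))"
    unfolding vinogradov_def by eventually_elim simp
  have pos: "\<forall>\<^sub>F x in at_top. K * sqrt x > 0" using K(1) by real_asymp
  obtain d where d: "d > 0" "\<forall>\<^sub>F x in at_top. counting B x \<ge> d * (x / ln x) / (K * sqrt x)"
    using counting_lower_from_upper[OF K(2) pos] by blast
  have "\<forall>\<^sub>F x in at_top. x powr (1/2) / (ln x * ln (ln x)) \<le> d * (x / ln x) / (K * sqrt x)"
    using K(1) d(1) by real_asymp
  with d(2) show "(\<lambda>x. x powr (1/2) / (ln x * ln (ln x))) \<lless>[1] counting B"
    unfolding vinogradov_def by eventually_elim simp
qed

end

theorem theorem2p6:
  "\<exists>C1>0. \<exists>C2>0. \<forall>A B :: nat set.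
     0 \<notin> A \<longrightarrow> 0 \<notin> B \<longrightarrow>
     (\<exists>a\<in>A. \<exists>a'\<in>A. a \<noteq> a') \<longrightarrow> (\<exists>b\<in>B. \<exists>b'\<in>B. b \<noteq> b') \<longrightarrow>
     {p. prime p} \<sim>\<^sub>e A + B \<longrightarrow>
       (\<lambda>x. x powr (1/2) / (ln x * ln (ln x))) \<lless>[C1] counting A \<and>
       counting A \<lless>[C2] (\<lambda>x. x powr (1/2) * ln (ln x)) \<and>
       (\<lambda>x. x powr (1/2) / (ln x * ln (ln x))) \<lless>[C1] counting B \<and>
       counting B \<lless>[C2] (\<lambda>x. x powr (1/2) * ln (ln x))"
proof (rule exI[of _ 1], rule conjI[OF zero_less_one], rule exI[of _ 1], rule conjI[OF zero_less_one], intro allI impI)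
  fix A B :: "nat set"
  assume two: "\<exists>a\<in>A. \<exists>a'\<in>A. a \<noteq> a'" "\<exists>b\<in>B. \<exists>b'\<in>B. b \<noteq> b'"
  assume "{p. prime p} \<sim>\<^sub>e A + B"
  then obtain x0 where eq: "(A + B) \<inter> {x0..} = {p. prime p} \<inter> {x0..}"
    unfolding ev_eq_set_def by blast
  interpret prime_sumset A B x0
  proof
    fix a b assume "a \<in> A" "b \<in> B" "x0 \<le> a + b"
    hence "a + b \<in> (A + B) \<inter> {x0..}" by (auto intro: set_plus_intro)
    thus "prime (a + b)" unfolding eq by simp
  next
    fix p assume "prime p" "x0 \<le> p"
    hence "p \<in> (A + B) \<inter> {x0..}" unfolding eq by simp
    thus "\<exists>a\<in>A. \<exists>b\<in>B. p = a + b" by (auto simp: set_plus_def)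
  qed
  show "(\<lambda>x. x powr (1/2) / (ln x * ln (ln x))) \<lless>[1] counting A \<and>
       counting A \<lless>[1] (\<lambda>x. x powr (1/2) * ln (ln x)) \<and>
       (\<lambda>x. x powr (1/2) / (ln x * ln (ln x))) \<lless>[1] counting B \<and>
       counting B \<lless>[1] (\<lambda>x. x powr (1/2) * ln (ln x))"
    using vinogradov_bounds[OF two] prime_sumset.vinogradov_bounds[OF swap two(2,1)] by blast
qed

end
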